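(* Let $h$ be a boundary function and suppose that (Poly-$\infty$) and $\mathbf{HK}^h_U$ hold. Then the following estimates hold for all $(t,x,y)\in(0,\infty)\times D\times D$ (with constants independent of $t,x,y$). (i) If $\psi(\rho(x,y))\le t$, then $$q(t,x,y)\simeq\frac{h(\phi^{-1}(1/t)^{-1},x,y)}{V(x,\psi^{-1}(t))}.$$ (ii) If $\psi(\rho(x,y))\ge t$, then $$q(t,x,y)\asymp\frac{C_0}{V(x,\rho(x,y))\Psi(\rho(x,y))}\bigg(t\,\mathcal{B}_h(t,x,y)+\frac{h(\phi^{-1}(1/t)^{-1},x,y)}{\phi^{-1}(1/t)}\bigg)$$ $$+\frac{h(\phi^{-1}(1/t)^{-1},x,y)}{V(x,\psi^{-1}(t))}\exp\Big(-\frac{c\,\rho(x,y)^2}{\psi^{-1}(t)^2}\Big)+h(\Phi(\rho(x,y)),x,y)\,\frac{t\,w(\Phi(\rho(x,y)))}{V(x,\rho(x,y))},$$ where $\mathcal{B}_h(t,x,y):=\int_{2\phi^{-1}(1/t)^{-1}}^{4\Phi(\rho(x,y))}h(s,x,y)\,w(s)\,ds$. Here $\asymp$ means that $q(t,x,y)$ is bounded below by $a_1$ times the right-hand side with $c=a_2$ and above by $a_3$ times the right-hand side with $c=a_4$, for some constants $a_1,a_2,a_3,a_4>0$.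
   Context: Notation: $a\wedge b=\min$, $a\vee b=\max$; $f\simeq g$ means $c_1g\le f\le c_2g$ on the specified range for some constants $c_1,c_2>0$. $\phi^{-1}(1/t)^{-1}=1/\phi^{-1}(1/t)$. Quotients $c/0$ with $c>0$ are $+\infty$. Subordinator: $S=(S_t)_{t\ge0}$ is a driftless subordinator (non-decreasing pure-jump Lévy process, $S_0=0$) with Laplace exponent $\phi(\lambda)=-\log\mathbb{E}e^{-\lambda S_1}=\int_0^\infty(1-e^{-\lambda s})\nu(ds)$ and $w(r):=\nu(r,\infty)$. Condition (Poly-$\infty$): there are constants $c_1,c_2>0$, $\beta_2\ge\beta_1>0$ with $c_1(R/r)^{\beta_1}\le w(r)/w(R)\le c_2(R/r)^{\beta_2}$ for all $0<r\le R<\infty$. Space and process: $(E,\rho)$ is a locally compact separable metric space in which all bounded closed sets are compact, $m$ is a positive Radon measure on $E$ with full support, $B(x,r)$ is the open ball, $V(x,r)=m(B(x,r))$. There are $R_E\in(0,\infty]$ and $d_2\ge d_1>0$ such that for every $a\ge1$ there is $C_V\ge1$ with $C_V^{-1}(R/r)^{d_1}\le V(x,R)/V(x,r)\le C_V(R/r)^{d_2}$ for all $x\in E$, $0<r\le R<aR_E$. $D\subset E$ is a proper open subset. $Y^D$ is a Hunt process in $D$ independent of $S$ whose semigroup has a density (heat kernel) $p_D(t,x,y)$ with respect to $m$; $X_t=Y^D_{S_t}$ has heat kernel $q(t,x,y)=\int_0^\infty p_D(s,x,y)\mathbb{P}(S_t\in ds)$. Scale functions: $\Phi,\Psi:[0,\infty)\to[0,\infty)$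 are strictly increasing, $\Psi\ge\Phi$, and for some constants $\alpha_1,\dots,\alpha_4,c_1,\dots,c_4>0$ and all $R\ge r>0$: $c_1(R/r)^{\alpha_1}\le\Phi(R)/\Phi(r)\le c_2(R/r)^{\alpha_2}$ and $c_3(R/r)^{\alpha_3}\le\Psi(R)/\Psi(r)\le c_4(R/r)^{\alpha_4}$. Set $\psi(r)=1/\phi(1/\Phi(r))$ for $r>0$, $\psi(0)=0$; thus $\psi^{-1}(t)=\Phi^{-1}(\phi^{-1}(1/t)^{-1})$. If $D$ is unbounded, $\Phi(\mathrm{diam}(D))$ is read as $\infty$. Boundary function: $h:(0,\infty)\times D\times D\to[0,1]$ such that (H1) $s\mapsto h(s,x,y)$ is non-increasing for all $x,y\in D$; (H2) there are $c_1>0$, $\gamma\ge0$ with $s^\gamma h(s,x,y)\le c_1t^\gamma h(t,x,y)$ for $0<s\le t<4\Phi(\mathrm{diam}(D))+1$, $x,y\in D$. Heat kernel condition: for $C_0\in\{0,1\}$ and $c>0$ put $$I_{c}(t,x,y)=\frac1{V(x,\Phi^{-1}(t))}\wedge\Big(\frac{C_0t}{V(x,\rho(x,y))\Psi(\rho(x,y))}+\frac1{V(x,\Phi^{-1}(t))}\exp\Big(-\frac{c\,\rho(x,y)^2}{\Phi^{-1}(t)^2}\Big)\Big)$$ (the first summand is absent if $C_0=0$). $\mathbf{HK}^h_U$: $R_E=\infty$ and there are $C_0\in\{0,1\}$ and $c_1,c_2,c_3,c_4>0$ with $c_1h(t,x,y)I_{c_2}(t,x,y)\le p_D(t,x,y)\le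 c_3h(t,x,y)I_{c_4}(t,x,y)$ for all $(t,x,y)\in(0,\infty)\times D\times D$. The constant $C_0$ in the claim is the one in this condition.
   Formalization: For bounded D, the upper bound in (i) is stated only for t with φ^{-1}(1/t)^{-1} < 4Φ(diam D)+1, the range of (H2); beyond it the bound can fail, e.g. for Brownian motion killed outside a ball with a stable subordinator. The rest is as stated. *)

theory Defs
  imports "HOL-Probability.Probability"
begin

section \<open>The state space\<close>

text \<open>
  The space \<open>E\<close> is (the universe of) a type of sorts \<open>heine_borel\<close> (bounded closed sets are
  compact; in particular \<open>E\<close> is locally compact) and \<open>second_countable_topology\<close> (separable).
  On such a space every Borel measure that is finite on compact sets is automatically regular,
  so that this finiteness is all that has to be said for \<open>m\<close> to be a Radon measure.
\<close>

definition radon_full_support ::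
    "'e::{heine_borel, second_countable_topology} measure \<Rightarrow> bool" where
  "radon_full_support m \<longleftrightarrow>
     sets m = sets borel \<and>
     (\<forall>K. compact K \<longrightarrow> emeasure m K < \<infinity>) \<and>
     (\<forall>U. open U \<and> U \<noteq> {} \<longrightarrow> 0 < emeasure m U)"

definition vol :: "'e::metric_space measure \<Rightarrow> 'e \<Rightarrow> real \<Rightarrow> real" where
  "vol m x r = measure m (ball x r)"

definition volume_growth :: "'e::metric_space measure \<Rightarrow> ereal \<Rightarrow> real \<Rightarrow> real \<Rightarrow> bool" where
  "volume_growth m R\<^sub>E d\<^sub>1 d\<^sub>2 \<longleftrightarrow>
     0 < R\<^sub>E \<and> 0 < d\<^sub>1 \<and> d\<^sub>1 \<le> d\<^sub>2 \<and>
     (\<forall>a\<ge>1. \<exists>C\<ge>1. \<forall>x r R. 0 < r \<and> r \<le> R \<and> ereal R < ereal a * R\<^sub>E \<longrightarrow>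
        inverse C * (R / r) powr d\<^sub>1 \<le> vol m x R / vol m x r \<and>
        vol m x R / vol m x r \<le> C * (R / r) powr d\<^sub>2)"


section \<open>Scale functions and inverses\<close>

text \<open>
  Inverse of an increasing function on \<open>[0,\<infinity>)\<close>.  A strictly increasing function need not be
  onto, so the (unambiguous) generalised inverse is used: for strictly increasing unbounded \<open>f\<close>
  the infimum is the same with \<open>\<le>\<close> in place of \<open><\<close>, it equals the supremum of
  \<open>{r. 0 \<le> r \<and> f r \<le> t}\<close> when \<open>f 0 \<le> t\<close>, and it is the ordinary inverse on the range of \<open>f\<close>.
\<close>

definition ginv :: "(real \<Rightarrow> real) \<Rightarrow> real \<Rightarrow> real" where
  "ginv f t = Inf {r. 0 \<le> r \<and> t < f r}"

definition power_scaling :: "(real \<Rightarrow> real) \<Rightarrow> bool" where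
  "power_scaling f \<longleftrightarrow>
     (\<exists>a\<^sub>1>0. \<exists>a\<^sub>2>0. \<exists>c\<^sub>1>0. \<exists>c\<^sub>2>0. \<forall>r R. 0 < r \<and> r \<le> R \<longrightarrow>
        c\<^sub>1 * (R / r) powr a\<^sub>1 \<le> f R / f r \<and> f R / f r \<le> c\<^sub>2 * (R / r) powr a\<^sub>2)"

definition scale_functions :: "(real \<Rightarrow> real) \<Rightarrow> (real \<Rightarrow> real) \<Rightarrow> bool" where
  "scale_functions \<Phi> \<Psi> \<longleftrightarrow>
     (\<forall>r\<ge>0. 0 \<le> \<Phi> r \<and> 0 \<le> \<Psi> r \<and> \<Phi> r \<le> \<Psi> r) \<and>
     strict_mono_on {0..} \<Phi> \<and> strict_mono_on {0..} \<Psi> \<and>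
     power_scaling \<Phi> \<and> power_scaling \<Psi>"


section \<open>Subordinators\<close>

definition levy_measure :: "real measure \<Rightarrow> bool" where
  "levy_measure \<nu> \<longleftrightarrow>
     sets \<nu> = sets borel \<and> emeasure \<nu> {..0} = 0 \<and> (\<integral>\<^sup>+s. ennreal (min 1 s) \<partial>\<nu>) < \<infinity>"

definition levy_tail :: "real measure \<Rightarrow> real \<Rightarrow> real" where
  "levy_tail \<nu> r = measure \<nu> {r<..}"

definition laplace_exponent :: "real measure \<Rightarrow> real \<Rightarrow> real" where
  "laplace_exponent \<nu> \<xi> = (\<integral>s. 1 - exp (- \<xi> * s) \<partial>\<nu>)"

text \<open>
  \<open>S\<close> is a subordinator with Levy measure \<open>\<nu>\<close> and without drift or killing: the last clause is
  the Levy-Khintchine formula with no linear and no constant term.  Left limits of the paths need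
  not be mentioned since the paths are monotone.
\<close>

definition driftless_subordinator ::
    "'w measure \<Rightarrow> (real \<Rightarrow> 'w \<Rightarrow> real) \<Rightarrow> real measure \<Rightarrow> bool" where
  "driftless_subordinator M S \<nu> \<longleftrightarrow>
     prob_space M \<and> levy_measure \<nu> \<and>
     (\<forall>t\<ge>0. S t \<in> borel_measurable M) \<and>
     (AE \<omega> in M. S 0 \<omega> = 0 \<and> mono_on {0..} (\<lambda>t. S t \<omega>) \<and>
        (\<forall>t\<ge>0. continuous (at_right t) (\<lambda>u. S u \<omega>))) \<and>
     (\<forall>\<tau> :: nat \<Rightarrow> real. \<forall>n. 0 \<le> \<tau> 0 \<and> mono \<tau> \<longrightarrow>
        prob_space.indep_vars M (\<lambda>_. borel) (\<lambda>i \<omega>. S (\<tau> (Suc i)) \<omega> - S (\<tau> i) \<omega>) {..<n}) \<and>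
     (\<forall>s\<ge>0. \<forall>t\<ge>0. distr M borel (\<lambda>\<omega>. S (s + t) \<omega> - S s \<omega>) = distr M borel (S t)) \<and>
     (\<forall>\<xi>>0. - ln (\<integral>\<omega>. exp (- \<xi> * S 1 \<omega>) \<partial>M) = laplace_exponent \<nu> \<xi>)"

definition Poly_infinity :: "(real \<Rightarrow> real) \<Rightarrow> bool" where
  "Poly_infinity w \<longleftrightarrow>
     (\<exists>c\<^sub>1>0. \<exists>c\<^sub>2>0. \<exists>\<beta>\<^sub>1>0. \<exists>\<beta>\<^sub>2\<ge>\<beta>\<^sub>1. \<forall>r R. 0 < r \<and> r \<le> R \<longrightarrow>
        c\<^sub>1 * (R / r) powr \<beta>\<^sub>1 \<le> w r / w R \<and> w r / w R \<le> c\<^sub>2 * (R / r) powr \<beta>\<^sub>2)"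

definition sub_scale :: "(real \<Rightarrow> real) \<Rightarrow> (real \<Rightarrow> real) \<Rightarrow> real \<Rightarrow> real" where
  "sub_scale \<phi> \<Phi> r = (if r = 0 then 0 else 1 / \<phi> (1 / \<Phi> r))"


section \<open>Hunt processes\<close>

text \<open>
  The cemetery is \<open>None\<close>; it is adjoined to \<open>D\<close> as the point at infinity (an isolated point
  if \<open>D\<close> is compact).
\<close>

definition cemetery_space :: "'e::topological_space set \<Rightarrow> 'e option topology" where
  "cemetery_space D = Alexandroff_compactification (top_of_set D)"

definition cemetery_borel :: "'e::topological_space set \<Rightarrow> 'e option measure" where
  "cemetery_borel D =
     sigma (topspace (cemetery_space D)) {U. openin (cemetery_space D) U}"

text \<open>
  Time runs through \<open>[0,\<infinity>]\<close>, represented by \<open>ennreal\<close>, with \<open>Y\<^sub>\<infinity>\<close> the cemetery, so stopping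
  times take values in \<open>ennreal\<close>.  The measures \<open>P x\<close> live on one measurable space, that of
  \<open>P None\<close>.  The strong Markov property and quasi-left-continuity are required under every
  \<open>P x\<close>, for one right-continuous filtration to which \<open>Y\<close> is adapted; since they pass to
  the right-continuous natural filtration, they then hold for every initial law as well.
\<close>

definition strong_markov ::
    "'e::topological_space set \<Rightarrow> ('e option \<Rightarrow> 'w measure) \<Rightarrow> (ennreal \<Rightarrow> 'w \<Rightarrow> 'e option) \<Rightarrow>
     (ennreal \<Rightarrow> 'w measure) \<Rightarrow> bool" where
  "strong_markov D P Y F \<longleftrightarrow>
     (\<forall>\<sigma> s. \<forall>x\<in>topspace (cemetery_space D). \<forall>B\<in>sets (cemetery_borel D).
        stopping_time F \<sigma> \<longrightarrow>
        (AE \<omega> in P x.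
           real_cond_exp (P x) (filtration.pre_sigma (space (P None)) F \<sigma>)
             (indicator {\<omega>'\<in>space (P None). Y (\<sigma> \<omega>' + s) \<omega>' \<in> B}) \<omega>
           = measure (P (Y (\<sigma> \<omega>) \<omega>)) {\<omega>'\<in>space (P None). Y s \<omega>' \<in> B}))"

definition quasi_left_continuous ::
    "'e::topological_space set \<Rightarrow> ('e option \<Rightarrow> 'w measure) \<Rightarrow> (ennreal \<Rightarrow> 'w \<Rightarrow> 'e option) \<Rightarrow>
     (ennreal \<Rightarrow> 'w measure) \<Rightarrow> bool" where
  "quasi_left_continuous D P Y F \<longleftrightarrow>
     (\<forall>\<sigma> :: nat \<Rightarrow> 'w \<Rightarrow> ennreal. \<forall>x\<in>topspace (cemetery_space D).
        (\<forall>n. stopping_time F (\<sigma> n)) \<and> (\<forall>\<omega>\<in>space (P None). incseq (\<lambda>n. \<sigma> n \<omega>)) \<longrightarrow>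
        (AE \<omega> in P x. (SUP n. \<sigma> n \<omega>) < \<infinity> \<longrightarrow>
           limitin (cemetery_space D) (\<lambda>n. Y (\<sigma> n \<omega>) \<omega>) (Y (SUP n. \<sigma> n \<omega>) \<omega>) sequentially))"

definition hunt_process ::
    "'e::topological_space set \<Rightarrow> ('e option \<Rightarrow> 'w measure) \<Rightarrow> (ennreal \<Rightarrow> 'w \<Rightarrow> 'e option) \<Rightarrow>
     bool" where
  "hunt_process D P Y \<longleftrightarrow>
     (let \<Omega> = space (P None); T = cemetery_space D; \<B> = cemetery_borel D in
      (\<forall>x\<in>topspace T. prob_space (P x) \<and> sets (P x) = sets (P None)) \<and>
      (\<forall>t. Y t \<in> P None \<rightarrow>\<^sub>M \<B>) \<and>
      (\<forall>t. \<forall>B\<in>sets \<B>. (\<lambda>x. measure (P x) {\<omega>\<in>\<Omega>. Y t \<omega> \<in> B}) \<in> borel_measurable \<B>) \<and>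
      (\<forall>x\<in>topspace T. AE \<omega> in P x. Y 0 \<omega> = x) \<and>
      (\<forall>\<omega>\<in>\<Omega>. Y \<infinity> \<omega> = None \<and> (\<forall>s t. s \<le> t \<and> Y s \<omega> = None \<longrightarrow> Y t \<omega> = None)) \<and>
      (\<forall>t. \<exists>\<theta>\<in>\<Omega> \<rightarrow> \<Omega>. \<forall>s. \<forall>\<omega>\<in>\<Omega>. Y s (\<theta> \<omega>) = Y (s + t) \<omega>) \<and>
      (\<forall>\<omega>\<in>\<Omega>. \<forall>t<\<infinity>. limitin T (\<lambda>u. Y u \<omega>) (Y t \<omega>) (at_right t)) \<and>
      (\<forall>\<omega>\<in>\<Omega>. \<forall>t<\<infinity>. 0 < t \<longrightarrow> (\<exists>l. limitin T (\<lambda>u. Y u \<omega>) l (at_left t))) \<and>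
      (\<exists>F. filtration \<Omega> F \<and>
           (\<forall>t. sets (F t) \<subseteq> sets (P None) \<and> Y t \<in> F t \<rightarrow>\<^sub>M \<B>) \<and>
           (\<forall>t<\<infinity>. sets (F t) = (\<Inter>u\<in>{t<..}. sets (F u))) \<and>
           strong_markov D P Y F \<and> quasi_left_continuous D P Y F))"

text \<open>Independence of the sigma-algebras generated by the whole processes.\<close>

definition independent_of_subordinator ::
    "'e::topological_space set \<Rightarrow> 'w measure \<Rightarrow> (ennreal \<Rightarrow> 'w \<Rightarrow> 'e option) \<Rightarrow>
     (real \<Rightarrow> 'w \<Rightarrow> real) \<Rightarrow> bool" where
  "independent_of_subordinator D M Y S \<longleftrightarrow>
     prob_space.indep_set M
       (sets (vimage_algebra (space M) (\<lambda>\<omega>. \<lambda>t\<in>UNIV. Y t \<omega>)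
          (\<Pi>\<^sub>M t\<in>UNIV. cemetery_borel D)))
       (sets (vimage_algebra (space M) (\<lambda>\<omega>. \<lambda>t\<in>{0..}. S t \<omega>) (\<Pi>\<^sub>M t\<in>{0..}. borel)))"

text \<open>
  Heat kernels take values in \<open>[0,\<infinity>]\<close>; that those of the theorem are finite is part of the
  two-sided bounds.
\<close>

definition heat_kernel ::
    "'e::{heine_borel, second_countable_topology} measure \<Rightarrow> 'e set \<Rightarrow>
     ('e option \<Rightarrow> 'w measure) \<Rightarrow> (ennreal \<Rightarrow> 'w \<Rightarrow> 'e option) \<Rightarrow>
     (real \<Rightarrow> 'e \<Rightarrow> 'e \<Rightarrow> ennreal) \<Rightarrow> bool" where
  "heat_kernel m D P Y p \<longleftrightarrow>
     (\<lambda>(t, x, y). p t x y) \<in> borel_measurable (restrict_space borel ({0<..} \<times> D \<times> D)) \<and>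
     (\<forall>t>0. \<forall>x\<in>D. \<forall>B\<in>sets borel. B \<subseteq> D \<longrightarrow>
        emeasure (P (Some x)) {\<omega>\<in>space (P None). Y (ennreal t) \<omega> \<in> Some ` B}
        = (\<integral>\<^sup>+y\<in>B. p t x y \<partial>m))"

text \<open>
  The heat kernel of \<open>X\<^sub>t = Y\<^bsub>S\<^sub>t\<^esub>\<close>.  The law of \<open>S\<^sub>t\<close> is taken under \<open>P (Some x)\<close>; it is
  determined by the Levy measure and so does not depend on \<open>x\<close>.
\<close>

definition subordinate_heat_kernel ::
    "('e option \<Rightarrow> 'w measure) \<Rightarrow> (real \<Rightarrow> 'w \<Rightarrow> real) \<Rightarrow> (real \<Rightarrow> 'e \<Rightarrow> 'e \<Rightarrow> ennreal) \<Rightarrow>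
     real \<Rightarrow> 'e \<Rightarrow> 'e \<Rightarrow> ennreal" where
  "subordinate_heat_kernel P S p t x y =
     (\<integral>\<^sup>+s\<in>{0<..}. p s x y \<partial>distr (P (Some x)) borel (S t))"


section \<open>Boundary functions and heat kernel bounds\<close>

text \<open>
  The condition \<open>s < 4 \<Phi>(diam D) + 1\<close>, which is void for unbounded \<open>D\<close>.  Besides delimiting
  (H2), it delimits the near-diagonal upper bound of the theorem.  For bounded \<open>D\<close> this
  is unavoidable: beyond the range of (H2) nothing prevents \<open>h\<close> from decaying exponentially in
  time.  Brownian motion killed outside a ball satisfies HK-U with \<open>\<Phi>(r) = r\<^sup>2\<close>, \<open>C\<^sub>0 = 0\<close> and
  an \<open>h\<close> of order \<open>exp (- \<lambda> t) t\<^bsup>d/2\<^esup>\<close> for large \<open>t\<close>, where \<open>\<lambda>\<close> is the bottom eigenvalue; with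
  \<open>\<phi>(u) = u\<^bsup>a\<^esup>\<close>, \<open>0 < a < 1\<close>, the subordinate kernel decays like \<open>exp (- \<lambda>\<^bsup>a\<^esup> t)\<close>, and not like
  \<open>exp (- \<lambda> t\<^bsup>1/a\<^esup>)\<close>.
\<close>

definition below_diam :: "'e::metric_space set \<Rightarrow> (real \<Rightarrow> real) \<Rightarrow> real \<Rightarrow> bool" where
  "below_diam D \<Phi> s \<longleftrightarrow> (bounded D \<longrightarrow> s < 4 * \<Phi> (diameter D) + 1)"

definition boundary_function ::
    "'e::metric_space set \<Rightarrow> (real \<Rightarrow> real) \<Rightarrow> (real \<Rightarrow> 'e \<Rightarrow> 'e \<Rightarrow> real) \<Rightarrow> bool" where
  "boundary_function D \<Phi> h \<longleftrightarrow>
     (\<forall>s>0. \<forall>x\<in>D. \<forall>y\<in>D. 0 \<le> h s x y \<and> h s x y \<le> 1) \<and>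
     (\<forall>x\<in>D. \<forall>y\<in>D. antimono_on {0<..} (\<lambda>s. h s x y)) \<and>
     (\<exists>c>0. \<exists>\<gamma>\<ge>0. \<forall>s t. 0 < s \<and> s \<le> t \<and> below_diam D \<Phi> t \<longrightarrow>
        (\<forall>x\<in>D. \<forall>y\<in>D. s powr \<gamma> * h s x y \<le> c * t powr \<gamma> * h t x y))"

text \<open>
  Computed in \<open>ennreal\<close>, where \<open>c / 0 = \<infinity>\<close> for \<open>c > 0\<close> and \<open>0 / 0 = 0\<close>: on the diagonal, where
  \<open>vol m x 0 = 0\<close>, the first summand is infinite if \<open>C\<^sub>0 = 1\<close> and absent if \<open>C\<^sub>0 = 0\<close>.
\<close>

definition hk_profile ::
    "'e::metric_space measure \<Rightarrow> (real \<Rightarrow> real) \<Rightarrow> (real \<Rightarrow> real) \<Rightarrow> real \<Rightarrow> real \<Rightarrow>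
     real \<Rightarrow> 'e \<Rightarrow> 'e \<Rightarrow> ennreal" where
  "hk_profile m \<Phi> \<Psi> C\<^sub>0 c t x y =
     min (1 / ennreal (vol m x (ginv \<Phi> t)))
         (ennreal (C\<^sub>0 * t) / ennreal (vol m x (dist x y) * \<Psi> (dist x y))
          + 1 / ennreal (vol m x (ginv \<Phi> t))
            * ennreal (exp (- c * (dist x y)\<^sup>2 / (ginv \<Phi> t)\<^sup>2)))"

definition HK_U ::
    "'e::metric_space measure \<Rightarrow> ereal \<Rightarrow> 'e set \<Rightarrow> (real \<Rightarrow> real) \<Rightarrow> (real \<Rightarrow> real) \<Rightarrow>
     (real \<Rightarrow> 'e \<Rightarrow> 'e \<Rightarrow> real) \<Rightarrow> real \<Rightarrow> (real \<Rightarrow> 'e \<Rightarrow> 'e \<Rightarrow> ennreal) \<Rightarrow> bool" where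
  "HK_U m R\<^sub>E D \<Phi> \<Psi> h C\<^sub>0 p \<longleftrightarrow>
     R\<^sub>E = \<infinity> \<and> C\<^sub>0 \<in> {0, 1} \<and>
     (\<exists>c\<^sub>1>0. \<exists>c\<^sub>2>0. \<exists>c\<^sub>3>0. \<exists>c\<^sub>4>0. \<forall>t>0. \<forall>x\<in>D. \<forall>y\<in>D.
        ennreal (c\<^sub>1 * h t x y) * hk_profile m \<Phi> \<Psi> C\<^sub>0 c\<^sub>2 t x y \<le> p t x y \<and>
        p t x y \<le> ennreal (c\<^sub>3 * h t x y) * hk_profile m \<Phi> \<Psi> C\<^sub>0 c\<^sub>4 t x y)"

end

theory Submission
  imports Defs "HOL-Real_Asymp.Real_Asymp"
begin

text \<open>
  Write \<open>T = T(t) = 1 / \<phi>\<^sup>-\<^sup>1(1/t)\<close> and \<open>\<R> s\<close> for the inverse of \<open>\<Phi>\<close> at \<open>s\<close>, and let \<open>r\<close> be the distance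
  of \<open>x\<close> and \<open>y\<close>.  Then \<open>\<psi>(r) \<le> t\<close> means \<open>\<Phi> r \<le> T\<close>, and the inverse of \<open>\<psi>\<close> at \<open>t\<close> is \<open>\<R> T\<close>.  Since
  \<open>q t x y\<close> is the expectation of \<open>p (S t) x y\<close>, the task is to integrate the bounds for \<open>p\<close> against
  the law of \<open>S t\<close>.  Four facts about this law suffice, with constants that depend on \<open>\<nu>\<close> only:

  \<^item> \<open>S t\<close> lies between \<open>e T\<close> and \<open>T\<close> with probability bounded below (\<open>prob_between\<close>);
  \<^item> the probability of \<open>S t \<le> \<epsilon> T\<close> decays faster than every power of \<open>\<epsilon>\<close> (\<open>prob_below_T\<close>);
  \<^item> \<open>P(S t \<ge> s)\<close> is at most of order \<open>t w(s)\<close> when \<open>s \<ge> K T\<close> (\<open>tail_upper_bound\<close>);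
  \<^item> \<open>P(a < S t \<le> N a)\<close> is at least of order \<open>t w(a)\<close> when \<open>a \<ge> T\<close> (\<open>block_lower_bound\<close>).

  The upper end in the first fact has to be \<open>T\<close> itself and not a multiple of it, because \<open>h\<close> may
  drop by any amount just beyond \<open>T\<close> when \<open>D\<close> is bounded and \<open>T\<close> is large.  This is delicate when
  \<open>S t\<close> is nearly deterministic.  The proof compares Laplace transforms at \<open>\<lambda>\<close>, \<open>2\<lambda>\<close> and \<open>4\<lambda>\<close> for
  the \<open>\<lambda>\<close> with \<open>t (2\<phi>(\<lambda>) - \<phi>(2\<lambda>)) = 1\<close>, which adapts to the fluctuations of \<open>S t\<close>.

  The third fact is not a Laplace transform estimate: \<open>P(S t \<ge> s) \<le> C t \<phi>(1/s)\<close> is too weak when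
  \<open>w\<close> decays faster than \<open>1/s\<close>.  Here \<open>S t\<close> is split into \<open>n\<close> independent copies of \<open>S (t/n)\<close>,
  the increments are truncated at \<open>s/4\<close>, and \<open>n\<close> tends to infinity.  All that is needed about small
  times is the limit of \<open>n E (1 - exp (- S (t/n) / a))\<^sup>k\<close>, which is \<open>t\<close> times the integral of
  \<open>(1 - exp (- s / a))\<^sup>k\<close> against \<open>\<nu>\<close>; both sides are finite combinations of values of \<open>\<phi>\<close>.  For
  \<open>k \<ge> \<beta>\<^sub>2 + 1\<close> the jumps below \<open>a\<close> contribute at most a multiple of \<open>w(a)\<close> to this integral, so it is
  comparable with \<open>w(a)\<close>.  The fourth fact uses the same limit.

  With these facts the expectation is split at \<open>T\<close>, at \<open>2 K T\<close> and at \<open>\<Phi> r\<close>.  Below \<open>T\<close>, (H2) and volume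
  doubling lose a power of \<open>T / S t\<close>, which has bounded expectation.  Between \<open>T\<close> and \<open>2 K T\<close> all factors are
  bounded by their values at \<open>T\<close>, up to constants.  Between \<open>2 K T\<close> and \<open>\<Phi> r\<close>, the jump part of \<open>p\<close>
  requires the expectation of \<open>S t h (S t)\<close> on this event, which Tonelli's theorem and the tail bounds turn into
  \<open>t\<close> times the integral of \<open>h w\<close>, while the Gaussian factor beats every power of \<open>\<Phi> r / S t\<close> and
  so contributes no more than the last summand.  Above \<open>\<Phi> r\<close>, \<open>p\<close> is at most of order
  \<open>h (\<Phi> r) / V x r\<close>, and the tail bound gives the last summand.  The lower bounds come from the same
  regions.
\<close>

section \<open>Generalised inverses of scale functions\<close>

locale scale_function =
  fixes \<Phi> :: "real \<Rightarrow> real" and \<alpha>\<^sub>1 \<alpha>\<^sub>2 b\<^sub>1 b\<^sub>2 :: real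
  assumes nonneg: "\<And>r. 0 \<le> r \<Longrightarrow> 0 \<le> \<Phi> r"
    and strict: "strict_mono_on {0..} \<Phi>"
    and pos: "0 < \<alpha>\<^sub>1" "0 < \<alpha>\<^sub>2" "0 < b\<^sub>1" "0 < b\<^sub>2"
    and lower_scaling: "\<And>r R. 0 < r \<Longrightarrow> r \<le> R \<Longrightarrow> b\<^sub>1 * (R / r) powr \<alpha>\<^sub>1 \<le> \<Phi> R / \<Phi> r"
    and upper_scaling: "\<And>r R. 0 < r \<Longrightarrow> r \<le> R \<Longrightarrow> \<Phi> R / \<Phi> r \<le> b\<^sub>2 * (R / r) powr \<alpha>\<^sub>2"
begin

abbreviation "\<R> \<equiv> ginv \<Phi>"

lemma less: "0 \<le> r \<Longrightarrow> r < r' \<Longrightarrow> \<Phi> r < \<Phi> r'"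
  using strict by (auto simp: strict_mono_on_def)

lemma mono: "0 \<le> r \<Longrightarrow> r \<le> r' \<Longrightarrow> \<Phi> r \<le> \<Phi> r'"
  using less[of r r'] by (cases "r = r'") auto

lemma \<Phi>_pos: "0 < r \<Longrightarrow> 0 < \<Phi> r"
  using less[of 0 r] nonneg[of 0] by simp

lemma \<Phi>_unbounded: "\<exists>r>0. s < \<Phi> r"
proof -
  define k where "k = (max 1 (2 * \<bar>s\<bar> / (b\<^sub>1 * \<Phi> 1) + 1)) powr (1 / \<alpha>\<^sub>1)"
  have k1: "k \<ge> 1" unfolding k_def using pos by (intro ge_one_powr_ge_zero) auto
  have "k powr \<alpha>\<^sub>1 = max 1 (2 * \<bar>s\<bar> / (b\<^sub>1 * \<Phi> 1) + 1)"
    unfolding k_def using pos by (simp add: powr_powr)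
  hence ks: "k powr \<alpha>\<^sub>1 > 2 * \<bar>s\<bar> / (b\<^sub>1 * \<Phi> 1)" by linarith
  have P: "b\<^sub>1 * \<Phi> 1 > 0" using pos \<Phi>_pos[of 1] by simp
  have "b\<^sub>1 * k powr \<alpha>\<^sub>1 \<le> \<Phi> k / \<Phi> 1" using lower_scaling[of 1 k] k1 by simp
  hence "b\<^sub>1 * \<Phi> 1 * k powr \<alpha>\<^sub>1 \<le> \<Phi> k" using \<Phi>_pos[of 1] by (simp add: field_simps)
  moreover have "b\<^sub>1 * \<Phi> 1 * k powr \<alpha>\<^sub>1 > 2 * \<bar>s\<bar>" using ks P by (simp add: field_simps)
  ultimately have "s < \<Phi> k" by linarith
  thus ?thesis using k1 by (intro exI[of _ k]) auto
qed

lemma ginv_upper: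
  assumes "0 \<le> r" "s \<le> \<Phi> r" shows "\<R> s \<le> r"
proof (rule field_le_epsilon)
  fix e :: real assume e: "0 < e"
  have "s < \<Phi> (r + e)" using less[of r "r + e"] assms e by simp
  thus "\<R> s \<le> r + e" unfolding ginv_def using assms e
    by (intro cInf_lower) (auto intro!: bdd_belowI[of _ 0])
qed

lemma ginv_lower:
  assumes "0 \<le> r" "\<Phi> r \<le> s" shows "r \<le> \<R> s"
  unfolding ginv_def
proof (rule cInf_greatest)
  show "{r. 0 \<le> r \<and> s < \<Phi> r} \<noteq> {}" using \<Phi>_unbounded[of s] by (auto intro: less_imp_le)
  fix u assume "u \<in> {r. 0 \<le> r \<and> s < \<Phi> r}"
  thus "r \<le> u" using mono[of u r] assms by (auto intro: ccontr)
qed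

lemma \<Phi>_small: assumes "0 < s" shows "\<exists>r>0. \<Phi> r \<le> s"
proof -
  define k where "k = (max 1 (\<Phi> 1 / (b\<^sub>1 * s))) powr (1 / \<alpha>\<^sub>1)"
  have k1: "k \<ge> 1" unfolding k_def using pos by (intro ge_one_powr_ge_zero) auto
  have kk: "k powr \<alpha>\<^sub>1 = max 1 (\<Phi> 1 / (b\<^sub>1 * s))"
    unfolding k_def using pos by (simp add: powr_powr)
  have "b\<^sub>1 * k powr \<alpha>\<^sub>1 \<le> \<Phi> 1 / \<Phi> (1 / k)" using lower_scaling[of "1 / k" 1] k1 by simp
  moreover have "\<Phi> 1 / s \<le> b\<^sub>1 * k powr \<alpha>\<^sub>1"
    unfolding kk using pos assms by (simp add: max_def field_simps)
  ultimately have "\<Phi> 1 / s \<le> \<Phi> 1 / \<Phi> (1 / k)" by simp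
  hence "\<Phi> (1 / k) \<le> s" using \<Phi>_pos[of 1] \<Phi>_pos[of "1/k"] k1 assms
    by (simp add: field_simps)
  thus ?thesis using k1 by (intro exI[of _ "1 / k"]) auto
qed

lemma ginv_pos: assumes "0 < s" shows "0 < \<R> s"
proof -
  obtain r where "0 < r" "\<Phi> r \<le> s" using \<Phi>_small[OF assms] by blast
  thus ?thesis using ginv_lower[of r s] by simp
qed

lemma ginv_mono: "0 < s \<Longrightarrow> s \<le> u \<Longrightarrow> \<R> s \<le> \<R> u"
  unfolding ginv_def
  by (rule cInf_superset_mono) (use \<Phi>_unbounded[of u] in \<open>auto intro!: bdd_belowI[of _ 0] dest: less_imp_le\<close>)

lemma \<Phi>_below_ginv: assumes "0 < r" "r < \<R> s" shows "\<Phi> r \<le> s"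
  using ginv_upper[of r s] assms by force

lemma \<Phi>_above_ginv: assumes "0 < s" "\<R> s < r" shows "s \<le> \<Phi> r"
  using ginv_lower[of r s] ginv_pos[of s] assms by force

text \<open>
  \<open>\<Phi>\<close> may jump at \<open>\<R> s\<close> and \<open>\<R> u\<close>, so its scaling is used at \<open>2 \<R> s\<close> and \<open>\<R> u / 2\<close>, where it is on the
  known side of \<open>s\<close> and \<open>u\<close>.  This costs the factor \<open>4\<close>.
\<close>

lemma ginv_scaling:
  "\<exists>C\<ge>1. \<forall>s u. 0 < s \<and> s \<le> u \<longrightarrow> \<R> u \<le> C * (u / s) powr (1 / \<alpha>\<^sub>1) * \<R> s"
proof (intro exI[of _ "4 * max 1 ((1 / b\<^sub>1) powr (1 / \<alpha>\<^sub>1))"] conjI allI impI)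
  let ?C = "4 * max 1 ((1 / b\<^sub>1) powr (1 / \<alpha>\<^sub>1))"
  show "1 \<le> ?C" by simp
  fix s u :: real assume su: "0 < s \<and> s \<le> u"
  hence s: "0 < \<R> s" and u: "0 < \<R> u" using ginv_pos by auto
  have g1: "(u / s) powr (1 / \<alpha>\<^sub>1) \<ge> 1" using su pos by (intro ge_one_powr_ge_zero) auto
  show "\<R> u \<le> ?C * (u / s) powr (1 / \<alpha>\<^sub>1) * \<R> s"
  proof (cases "\<R> u \<le> 4 * \<R> s")
    case True
    also have "4 * \<R> s \<le> ?C * (u / s) powr (1 / \<alpha>\<^sub>1) * \<R> s"
      using g1 s mult_mono[of 4 ?C 1 "(u / s) powr (1 / \<alpha>\<^sub>1)"] by (simp add: mult_right_mono)
    finally show ?thesis .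
  next
    case False
    define z where "z = \<R> u / 2 / (2 * \<R> s)"
    have z: "z > 0" using s u by (simp add: z_def)
    have "b\<^sub>1 * z powr \<alpha>\<^sub>1 \<le> \<Phi> (\<R> u / 2) / \<Phi> (2 * \<R> s)"
      using lower_scaling[of "2 * \<R> s" "\<R> u / 2"] False s by (simp add: z_def)
    also have "\<dots> \<le> u / s"
      using \<Phi>_below_ginv[of "\<R> u / 2" u] \<Phi>_above_ginv[of s "2 * \<R> s"] s u su
      by (intro frac_le) auto
    finally have "z powr \<alpha>\<^sub>1 \<le> (u / s) / b\<^sub>1"
      using pos(3) by (simp only: pos_le_divide_eq mult.commute)
    hence "z powr \<alpha>\<^sub>1 \<le> (1 / b\<^sub>1) * (u / s)" by (simp add: mult.commute)
    hence "(z powr \<alpha>\<^sub>1) powr (1 / \<alpha>\<^sub>1) \<le> ((1 / b\<^sub>1) * (u / s)) powr (1 / \<alpha>\<^sub>1)"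
      using pos by (intro powr_mono2) auto
    hence "z \<le> (1 / b\<^sub>1) powr (1 / \<alpha>\<^sub>1) * (u / s) powr (1 / \<alpha>\<^sub>1)"
      using pos z by (simp add: powr_powr flip: powr_mult)
    also have "\<dots> \<le> max 1 ((1 / b\<^sub>1) powr (1 / \<alpha>\<^sub>1)) * (u / s) powr (1 / \<alpha>\<^sub>1)"
      by (intro mult_right_mono) auto
    finally have "4 * z * \<R> s \<le> 4 * (max 1 ((1 / b\<^sub>1) powr (1 / \<alpha>\<^sub>1)) * (u / s) powr (1 / \<alpha>\<^sub>1)) * \<R> s"
      using s by (intro mult_right_mono mult_left_mono) auto
    thus ?thesis using s by (simp add: z_def mult.assoc)
  qed
qed

text \<open>
  The converse comparison, of times with distances; it turns powers of \<open>\<Phi> r / s\<close> into powers of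
  \<open>r / \<R> s\<close>, against which the Gaussian factor is effective.
\<close>

lemma \<Phi>_over_upper:
  assumes "0 < s" "s \<le> \<Phi> r" "0 < r"
  shows "\<Phi> r / s \<le> b\<^sub>2 * 2 powr \<alpha>\<^sub>2 * (r / \<R> s) powr \<alpha>\<^sub>2"
proof -
  have R: "0 < \<R> s" "\<R> s \<le> r" using ginv_pos ginv_upper[of r s] assms by auto
  have "\<Phi> r / s \<le> \<Phi> r / \<Phi> (\<R> s / 2)"
    using \<Phi>_below_ginv[of "\<R> s / 2" s] R \<Phi>_pos assms
    by (intro divide_left_mono) (auto intro!: mult_pos_pos)
  also have "\<dots> \<le> b\<^sub>2 * (r / (\<R> s / 2)) powr \<alpha>\<^sub>2" using upper_scaling[of "\<R> s / 2" r] R by simp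
  also have "r / (\<R> s / 2) = 2 * (r / \<R> s)" by simp
  also have "(2 * (r / \<R> s)) powr \<alpha>\<^sub>2 = 2 powr \<alpha>\<^sub>2 * (r / \<R> s) powr \<alpha>\<^sub>2"
    using R assms by (subst powr_mult) auto
  finally show ?thesis by (simp add: mult.assoc)
qed

end

section \<open>Levy measures with polynomial tails\<close>

lemma one_minus_exp_le_max:
  fixes s \<xi> :: real assumes "0 \<le> s" "0 \<le> \<xi>"
  shows "1 - exp (- \<xi> * s) \<le> max 1 \<xi> * min 1 s"
proof (cases "s \<le> 1")
  case True
  have "1 - exp (- \<xi> * s) \<le> \<xi> * s" using exp_ge_add_one_self[of "- \<xi> * s"] by simp
  also have "\<dots> \<le> max 1 \<xi> * s" using assms by (intro mult_right_mono) auto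
  finally show ?thesis using True by simp
next
  case False
  have "1 - exp (- \<xi> * s) \<le> 1" by simp
  also have "1 \<le> max 1 \<xi>" by simp
  finally show ?thesis using False by simp
qed

lemma one_minus_exp_concave:
  fixes z K :: real assumes "1 \<le> K"
  shows "1 - exp (- (K * z)) \<le> K * (1 - exp (- z))"
proof -
  have "exp (- z) \<le> (1 - 1 / K) + (1 / K) * exp (- (K * z))"
    using convex_onD[OF exp_convex, of "1 / K" 0 "- (K * z)"] assms by simp
  hence "K * exp (- z) \<le> K * ((1 - 1 / K) + (1 / K) * exp (- (K * z)))"
    using assms by (intro mult_left_mono) auto
  also have "\<dots> = K - 1 + exp (- (K * z))" using assms by (simp add: algebra_simps)
  finally show ?thesis by (simp add: algebra_simps)
qed

locale poly_levy =
  fixes \<nu> :: "real measure" and b\<^sub>1 b\<^sub>2 \<beta>\<^sub>1 \<beta>\<^sub>2 :: real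
  assumes levy: "levy_measure \<nu>"
    and pos: "0 < b\<^sub>1" "0 < b\<^sub>2" "0 < \<beta>\<^sub>1" "\<beta>\<^sub>1 \<le> \<beta>\<^sub>2"
    and tail_lower: "\<And>r R. 0 < r \<Longrightarrow> r \<le> R \<Longrightarrow>
      b\<^sub>1 * (R / r) powr \<beta>\<^sub>1 \<le> levy_tail \<nu> r / levy_tail \<nu> R"
    and tail_upper: "\<And>r R. 0 < r \<Longrightarrow> r \<le> R \<Longrightarrow>
      levy_tail \<nu> r / levy_tail \<nu> R \<le> b\<^sub>2 * (R / r) powr \<beta>\<^sub>2"
begin

abbreviation "w \<equiv> levy_tail \<nu>"
abbreviation "\<phi> \<equiv> laplace_exponent \<nu>"

lemma sets_\<nu>[simp, measurable_cong]: "sets \<nu> = sets borel"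
  using levy by (simp add: levy_measure_def)

lemma space_\<nu>[simp]: "space \<nu> = UNIV"
  using sets_eq_imp_space_eq[OF sets_\<nu>] by simp

lemma AE_pos: "AE s in \<nu>. 0 < s"
proof -
  have "{..0} \<in> null_sets \<nu>" using levy by (auto simp: levy_measure_def null_sets_def)
  from AE_not_in[OF this] show ?thesis by eventually_elim auto
qed

lemma min_finite: "(\<integral>\<^sup>+s. ennreal (min 1 s) \<partial>\<nu>) < \<infinity>"
  using levy by (simp add: levy_measure_def)

lemma emeasure_tail: assumes "0 < r" shows "emeasure \<nu> {r<..} = ennreal (w r)"
proof -
  have "ennreal (min 1 r) * emeasure \<nu> {r<..} = (\<integral>\<^sup>+s. ennreal (min 1 r) * indicator {r<..} s \<partial>\<nu>)"
    by (simp add: nn_integral_cmult_indicator)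
  also have "\<dots> \<le> (\<integral>\<^sup>+s. ennreal (min 1 s) \<partial>\<nu>)"
    by (intro nn_integral_mono) (auto split: split_indicator intro!: ennreal_leI)
  finally have *: "ennreal (min 1 r) * emeasure \<nu> {r<..} < \<infinity>" using min_finite by (rule le_less_trans)
  have "emeasure \<nu> {r<..} \<noteq> top"
  proof
    assume "emeasure \<nu> {r<..} = top"
    moreover have "min 1 r > 0" using assms by simp
    ultimately show False using * by (simp add: ennreal_mult_top less_imp_neq[THEN not_sym] del: min_less_iff_conj)
  qed
  thus ?thesis unfolding levy_tail_def by (rule emeasure_eq_ennreal_measure)
qed

lemma w_pos: assumes "0 < r" shows "0 < w r"
proof -
  have "b\<^sub>1 \<le> w r / w r" using tail_lower[of r r] assms by simp
  hence "w r \<noteq> 0" using pos by auto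
  thus ?thesis by (simp add: levy_tail_def less_le)
qed

lemma w_antimono: assumes "0 < r" "r \<le> R" shows "w R \<le> w r"
proof -
  have "emeasure \<nu> {R<..} \<le> emeasure \<nu> {r<..}" using assms by (intro emeasure_mono) auto
  thus ?thesis using assms by (simp add: emeasure_tail ennreal_le_iff levy_tail_def)
qed

lemma w_lower: "0 < r \<Longrightarrow> r \<le> R \<Longrightarrow> b\<^sub>1 * (R / r) powr \<beta>\<^sub>1 * w R \<le> w r"
  using tail_lower[of r R] w_pos[of R] by (simp add: pos_le_divide_eq)

lemma w_upper: "0 < r \<Longrightarrow> r \<le> R \<Longrightarrow> w r \<le> b\<^sub>2 * (R / r) powr \<beta>\<^sub>2 * w R"
  using tail_upper[of r R] w_pos[of R] by (simp add: pos_divide_le_eq)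

lemma sigma_finite_\<nu>: "sigma_finite_measure \<nu>"
proof
  let ?A = "insert {..0} (range (\<lambda>n. {inverse (real (Suc n))<..}))"
  have "x \<in> \<Union>?A" for x :: real
  proof (cases "x \<le> 0")
    case False
    then obtain n where "inverse (real (Suc n)) < x" using reals_Archimedean[of x] by auto
    thus ?thesis by auto
  qed auto
  hence "\<Union>?A = UNIV" by blast
  moreover have "emeasure \<nu> {..0} = 0" using levy by (simp add: levy_measure_def)
  moreover have "emeasure \<nu> {inverse (real (Suc n))<..} \<noteq> \<infinity>" for n
    by (subst emeasure_tail) auto
  ultimately show "\<exists>A. countable A \<and> A \<subseteq> sets \<nu> \<and> \<Union>A = space \<nu> \<and> (\<forall>a\<in>A. emeasure \<nu> a \<noteq> \<infinity>)"
    by (intro exI[of _ ?A]) auto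
qed

lemma integrable_levy:
  assumes [measurable]: "f \<in> borel_measurable borel"
    and "\<And>s. 0 < s \<Longrightarrow> \<bar>f s\<bar> \<le> C * min 1 s" "0 \<le> C"
  shows "integrable \<nu> f"
proof (rule integrableI_bounded)
  have "(\<integral>\<^sup>+s. ennreal (norm (f s)) \<partial>\<nu>) \<le> (\<integral>\<^sup>+s. ennreal C * ennreal (min 1 s) \<partial>\<nu>)"
    using AE_pos assms by (intro nn_integral_mono_AE) (auto simp: ennreal_mult'[symmetric] intro!: ennreal_leI)
  also have "\<dots> = ennreal C * (\<integral>\<^sup>+s. ennreal (min 1 s) \<partial>\<nu>)" by (intro nn_integral_cmult) auto
  also have "\<dots> < \<infinity>" using min_finite by (simp add: ennreal_mult_less_top)
  finally show "(\<integral>\<^sup>+s. ennreal (norm (f s)) \<partial>\<nu>) < \<infinity>" .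
qed auto

lemma integrable_exponent: "0 \<le> \<xi> \<Longrightarrow> integrable \<nu> (\<lambda>s. 1 - exp (- \<xi> * s))"
  by (rule integrable_levy[where C = "max 1 \<xi>"]) (use one_minus_exp_le_max[of _ \<xi>] in auto)

lemma \<phi>_0[simp]: "\<phi> 0 = 0" by (simp add: laplace_exponent_def)

lemma \<phi>_mono: assumes "0 \<le> x" "x \<le> y" shows "\<phi> x \<le> \<phi> y"
  unfolding laplace_exponent_def
  using assms AE_pos by (intro integral_mono_AE integrable_exponent) (auto intro!: mult_right_mono)

lemma \<phi>_nonneg: "0 \<le> x \<Longrightarrow> 0 \<le> \<phi> x" using \<phi>_mono[of 0 x] by simp

lemma \<phi>_less: assumes "0 \<le> x" "x < y" shows "\<phi> x < \<phi> y"
proof (rule ccontr)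
  assume "\<not> \<phi> x < \<phi> y"
  hence "\<phi> y - \<phi> x = 0" using \<phi>_mono[of x y] assms by simp
  moreover have "(\<integral>s. (1 - exp (- y * s)) - (1 - exp (- x * s)) \<partial>\<nu>) = \<phi> y - \<phi> x"
    unfolding laplace_exponent_def
    using assms by (intro Bochner_Integration.integral_diff integrable_exponent) auto
  ultimately have "(\<integral>s. (1 - exp (- y * s)) - (1 - exp (- x * s)) \<partial>\<nu>) = 0" by simp
  moreover have "AE s in \<nu>. 0 \<le> (1 - exp (- y * s)) - (1 - exp (- x * s))"
    using AE_pos assms by (auto elim!: eventually_mono)
  moreover have "integrable \<nu> (\<lambda>s. (1 - exp (- y * s)) - (1 - exp (- x * s)))"
    using assms by (intro Bochner_Integration.integrable_diff integrable_exponent) auto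
  ultimately have "AE s in \<nu>. (1 - exp (- y * s)) - (1 - exp (- x * s)) = 0"
    using integral_nonneg_eq_0_iff_AE by blast
  with AE_pos have "AE s in \<nu>. s \<notin> {1<..}" by eventually_elim (use assms in auto)
  hence "emeasure \<nu> {1<..} = 0" by (simp add: AE_iff_null null_sets_def greaterThan_def)
  thus False using w_pos[of 1] by (simp add: emeasure_tail)
qed

lemma \<phi>_pos: "0 < x \<Longrightarrow> 0 < \<phi> x" using \<phi>_less[of 0 x] by simp

lemma \<phi>_sublinear: assumes "0 \<le> x" "1 \<le> K" shows "\<phi> (K * x) \<le> K * \<phi> x"
proof -
  have "\<phi> (K * x) \<le> (\<integral>s. K * (1 - exp (- x * s)) \<partial>\<nu>)"
    unfolding laplace_exponent_def
  proof (rule integral_mono_AE)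
    show "AE s in \<nu>. 1 - exp (- (K * x) * s) \<le> K * (1 - exp (- x * s))"
      using AE_pos
    proof eventually_elim
      case (elim s)
      show ?case using one_minus_exp_concave[OF assms(2), of "x * s"] by (simp add: mult.assoc)
    qed
  qed (use assms integrable_exponent in auto)
  also have "\<dots> = K * \<phi> x" by (simp add: laplace_exponent_def)
  finally show ?thesis .
qed

lemma \<phi>_continuous: "continuous_on {0<..} \<phi>"
proof -
  have "isCont \<phi> x" if x: "0 < x" for x
    unfolding isCont_def
  proof (rule real_tendsto_sandwich)
    show "\<forall>\<^sub>F y in at x. \<phi> x * min 1 (y / x) \<le> \<phi> y"
    proof -
      have "\<forall>\<^sub>F y in at x. 0 < y" using x by (intro order_tendstoD(1)[OF tendsto_ident_at]) auto
      thus ?thesis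
      proof eventually_elim
        case (elim y)
        show ?case
        proof (cases "x \<le> y")
          case True thus ?thesis using \<phi>_mono[of x y] x by simp
        next
          case False
          thus ?thesis using \<phi>_sublinear[of y "x / y"] elim x by (simp add: field_simps)
        qed
      qed
    qed
    show "\<forall>\<^sub>F y in at x. \<phi> y \<le> \<phi> x * max 1 (y / x)"
    proof -
      have "\<forall>\<^sub>F y in at x. 0 < y" using x by (intro order_tendstoD(1)[OF tendsto_ident_at]) auto
      thus ?thesis
      proof eventually_elim
        case (elim y)
        show ?case
        proof (cases "y \<le> x")
          case True thus ?thesis using \<phi>_mono[of y x] elim x by simp
        next
          case False
          thus ?thesis using \<phi>_sublinear[of x "y / x"] elim x by (simp add: field_simps)
        qed
      qed
    qed
    show "((\<lambda>y. \<phi> x * min 1 (y / x)) \<longlongrightarrow> \<phi> x) (at x)"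
      using x by (auto intro!: tendsto_eq_intros)
    show "((\<lambda>y. \<phi> x * max 1 (y / x)) \<longlongrightarrow> \<phi> x) (at x)"
      using x by (auto intro!: tendsto_eq_intros)
  qed
  thus ?thesis by (intro continuous_at_imp_continuous_on) auto
qed

text \<open>
  Tonelli's theorem for \<open>F s = \<integral>\<^sub>0\<^sup>s f\<close>.  It expresses integrals against \<open>\<nu>\<close> through the tail \<open>w\<close>, on
  which the scaling is assumed.
\<close>

lemma levy_by_parts:
  assumes F: "\<And>s. 0 \<le> s \<Longrightarrow> (F has_real_derivative f s) (at s)" "F 0 = 0"
    and f: "\<And>s. 0 \<le> s \<Longrightarrow> 0 \<le> f s" and [measurable]: "f \<in> borel_measurable borel"
  shows "(\<integral>\<^sup>+s. ennreal (F s) \<partial>\<nu>) = (\<integral>\<^sup>+u. ennreal (f u * w u) * indicator {0<..} u \<partial>lborel)"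
proof -
  interpret sigma_finite_measure \<nu> by (rule sigma_finite_\<nu>)
  interpret pair_sigma_finite lborel \<nu> by unfold_locales
  have "(\<integral>\<^sup>+s. ennreal (F s) \<partial>\<nu>)
      = (\<integral>\<^sup>+s. (\<integral>\<^sup>+u. ennreal (f u) * indicator {0<..} u * indicator {u<..} s \<partial>lborel) \<partial>\<nu>)"
  proof (rule nn_integral_cong_AE)
    show "AE s in \<nu>. ennreal (F s) = (\<integral>\<^sup>+u. ennreal (f u) * indicator {0<..} u * indicator {u<..} s \<partial>lborel)"
      using AE_pos
    proof eventually_elim
      case (elim s)
      have "ennreal (F s) = ennreal (F s - F 0)" using F by simp
      also have "\<dots> = (\<integral>\<^sup>+u. ennreal (f u) * indicator {0 .. s} u \<partial>lborel)"
        using elim by (intro nn_integral_FTC_Icc[symmetric] F f) auto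
      also have "\<dots> = (\<integral>\<^sup>+u. ennreal (f u) * indicator {0<..} u * indicator {u<..} s \<partial>lborel)"
        using AE_lborel_singleton[of 0] AE_lborel_singleton[of s]
        by (intro nn_integral_cong_AE) (auto elim!: eventually_elim2 split: split_indicator)
      finally show ?case .
    qed
  qed
  also have "\<dots> = (\<integral>\<^sup>+u. (\<integral>\<^sup>+s. ennreal (f u) * indicator {0<..} u * indicator {u<..} s \<partial>\<nu>) \<partial>lborel)"
  proof (rule Fubini')
    have eq: "(\<lambda>x. indicator {fst x<..} (snd x) :: ennreal) = (\<lambda>x. if fst x < snd x then 1 else 0)"
      by (auto simp: indicator_def)
    have [measurable]: "(\<lambda>x. indicator {fst x<..} (snd x) :: ennreal) \<in> borel_measurable (lborel \<Otimes>\<^sub>M \<nu>)"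
        unfolding eq by measurable
    show "(\<lambda>(u, s). ennreal (f u) * indicator {0<..} u * indicator {u<..} s) \<in> borel_measurable (lborel \<Otimes>\<^sub>M \<nu>)"
      unfolding case_prod_beta by measurable
  qed
  also have "\<dots> = (\<integral>\<^sup>+u. ennreal (f u * w u) * indicator {0<..} u \<partial>lborel)"
    by (intro nn_integral_cong)
       (auto simp: nn_integral_cmult_indicator emeasure_tail f ennreal_mult' w_pos less_imp_le split: split_indicator)
  finally show ?thesis .
qed

lemma \<phi>_nn: assumes "0 \<le> x" shows "ennreal (\<phi> x) = (\<integral>\<^sup>+s. ennreal (1 - exp (- x * s)) \<partial>\<nu>)"
  unfolding laplace_exponent_def
  using assms AE_pos integrable_exponent[OF assms] by (intro nn_integral_eq_integral[symmetric]) auto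

lemma \<phi>_by_parts: assumes "0 < x"
  shows "ennreal (\<phi> x) = (\<integral>\<^sup>+u. ennreal (x * exp (- x * u) * w u) * indicator {0<..} u \<partial>lborel)"
  unfolding \<phi>_nn[OF less_imp_le[OF assms]]
  by (rule levy_by_parts) (use assms in \<open>auto intro!: derivative_eq_intros\<close>)

lemma w_measurable[measurable]: "w \<in> borel_measurable borel"
proof -
  interpret sigma_finite_measure \<nu> by (rule sigma_finite_\<nu>)
  have eq: "(\<lambda>x. indicator {fst x<..} (snd x) :: ennreal) = (\<lambda>x. if fst x < snd x then 1 else 0)"
    by (auto simp: indicator_def)
  have [measurable]: "(\<lambda>x. indicator {fst x<..} (snd x) :: ennreal) \<in> borel_measurable (borel \<Otimes>\<^sub>M \<nu>)"
      unfolding eq by measurable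
  have "(\<lambda>u. \<integral>\<^sup>+s. indicator {u<..} s \<partial>\<nu>) \<in> borel_measurable borel"
    by (rule borel_measurable_nn_integral) (simp add: case_prod_beta)
  hence "(\<lambda>u. enn2real (emeasure \<nu> {u<..})) \<in> borel_measurable borel" by simp
  thus ?thesis by (simp add: levy_tail_def[abs_def] measure_def)
qed

text \<open>
  After the substitution \<open>u \<mapsto> u / K\<close> in \<open>\<phi>(x) = \<integral> x exp (- x u) w(u) du\<close> this is the scaling of \<open>w\<close>.
\<close>

lemma \<phi>_lower: assumes "0 < x" "1 \<le> K" shows "b\<^sub>1 * K powr \<beta>\<^sub>1 * \<phi> x \<le> \<phi> (K * x)"
proof -
  have K: "0 < K" using assms by simp
  have "ennreal (b\<^sub>1 * K powr \<beta>\<^sub>1) * ennreal (\<phi> x)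
    = (\<integral>\<^sup>+u. ennreal (b\<^sub>1 * K powr \<beta>\<^sub>1) * (ennreal (x * exp (- x * u) * w u) * indicator {0<..} u) \<partial>lborel)"
    unfolding \<phi>_by_parts[OF assms(1)] by (rule nn_integral_cmult[symmetric]) simp
  also have "\<dots> \<le> (\<integral>\<^sup>+u. ennreal (x * exp (- x * u) * w (u / K)) * indicator {0<..} u \<partial>lborel)"
  proof (intro nn_integral_mono)
    fix u :: real
    show "ennreal (b\<^sub>1 * K powr \<beta>\<^sub>1) * (ennreal (x * exp (- x * u) * w u) * indicator {0<..} u)
        \<le> ennreal (x * exp (- x * u) * w (u / K)) * indicator {0<..} u"
    proof (cases "0 < u")
      case True
      have "u / K \<le> u / 1" using True assms by (intro divide_left_mono) auto
      hence "b\<^sub>1 * K powr \<beta>\<^sub>1 * w u \<le> w (u / K)" using w_lower[of "u / K" u] True K by simp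
      hence "x * exp (- x * u) * (b\<^sub>1 * K powr \<beta>\<^sub>1 * w u) \<le> x * exp (- x * u) * w (u / K)"
        using assms by (intro mult_left_mono) auto
      thus ?thesis using True pos by (simp add: ennreal_mult'[symmetric] mult_ac ennreal_leI)
    qed auto
  qed
  also have "\<dots> = (\<integral>\<^sup>+u. ennreal (1 / K) * (ennreal (K * x * exp (- x * u) * w (u / K)) * indicator {0<..} u) \<partial>lborel)"
    using K by (intro nn_integral_cong) (auto split: split_indicator simp: ennreal_mult'[symmetric] mult.assoc)
  also have "\<dots> = ennreal (1 / K) * (\<integral>\<^sup>+u. (ennreal (K * x * exp (- x * u) * w (u / K)) * indicator {0<..} u) \<partial>lborel)"
    by (rule nn_integral_cmult) simp
  also have "\<dots> = (\<integral>\<^sup>+u. ennreal (K * x * exp (- (K * x) * u) * w u) * indicator {0<..} u \<partial>lborel)"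
  proof -
    have "(\<integral>\<^sup>+u. ennreal (K * x * exp (- (K * x) * u) * w u) * indicator {0<..} u \<partial>lborel)
      = ennreal \<bar>1 / K\<bar> * (\<integral>\<^sup>+u. ennreal (K * x * exp (- (K * x) * (0 + 1 / K * u)) * w (0 + 1 / K * u))
           * indicator {0<..} (0 + 1 / K * u) \<partial>lborel)"
      using K by (intro nn_integral_real_affine) auto
    also have "(\<integral>\<^sup>+u. ennreal (K * x * exp (- (K * x) * (0 + 1 / K * u)) * w (0 + 1 / K * u))
           * indicator {0<..} (0 + 1 / K * u) \<partial>lborel)
       = (\<integral>\<^sup>+u. (ennreal (K * x * exp (- x * u) * w (u / K)) * indicator {0<..} u) \<partial>lborel)"
    proof (rule nn_integral_cong)
      fix u :: real
      have "- (K * x) * (0 + 1 / K * u) = - x * u" "0 + 1 / K * u = u / K" using K by auto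
      moreover have "indicator {0<..} (u / K) = (indicator {0<..} u :: ennreal)"
        using K by (simp add: indicator_def zero_less_divide_iff)
      ultimately show "ennreal (K * x * exp (- (K * x) * (0 + 1 / K * u)) * w (0 + 1 / K * u))
           * indicator {0<..} (0 + 1 / K * u) = ennreal (K * x * exp (- x * u) * w (u / K)) * indicator {0<..} u"
        by simp
    qed
    finally show ?thesis using K by simp
  qed
  also have "\<dots> = ennreal (\<phi> (K * x))" using \<phi>_by_parts[of "K * x"] K assms by simp
  finally have "ennreal (b\<^sub>1 * K powr \<beta>\<^sub>1 * \<phi> x) \<le> ennreal (\<phi> (K * x))"
    using pos by (subst ennreal_mult') auto
  thus ?thesis using \<phi>_nonneg[of "K * x"] K assms by (simp add: ennreal_le_iff)
qed

lemma \<phi>_surj: assumes "0 < y" shows "\<exists>x>0. \<phi> x = y"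
proof -
  define K where "K = (max 1 (max (y / (b\<^sub>1 * \<phi> 1)) (\<phi> 1 / (b\<^sub>1 * y)))) powr (1 / \<beta>\<^sub>1)"
  have K1: "1 \<le> K" unfolding K_def using pos by (intro ge_one_powr_ge_zero) auto
  have KK: "K powr \<beta>\<^sub>1 = max 1 (max (y / (b\<^sub>1 * \<phi> 1)) (\<phi> 1 / (b\<^sub>1 * y)))"
    unfolding K_def using pos by (simp add: powr_powr)
  have p1: "0 < \<phi> 1" by (rule \<phi>_pos) simp
  have "y / (b\<^sub>1 * \<phi> 1) \<le> K powr \<beta>\<^sub>1" unfolding KK by linarith
  hence "y \<le> b\<^sub>1 * K powr \<beta>\<^sub>1 * \<phi> 1" using pos p1 by (simp add: field_simps)
  also have "\<dots> \<le> \<phi> (K * 1)" using K1 by (intro \<phi>_lower) auto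
  finally have up: "y \<le> \<phi> K" by simp
  have "\<phi> 1 / (b\<^sub>1 * y) \<le> K powr \<beta>\<^sub>1" unfolding KK by linarith
  hence "\<phi> 1 \<le> b\<^sub>1 * K powr \<beta>\<^sub>1 * y" using pos assms by (simp add: field_simps)
  moreover have "b\<^sub>1 * K powr \<beta>\<^sub>1 * \<phi> (1 / K) \<le> \<phi> (K * (1 / K))" using K1 by (intro \<phi>_lower) auto
  ultimately have "b\<^sub>1 * K powr \<beta>\<^sub>1 * \<phi> (1 / K) \<le> b\<^sub>1 * K powr \<beta>\<^sub>1 * y" using K1 by simp
  hence down: "\<phi> (1 / K) \<le> y" using K1 pos by simp
  have "1 / K \<le> K" using K1 by (simp add: field_simps mult_ge1_I)
  moreover have "continuous_on {1 / K..K} \<phi>"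
    by (rule continuous_on_subset[OF \<phi>_continuous]) (use K1 in \<open>auto intro: less_le_trans[of 0 "1 / K"]\<close>)
  ultimately obtain x where "1 / K \<le> x" "\<phi> x = y" using IVT'[of \<phi> "1 / K" y K] up down by auto
  thus ?thesis using K1 by (intro exI[of _ x]) (auto intro: less_le_trans[of 0 "1 / K"])
qed

lemma ginv_\<phi>: assumes "0 < y" shows "0 < ginv \<phi> y" "\<phi> (ginv \<phi> y) = y"
proof -
  obtain x where x: "x > 0" "\<phi> x = y" using \<phi>_surj[OF assms] by blast
  have "{r. 0 \<le> r \<and> y < \<phi> r} = {x<..}"
  proof (intro set_eqI iffI)
    fix r assume r: "r \<in> {r. 0 \<le> r \<and> y < \<phi> r}"
    show "r \<in> {x<..}"
    proof (rule ccontr)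
      assume "r \<notin> {x<..}"
      thus False using \<phi>_mono[of r x] r x by auto
    qed
  next
    fix r assume "r \<in> {x<..}"
    thus "r \<in> {r. 0 \<le> r \<and> y < \<phi> r}" using \<phi>_less[of x r] x by auto
  qed
  hence "ginv \<phi> y = x" by (simp add: ginv_def)
  thus "0 < ginv \<phi> y" "\<phi> (ginv \<phi> y) = y" using x by auto
qed

text \<open>
  The integrand behaves like \<open>(min 1 (s / a))\<^sup>k\<close>: for large \<open>k\<close> it is a smooth substitute for the
  indicator of \<open>s > a\<close>.  Being a polynomial in \<open>exp (- s / a)\<close>, it has an expectation under the law
  of \<open>S t\<close> that can be read off from \<open>\<phi>\<close>.
\<close>

definition tail_moment :: "nat \<Rightarrow> real \<Rightarrow> real" where
  "tail_moment k a = (\<integral>s. (1 - exp (- s / a)) ^ k \<partial>\<nu>)"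

lemma integrable_tail_moment:
  assumes "0 < a" "1 \<le> k" shows "integrable \<nu> (\<lambda>s. (1 - exp (- s / a)) ^ k)"
proof (rule integrable_levy[where C = "max 1 (1 / a)"])
  fix s :: real assume s: "0 < s"
  have 0: "0 \<le> 1 - exp (- s / a)" using s assms by simp
  have "(1 - exp (- s / a)) ^ k \<le> (1 - exp (- s / a)) ^ 1"
    using 0 assms by (intro power_decreasing) auto
  also have "\<dots> \<le> max 1 (1 / a) * min 1 s" using one_minus_exp_le_max[of s "1 / a"] s assms by simp
  finally show "\<bar>(1 - exp (- s / a)) ^ k\<bar> \<le> max 1 (1 / a) * min 1 s" using 0 by simp
qed auto

lemma tail_moment_ge: assumes "0 < a" "1 \<le> k" shows "(1 - exp (-1)) ^ k * w a \<le> tail_moment k a"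
proof -
  have "(1 - exp (-1)) ^ k * w a = (\<integral>s. (1 - exp (-1)) ^ k * indicator {a<..} s \<partial>\<nu>)"
    by (simp add: levy_tail_def)
  also have "\<dots> \<le> tail_moment k a" unfolding tail_moment_def
  proof (rule integral_mono_AE)
    show "integrable \<nu> (\<lambda>s. (1 - exp (-1) :: real) ^ k * indicator {a<..} s)"
    proof (rule integrable_mult_right)
      show "integrable \<nu> (indicator {a<..} :: real \<Rightarrow> real)"
        using emeasure_tail[OF assms(1)] by (intro integrable_real_indicator) auto
    qed
    show "AE s in \<nu>. (1 - exp (-1)) ^ k * indicator {a<..} s \<le> (1 - exp (- s / a)) ^ k"
      using AE_pos
    proof eventually_elim
      case (elim s)
      show ?case using elim assms
        by (auto split: split_indicator intro!: power_mono simp: field_simps)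
    qed
  qed (rule integrable_tail_moment[OF assms])
  finally show ?thesis .
qed

text \<open>
  After integration by parts the integrand is bounded by a multiple of \<open>w(a) exp (- u / a) / a\<close>:
  for \<open>u < a\<close>, \<open>w(u)\<close> exceeds \<open>w(a)\<close> at most by a factor of order \<open>(a / u) powr \<beta>\<^sub>2\<close>, which the
  factor \<open>(1 - exp (- u / a)) ^ (k - 1)\<close> compensates.
\<close>

lemma tail_moment_le:
  assumes a: "0 < a" and "\<beta>\<^sub>2 + 1 \<le> real k" shows "tail_moment k a \<le> real k * (1 + b\<^sub>2) * w a"
proof -
  have k: "1 \<le> k" using assms pos by (cases k) auto
  define f where "f s = real k / a * exp (- s / a) * (1 - exp (- s / a)) ^ (k - 1)" for s :: real
  have "ennreal (tail_moment k a) = (\<integral>\<^sup>+s. ennreal ((1 - exp (- s / a)) ^ k) \<partial>\<nu>)"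
    unfolding tail_moment_def using AE_pos a
    by (intro nn_integral_eq_integral[symmetric] integrable_tail_moment k)
       (auto elim!: eventually_mono)
  also have "\<dots> = (\<integral>\<^sup>+u. ennreal (f u * w u) * indicator {0<..} u \<partial>lborel)"
    unfolding f_def using a k
    by (intro levy_by_parts) (auto intro!: derivative_eq_intros simp: field_simps)
  also have "\<dots> \<le> (\<integral>\<^sup>+u. ennreal (real k * (1 + b\<^sub>2) * w a) * (ennreal (exp (- u / a) / a) * indicator {0..} u) \<partial>lborel)"
  proof (rule nn_integral_mono)
    fix u :: real
    have "f u * w u \<le> real k * (1 + b\<^sub>2) * w a * (exp (- u / a) / a)" if u: "0 < u"
    proof -
      have 0: "0 \<le> 1 - exp (- u / a)" using u a by simp
      have "(1 - exp (- u / a)) ^ (k - 1) * w u \<le> (1 + b\<^sub>2) * w a"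
      proof (cases "a \<le> u")
        case True
        have "(1 - exp (- u / a)) ^ (k - 1) * w u \<le> 1 * w a"
          using 0 w_antimono[OF a True] w_pos[OF u] by (intro mult_mono power_le_one) auto
        also have "\<dots> \<le> (1 + b\<^sub>2) * w a" using w_pos[OF a] pos by (intro mult_right_mono) auto
        finally show ?thesis .
      next
        case False
        have "(1 - exp (- u / a)) ^ (k - 1) \<le> (u / a) ^ (k - 1)"
          using exp_ge_add_one_self[of "- u / a"] 0 by (intro power_mono) auto
        also have "\<dots> = (u / a) powr real (k - 1)" using u a by (simp add: powr_realpow)
        also have "\<dots> \<le> (u / a) powr \<beta>\<^sub>2" using u a False assms k by (intro powr_mono') auto
        finally have "(1 - exp (- u / a)) ^ (k - 1) * w u \<le> (u / a) powr \<beta>\<^sub>2 * (b\<^sub>2 * (a / u) powr \<beta>\<^sub>2 * w a)"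
          using w_upper[OF u, of a] False w_pos[OF u] by (intro mult_mono) auto
        also have "\<dots> = ((u / a) powr \<beta>\<^sub>2 * (a / u) powr \<beta>\<^sub>2) * (b\<^sub>2 * w a)" by simp
        also have "(u / a) powr \<beta>\<^sub>2 * (a / u) powr \<beta>\<^sub>2 = 1"
          using u a by (subst powr_mult[symmetric]) simp
        also have "1 * (b\<^sub>2 * w a) \<le> (1 + b\<^sub>2) * w a" using w_pos[OF a] by (simp add: algebra_simps)
        finally show ?thesis .
      qed
      hence "real k / a * exp (- u / a) * ((1 - exp (- u / a)) ^ (k - 1) * w u)
          \<le> real k / a * exp (- u / a) * ((1 + b\<^sub>2) * w a)"
        using a by (intro mult_left_mono) auto
      thus ?thesis by (simp add: f_def mult_ac)
    qed
    thus "ennreal (f u * w u) * indicator {0<..} u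
      \<le> ennreal (real k * (1 + b\<^sub>2) * w a) * (ennreal (exp (- u / a) / a) * indicator {0..} u)"
      using a pos w_pos[OF a]
      by (auto split: split_indicator simp: ennreal_mult'[symmetric] intro!: ennreal_leI)
  qed
  also have "\<dots> = ennreal (real k * (1 + b\<^sub>2) * w a) * (\<integral>\<^sup>+u. ennreal (exp (- u / a) / a) * indicator {0..} u \<partial>lborel)"
    by (rule nn_integral_cmult) simp
  also have "(\<integral>\<^sup>+u. ennreal (exp (- u / a) / a) * indicator {0..} u \<partial>lborel) = 0 - (- exp (- 0 / a))"
  proof (rule nn_integral_FTC_atLeast)
    show "((\<lambda>u. - exp (- u / a)) \<longlongrightarrow> 0) at_top" using a by real_asymp
  qed (use a in \<open>auto intro!: derivative_eq_intros\<close>)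
  finally have "ennreal (tail_moment k a) \<le> ennreal (real k * (1 + b\<^sub>2) * w a)" by simp
  thus ?thesis using pos w_pos[OF a] by (subst (asm) ennreal_le_iff) auto
qed

end

lemma nn_integral_indicator_comp:
  assumes [measurable]: "X \<in> borel_measurable M" "A \<in> sets borel"
  shows "(\<integral>\<^sup>+\<omega>. indicator A (X \<omega>) \<partial>M) = emeasure M {\<omega>\<in>space M. X \<omega> \<in> A}"
proof -
  have "(\<integral>\<^sup>+\<omega>. indicator A (X \<omega>) \<partial>M) = (\<integral>\<^sup>+\<omega>. indicator {\<omega>\<in>space M. X \<omega> \<in> A} \<omega> \<partial>M)"
    by (intro nn_integral_cong) (auto simp: indicator_def)
  also have "\<dots> = emeasure M {\<omega>\<in>space M. X \<omega> \<in> A}" by (intro nn_integral_indicator) auto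
  finally show ?thesis .
qed

section \<open>Subordinators through their Laplace transforms\<close>

locale subordinator =
  fixes M :: "'w measure" and S :: "real \<Rightarrow> 'w \<Rightarrow> real" and \<nu> :: "real measure"
  assumes sub: "driftless_subordinator M S \<nu>"

sublocale subordinator \<subseteq> prob_space M
  using sub by (simp add: driftless_subordinator_def)

context subordinator
begin

lemma S_measurable: "0 \<le> t \<Longrightarrow> S t \<in> borel_measurable M"
  using sub by (simp add: driftless_subordinator_def)

lemma AE_S_0: "AE \<omega> in M. S 0 \<omega> = 0"
  and AE_S_mono: "AE \<omega> in M. mono_on {0..} (\<lambda>t. S t \<omega>)"
proof -
  have "AE \<omega> in M. S 0 \<omega> = 0 \<and> mono_on {0..} (\<lambda>t. S t \<omega>) \<and>
        (\<forall>t\<ge>0. continuous (at_right t) (\<lambda>u. S u \<omega>))"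
    using sub by (simp add: driftless_subordinator_def)
  thus "AE \<omega> in M. S 0 \<omega> = 0" "AE \<omega> in M. mono_on {0..} (\<lambda>t. S t \<omega>)"
    by (auto elim!: eventually_mono)
qed

lemma AE_S_nonneg: assumes "0 \<le> t" shows "AE \<omega> in M. 0 \<le> S t \<omega>"
  using AE_S_0 AE_S_mono
proof eventually_elim
  case (elim \<omega>)
  thus ?case using mono_onD[of "{0..}" "\<lambda>t. S t \<omega>" 0 t] assms by auto
qed

lemma nn_integral_increment:
  assumes [measurable]: "f \<in> borel_measurable borel" and "0 \<le> s" "0 \<le> t"
  shows "(\<integral>\<^sup>+\<omega>. f (S (s + t) \<omega> - S s \<omega>) \<partial>M) = (\<integral>\<^sup>+\<omega>. f (S t \<omega>) \<partial>M)"
proof -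
  have [measurable]: "S (s + t) \<in> borel_measurable M" "S s \<in> borel_measurable M" "S t \<in> borel_measurable M"
    using S_measurable assms by auto
  have "(\<integral>\<^sup>+\<omega>. f (S (s + t) \<omega> - S s \<omega>) \<partial>M) = (\<integral>\<^sup>+x. f x \<partial>distr M borel (\<lambda>\<omega>. S (s + t) \<omega> - S s \<omega>))"
    by (subst nn_integral_distr) auto
  also have "distr M borel (\<lambda>\<omega>. S (s + t) \<omega> - S s \<omega>) = distr M borel (S t)"
    using sub assms by (simp add: driftless_subordinator_def)
  also have "(\<integral>\<^sup>+x. f x \<partial>distr M borel (S t)) = (\<integral>\<^sup>+\<omega>. f (S t \<omega>) \<partial>M)"
    by (subst nn_integral_distr) auto
  finally show ?thesis .
qed

text \<open>
  All uses of independence are instances of this identity, with \<open>g\<close> an exponential, a truncated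
  exponential, or an indicator.
\<close>

lemma nn_integral_prod_increments:
  fixes g :: "real \<Rightarrow> real"
  assumes [measurable]: "g \<in> borel_measurable borel" and u: "0 \<le> u"
  shows "(\<integral>\<^sup>+\<omega>. (\<Prod>i<n. ennreal (g (S (real (Suc i) * u) \<omega> - S (real i * u) \<omega>))) \<partial>M)
     = (\<integral>\<^sup>+\<omega>. ennreal (g (S u \<omega>)) \<partial>M) ^ n"
proof -
  have "mono (\<lambda>i. real i * u)" using u by (auto intro!: monoI mult_right_mono)
  hence "indep_vars (\<lambda>_. borel) (\<lambda>i \<omega>. S (real (Suc i) * u) \<omega> - S (real i * u) \<omega>) {..<n}"
    using sub u unfolding driftless_subordinator_def
    by (elim conjE allE[of _ "\<lambda>i. real i * u"] allE[of _ n] impE) auto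
  hence "indep_vars (\<lambda>_. borel) (\<lambda>i \<omega>. ennreal (g (S (real (Suc i) * u) \<omega> - S (real i * u) \<omega>))) {..<n}"
    by (rule indep_vars_compose2[where Y = "\<lambda>_ x. ennreal (g x)"]) auto
  hence "(\<integral>\<^sup>+\<omega>. (\<Prod>i<n. ennreal (g (S (real (Suc i) * u) \<omega> - S (real i * u) \<omega>))) \<partial>M)
     = (\<Prod>i<n. (\<integral>\<^sup>+\<omega>. ennreal (g (S (real (Suc i) * u) \<omega> - S (real i * u) \<omega>)) \<partial>M))"
    by (intro indep_vars_nn_integral) auto
  also have "\<dots> = (\<Prod>i<n. \<integral>\<^sup>+\<omega>. ennreal (g (S u \<omega>)) \<partial>M)"
  proof (rule prod.cong)
    fix i
    show "(\<integral>\<^sup>+\<omega>. ennreal (g (S (real (Suc i) * u) \<omega> - S (real i * u) \<omega>)) \<partial>M)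
        = (\<integral>\<^sup>+\<omega>. ennreal (g (S u \<omega>)) \<partial>M)"
      using nn_integral_increment[of "\<lambda>x. ennreal (g x)" "real i * u" u] u by (simp add: algebra_simps)
  qed auto
  finally show ?thesis by simp
qed

lemma AE_increments:
  assumes "0 \<le> u"
  shows "AE \<omega> in M. (\<forall>i<n. 0 \<le> S (real (Suc i) * u) \<omega> - S (real i * u) \<omega>) \<and>
     (\<Sum>i<n. S (real (Suc i) * u) \<omega> - S (real i * u) \<omega>) = S (real n * u) \<omega>"
  using AE_S_0 AE_S_mono
proof eventually_elim
  case (elim \<omega>)
  have "S (real i * u) \<omega> \<le> S (real (Suc i) * u) \<omega>" for i
    using mono_onD[OF elim(2), of "real i * u" "real (Suc i) * u"] assms by (simp add: algebra_simps)
  moreover have "(\<Sum>i<n. S (real (Suc i) * u) \<omega> - S (real i * u) \<omega>) = S (real n * u) \<omega>"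
    using sum_lessThan_telescope[of "\<lambda>i. S (real i * u) \<omega>" n] elim by simp
  ultimately show ?case by simp
qed

lemma integrable_exp: assumes "0 \<le> t" "0 \<le> \<xi>" shows "integrable M (\<lambda>\<omega>. exp (- \<xi> * S t \<omega>))"
proof (rule integrable_const_bound[where B = 1])
  show "AE \<omega> in M. norm (exp (- \<xi> * S t \<omega>)) \<le> 1"
    using AE_S_nonneg[OF assms(1)] assms by (auto elim!: eventually_mono)
qed (use S_measurable[OF assms(1)] in auto)

lemma laplace_nat_multiple:
  assumes "0 \<le> u" and that: "0 \<le> \<xi>"
  shows "(\<integral>\<omega>. exp (- \<xi> * S (real n * u) \<omega>) \<partial>M) = (\<integral>\<omega>. exp (- \<xi> * S u \<omega>) \<partial>M) ^ n"
proof -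
  have "ennreal (\<integral>\<omega>. exp (- \<xi> * S (real n * u) \<omega>) \<partial>M) = (\<integral>\<^sup>+\<omega>. ennreal (exp (- \<xi> * S (real n * u) \<omega>)) \<partial>M)"
    using that assms by (intro nn_integral_eq_integral[symmetric] integrable_exp) auto
  also have "\<dots> = (\<integral>\<^sup>+\<omega>. (\<Prod>i<n. ennreal (exp (- \<xi> * (S (real (Suc i) * u) \<omega> - S (real i * u) \<omega>)))) \<partial>M)"
  proof (rule nn_integral_cong_AE)
    show "AE \<omega> in M. ennreal (exp (- \<xi> * S (real n * u) \<omega>)) =
        (\<Prod>i<n. ennreal (exp (- \<xi> * (S (real (Suc i) * u) \<omega> - S (real i * u) \<omega>))))"
      using AE_increments[OF assms(1), of n]
    proof eventually_elim
      case (elim \<omega>)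
      have "exp (- \<xi> * S (real n * u) \<omega>)
          = exp (\<Sum>i<n. - \<xi> * (S (real (Suc i) * u) \<omega> - S (real i * u) \<omega>))"
        unfolding sum_distrib_left[symmetric] using elim by simp
      also have "\<dots> = (\<Prod>i<n. exp (- \<xi> * (S (real (Suc i) * u) \<omega> - S (real i * u) \<omega>)))"
        by (rule exp_sum) simp
      finally show ?case by (simp only: prod_ennreal exp_ge_zero)
    qed
  qed
  also have "\<dots> = (\<integral>\<^sup>+\<omega>. ennreal (exp (- \<xi> * S u \<omega>)) \<partial>M) ^ n"
    using assms by (intro nn_integral_prod_increments) auto
  also have "(\<integral>\<^sup>+\<omega>. ennreal (exp (- \<xi> * S u \<omega>)) \<partial>M) = ennreal (\<integral>\<omega>. exp (- \<xi> * S u \<omega>) \<partial>M)"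
    using that assms by (intro nn_integral_eq_integral integrable_exp) auto
  finally have "ennreal (\<integral>\<omega>. exp (- \<xi> * S (real n * u) \<omega>) \<partial>M) = ennreal ((\<integral>\<omega>. exp (- \<xi> * S u \<omega>) \<partial>M) ^ n)"
    by (simp add: ennreal_power integral_nonneg_AE)
  thus ?thesis by (subst (asm) ennreal_inj) (auto intro!: integral_nonneg_AE zero_le_power)
qed

lemma laplace_one: assumes "0 < \<xi>"
  shows "(\<integral>\<omega>. exp (- \<xi> * S 1 \<omega>) \<partial>M) = exp (- laplace_exponent \<nu> \<xi>)"
proof -
  let ?I = "\<integral>\<omega>. exp (- \<xi> * S 1 \<omega>) \<partial>M"
  have "?I \<noteq> 0"
  proof
    assume "?I = 0"
    hence "AE \<omega> in M. exp (- \<xi> * S 1 \<omega>) = 0"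
      using integrable_exp[of 1 \<xi>] assms by (subst integral_nonneg_eq_0_iff_AE[symmetric]) auto
    thus False by simp
  qed
  moreover have "0 \<le> ?I" by (intro integral_nonneg_AE) auto
  moreover have "- ln ?I = laplace_exponent \<nu> \<xi>"
    using sub assms by (simp add: driftless_subordinator_def)
  ultimately show ?thesis by (metis add.inverse_inverse exp_ln less_le)
qed

text \<open>
  The Laplace transform is given at time \<open>1\<close> only; independence and stationarity of the increments
  give it at rational times, and the monotone paths at the times between.
\<close>

lemma laplace_transform: assumes t: "0 < t" and \<xi>: "0 \<le> \<xi>"
  shows "(\<integral>\<omega>. exp (- \<xi> * S t \<omega>) \<partial>M) = exp (- t * laplace_exponent \<nu> \<xi>)"
proof (cases "\<xi> = 0")
  case True
  thus ?thesis by (simp add: laplace_exponent_def prob_space)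
next
  case False
  hence \<xi>0: "0 < \<xi>" using \<xi> by simp
  define f where "f t = (\<integral>\<omega>. exp (- \<xi> * S t \<omega>) \<partial>M)" for t
  define l where "l = laplace_exponent \<nu> \<xi>"
  have f1: "f 1 = exp (- l)" using laplace_one[OF \<xi>0] by (simp add: f_def l_def)
  have f0: "0 \<le> f t" for t unfolding f_def by (intro integral_nonneg_AE) auto
  have fr: "f (real k / real n) = exp (- (real k / real n) * l)" if n: "0 < n" for k n :: nat
  proof -
    have "f (1 / real n) ^ n = exp (- l / real n) ^ n"
      using laplace_nat_multiple[of "1 / real n" \<xi> n] \<xi> n f1
      by (simp add: f_def exp_of_nat_mult[symmetric])
    hence "f (1 / real n) = exp (- l / real n)"
      using f0 n by (simp add: power_eq_iff_eq_base)
    moreover have "f (real k * (1 / real n)) = f (1 / real n) ^ k"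
      unfolding f_def using \<xi> n by (intro laplace_nat_multiple) auto
    ultimately show ?thesis by (simp add: exp_of_nat_mult[symmetric] mult_ac)
  qed
  have anti: "f t \<le> f s" if "0 \<le> s" "s \<le> t" for s t
    unfolding f_def
  proof (rule integral_mono_AE)
    show "AE \<omega> in M. exp (- \<xi> * S t \<omega>) \<le> exp (- \<xi> * S s \<omega>)"
      using AE_S_mono
    proof eventually_elim
      case (elim \<omega>)
      thus ?case using mono_onD[OF elim, of s t] that \<xi> by (auto intro!: mult_left_mono)
    qed
  qed (use that \<xi> integrable_exp in auto)
  have fl: "real (nat \<lfloor>real n * t\<rfloor>) = of_int \<lfloor>real n * t\<rfloor>" for n
    using t by (simp add: of_nat_nat)
  have "f t = exp (- t * l)"
  proof (rule LIMSEQ_unique)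
    show "(\<lambda>n. f t) \<longlonglongrightarrow> f t" by simp
    show "(\<lambda>n. f t) \<longlonglongrightarrow> exp (- t * l)"
    proof (rule real_tendsto_sandwich)
      let ?k = "\<lambda>n. nat \<lfloor>real n * t\<rfloor>"
      show "\<forall>\<^sub>F n in sequentially. exp (- (real (Suc (?k n)) / real n) * l) \<le> f t"
        using eventually_gt_at_top[of 0]
      proof eventually_elim
        case (elim n)
        have "real n * t \<le> real (Suc (?k n))" using fl[of n] by (simp add: algebra_simps) linarith
        hence "t \<le> real (Suc (?k n)) / real n" using elim by (simp add: field_simps)
        thus ?case using anti[of t "real (Suc (?k n)) / real n"] fr[OF elim, of "Suc (?k n)"] t by simp
      qed
      show "\<forall>\<^sub>F n in sequentially. f t \<le> exp (- (real (?k n) / real n) * l)"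
        using eventually_gt_at_top[of 0]
      proof eventually_elim
        case (elim n)
        have "real (?k n) \<le> real n * t" using fl[of n] by (simp add: algebra_simps)
        hence "real (?k n) / real n \<le> t" using elim by (simp add: field_simps)
        thus ?case using anti[of "real (?k n) / real n" t] fr[OF elim, of "?k n"] t by simp
      qed
      have lim: "(\<lambda>n. real_of_int \<lfloor>real n * t\<rfloor> / real n) \<longlonglongrightarrow> t" using t by real_asymp
      show "(\<lambda>n. exp (- (real (?k n) / real n) * l)) \<longlonglongrightarrow> exp (- t * l)"
        unfolding fl by (intro tendsto_intros lim)
      have "(\<lambda>n. real_of_int \<lfloor>real n * t\<rfloor> / real n + 1 / real n) \<longlonglongrightarrow> t + 0"
        by (intro tendsto_add lim) real_asymp
      hence lim': "(\<lambda>n. real (Suc (?k n)) / real n) \<longlonglongrightarrow> t"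
        by (simp add: fl of_nat_Suc add_divide_distrib add.commute)
      show "(\<lambda>n. exp (- (real (Suc (?k n)) / real n) * l)) \<longlonglongrightarrow> exp (- t * l)"
        by (intro tendsto_intros lim')
    qed
  qed
  thus ?thesis by (simp add: f_def l_def)
qed

text \<open>
  Either one of the \<open>n\<close> increments exceeds \<open>a\<close>, or truncation at \<open>a\<close> changes none of them and the
  exponential Chebyshev inequality applies to the truncated increments, for any \<open>\<theta>\<close>.
\<close>

lemma truncated_chernoff:
  assumes t: "0 < t" and n: "0 < n" and \<theta>: "0 \<le> \<theta>"
  shows "emeasure M {\<omega>\<in>space M. r \<le> S t \<omega>} \<le>
     of_nat n * emeasure M {\<omega>\<in>space M. a < S (t / real n) \<omega>}
     + ennreal (exp (- \<theta> * r)) * (\<integral>\<^sup>+\<omega>. ennreal (exp (\<theta> * min (S (t / real n) \<omega>) a)) \<partial>M) ^ n"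
proof -
  define u where "u = t / real n"
  have u: "0 \<le> u" "real n * u = t" using t n by (auto simp: u_def)
  define X where "X i \<omega> = S (real (Suc i) * u) \<omega> - S (real i * u) \<omega>" for i \<omega>
  have [measurable]: "X i \<in> borel_measurable M" for i
    unfolding X_def using S_measurable u by (intro borel_measurable_diff) auto
  have [measurable]: "S t \<in> borel_measurable M" "S u \<in> borel_measurable M"
    using S_measurable u t by auto
  have "emeasure M {\<omega>\<in>space M. r \<le> S t \<omega>} = (\<integral>\<^sup>+\<omega>. indicator {r..} (S t \<omega>) \<partial>M)"
    by (subst nn_integral_indicator_comp) auto
  also have "\<dots> \<le> (\<integral>\<^sup>+\<omega>. (\<Sum>i<n. indicator {a<..} (X i \<omega>)) +
      ennreal (exp (- \<theta> * r)) * (\<Prod>i<n. ennreal (exp (\<theta> * min (X i \<omega>) a))) \<partial>M)"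
  proof (rule nn_integral_mono_AE)
    show "AE \<omega> in M. indicator {r..} (S t \<omega>) \<le> (\<Sum>i<n. indicator {a<..} (X i \<omega>)) +
      ennreal (exp (- \<theta> * r)) * (\<Prod>i<n. ennreal (exp (\<theta> * min (X i \<omega>) a)))"
      using AE_increments[OF u(1), of n]
    proof eventually_elim
      case (elim \<omega>)
      hence sm: "(\<Sum>i<n. X i \<omega>) = S t \<omega>" using u(2) by (simp add: X_def)
      show ?case
      proof (cases "\<exists>i<n. a < X i \<omega>")
        case True
        then obtain i where i: "i < n" "a < X i \<omega>" by blast
        have "indicator {r..} (S t \<omega>) \<le> (1::ennreal)" by (simp add: indicator_def)
        also have "1 = (indicator {a<..} (X i \<omega>) :: ennreal)" using i by simp
        also have "\<dots> \<le> (\<Sum>i<n. indicator {a<..} (X i \<omega>))"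
          by (rule member_le_sum) (use i in auto)
        finally show ?thesis by (rule order_trans) simp
      next
        case False
        hence "min (X i \<omega>) a = X i \<omega>" if "i < n" for i using that by (meson min.absorb1 not_less)
        hence "(\<Prod>i<n. ennreal (exp (\<theta> * min (X i \<omega>) a))) = (\<Prod>i<n. ennreal (exp (\<theta> * X i \<omega>)))"
          by (intro prod.cong) auto
        also have "\<dots> = ennreal (exp (\<theta> * S t \<omega>))"
          by (simp add: prod_ennreal exp_sum[symmetric] sum_distrib_left[symmetric] sm)
        finally have "ennreal (exp (- \<theta> * r)) * (\<Prod>i<n. ennreal (exp (\<theta> * min (X i \<omega>) a)))
          = ennreal (exp (\<theta> * (S t \<omega> - r)))"
          by (simp add: ennreal_mult'[symmetric] exp_add[symmetric] algebra_simps)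
        moreover have "indicator {r..} (S t \<omega>) \<le> ennreal (exp (\<theta> * (S t \<omega> - r)))"
          using \<theta> by (auto split: split_indicator)
        ultimately show ?thesis by (auto intro: order_trans[OF _ le_add2] simp: add_increasing)
      qed
    qed
  qed
  also have "\<dots> = (\<Sum>i<n. (\<integral>\<^sup>+\<omega>. indicator {a<..} (X i \<omega>) \<partial>M)) +
      ennreal (exp (- \<theta> * r)) * (\<integral>\<^sup>+\<omega>. (\<Prod>i<n. ennreal (exp (\<theta> * min (X i \<omega>) a))) \<partial>M)"
    by (subst nn_integral_add) (auto simp: nn_integral_sum nn_integral_cmult)
  also have "(\<integral>\<^sup>+\<omega>. (\<Prod>i<n. ennreal (exp (\<theta> * min (X i \<omega>) a))) \<partial>M)
      = (\<integral>\<^sup>+\<omega>. ennreal (exp (\<theta> * min (S u \<omega>) a)) \<partial>M) ^ n"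
    unfolding X_def using u by (intro nn_integral_prod_increments[where g = "\<lambda>x. exp (\<theta> * min x a)"]) auto
  also have "(\<Sum>i<n. (\<integral>\<^sup>+\<omega>. indicator {a<..} (X i \<omega>) \<partial>M))
      = (\<Sum>i<n. emeasure M {\<omega>\<in>space M. a < S u \<omega>})"
  proof (rule sum.cong)
    fix i
    have "(\<integral>\<^sup>+\<omega>. indicator {a<..} (X i \<omega>) \<partial>M) = (\<integral>\<^sup>+\<omega>. indicator {a<..} (S u \<omega>) \<partial>M)"
      unfolding X_def using nn_integral_increment[of "indicator {a<..}" "real i * u" u] u
      by (simp add: algebra_simps)
    also have "\<dots> = emeasure M {\<omega>\<in>space M. a < S u \<omega>}"
      by (subst nn_integral_indicator_comp) auto
    finally show "(\<integral>\<^sup>+\<omega>. indicator {a<..} (X i \<omega>) \<partial>M) = emeasure M {\<omega>\<in>space M. a < S u \<omega>}" .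
  qed auto
  finally show ?thesis by (simp add: u_def)
qed

text \<open>
  The sum of nonnegative increments is at most \<open>s\<close> only if each of them is.
\<close>

lemma prob_le_power:
  assumes t: "0 < t" and n: "0 < n"
  shows "prob {\<omega>\<in>space M. S t \<omega> \<le> s} \<le> prob {\<omega>\<in>space M. S (t / real n) \<omega> \<le> s} ^ n"
proof -
  define u where "u = t / real n"
  have u: "0 \<le> u" "real n * u = t" using t n by (auto simp: u_def)
  define X where "X i \<omega> = S (real (Suc i) * u) \<omega> - S (real i * u) \<omega>" for i \<omega>
  have [measurable]: "S t \<in> borel_measurable M" "S u \<in> borel_measurable M"
    using S_measurable u t by auto
  have "emeasure M {\<omega>\<in>space M. S t \<omega> \<le> s} = (\<integral>\<^sup>+\<omega>. indicator {..s} (S t \<omega>) \<partial>M)"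
    by (subst nn_integral_indicator_comp) auto
  also have "\<dots> \<le> (\<integral>\<^sup>+\<omega>. (\<Prod>i<n. ennreal (indicator {..s} (X i \<omega>))) \<partial>M)"
  proof (rule nn_integral_mono_AE)
    show "AE \<omega> in M. indicator {..s} (S t \<omega>) \<le> (\<Prod>i<n. ennreal (indicator {..s} (X i \<omega>)))"
      using AE_increments[OF u(1), of n]
    proof eventually_elim
      case (elim \<omega>)
      hence sm: "(\<Sum>i<n. X i \<omega>) = S t \<omega>" and nn: "\<And>i. i < n \<Longrightarrow> 0 \<le> X i \<omega>" using u(2) by (auto simp: X_def)
      have "X i \<omega> \<le> S t \<omega>" if "i < n" for i
        unfolding sm[symmetric] by (rule member_le_sum) (use that nn in auto)
      hence "(\<Prod>i<n. ennreal (indicator {..s} (X i \<omega>))) = (\<Prod>i<n. 1)" if "S t \<omega> \<le> s"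
        using that by (intro prod.cong) (force simp: indicator_def)+
      thus ?case by (cases "S t \<omega> \<le> s") auto
    qed
  qed
  also have "\<dots> = (\<integral>\<^sup>+\<omega>. ennreal (indicator {..s} (S u \<omega>)) \<partial>M) ^ n"
    unfolding X_def using u by (intro nn_integral_prod_increments) auto
  also have "(\<integral>\<^sup>+\<omega>. ennreal (indicator {..s} (S u \<omega>)) \<partial>M) = emeasure M {\<omega>\<in>space M. S u \<omega> \<le> s}"
    by (simp add: nn_integral_indicator_comp ennreal_indicator)
  finally show ?thesis unfolding u_def emeasure_eq_measure
    by (simp add: ennreal_power)
qed

end

text \<open>
  Subtracting \<open>(1 - 1)\<^sup>k = 0\<close> leaves terms that vanish at \<open>y = 1\<close>; with \<open>y = exp (- s / a)\<close> each of
  them is integrable against \<open>\<nu>\<close>, although the single powers of \<open>y\<close> are not.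
\<close>

lemma alternating_binomial:
  fixes y :: real assumes "1 \<le> k"
  shows "(1 - y) ^ k = (\<Sum>j\<le>k. of_nat (k choose j) * (-1) ^ j * (y ^ j - 1))"
proof -
  have e: "(1 - y) ^ k = (\<Sum>j\<le>k. of_nat (k choose j) * (-1) ^ j * y ^ j)" for y :: real
  proof -
    have "(1 - y) ^ k = ((- y) + 1) ^ k" by simp
    also have "\<dots> = (\<Sum>j\<le>k. of_nat (k choose j) * (- y) ^ j * 1 ^ (k - j))" by (rule binomial_ring)
    finally show ?thesis by (simp add: power_minus[of y] mult.assoc)
  qed
  have "(1 - y) ^ k = (1 - y) ^ k - (1 - 1) ^ k" using assms by (simp add: power_0_left)
  also have "\<dots> = (\<Sum>j\<le>k. of_nat (k choose j) * (-1) ^ j * (y ^ j - 1))"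
    unfolding e[of y] e[of 1] sum_subtractf[symmetric] by (simp add: right_diff_distrib)
  finally show ?thesis .
qed

locale poly_subordinator = poly_levy \<nu> b\<^sub>1 b\<^sub>2 \<beta>\<^sub>1 \<beta>\<^sub>2 + subordinator M S \<nu>
  for M :: "'w measure" and S :: "real \<Rightarrow> 'w \<Rightarrow> real" and \<nu> b\<^sub>1 b\<^sub>2 \<beta>\<^sub>1 \<beta>\<^sub>2
begin

lemma laplace_\<phi>: "0 < t \<Longrightarrow> 0 \<le> \<xi> \<Longrightarrow> (\<integral>\<omega>. exp (- \<xi> * S t \<omega>) \<partial>M) = exp (- t * \<phi> \<xi>)"
  by (rule laplace_transform)

definition law_moment :: "nat \<Rightarrow> real \<Rightarrow> real \<Rightarrow> real" where
  "law_moment k t a = (\<integral>\<omega>. (1 - exp (- S t \<omega> / a)) ^ k \<partial>M)"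

lemma integrable_law_moment: assumes "0 < t" "0 < a" shows "integrable M (\<lambda>\<omega>. (1 - exp (- S t \<omega> / a)) ^ k)"
proof (rule integrable_const_bound[where B = 1])
  show "AE \<omega> in M. norm ((1 - exp (- S t \<omega> / a)) ^ k) \<le> 1"
    using AE_S_nonneg[of t] assms by (auto elim!: eventually_mono intro!: power_le_one)
qed (use S_measurable[of t] assms in auto)

text \<open>
  Both sides expand into values of \<open>\<phi>\<close> at \<open>j / a\<close>, and \<open>n (exp (- t \<phi>(j / a) / n) - 1)\<close> tends to
  \<open>- t \<phi>(j / a)\<close>.  This replaces the vague convergence of \<open>n\<close> times the law of \<open>S (t / n)\<close> to \<open>t \<nu>\<close>.
\<close>

lemma law_moment_limit:
  assumes t: "0 < t" and a: "0 < a" and k: "1 \<le> k"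
  shows "(\<lambda>n. real n * law_moment k (t / real n) a) \<longlonglongrightarrow> t * tail_moment k a"
proof -
  let ?c = "\<lambda>j. of_nat (k choose j) * (-1) ^ j :: real"
  have pw: "exp (- s / a) ^ j = exp (- (real j / a) * s)" for s j
    by (simp add: exp_of_nat_mult[symmetric])
  have "tail_moment k a = (\<integral>s. (\<Sum>j\<le>k. - ?c j * (1 - exp (- (real j / a) * s))) \<partial>\<nu>)"
    unfolding tail_moment_def alternating_binomial[OF k] pw
    by (intro Bochner_Integration.integral_cong sum.cong refl) (simp add: algebra_simps)
  also have "\<dots> = (\<Sum>j\<le>k. - ?c j * \<phi> (real j / a))"
  proof -
    have "integrable \<nu> (\<lambda>s. - ?c j * (1 - exp (- (real j / a) * s)))" for j
      using a by (intro integrable_mult_right integrable_exponent) auto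
    thus ?thesis unfolding laplace_exponent_def
      by (subst Bochner_Integration.integral_sum) (simp_all only: integral_mult_right_zero)
  qed
  finally have tm: "tail_moment k a = (\<Sum>j\<le>k. - ?c j * \<phi> (real j / a))" .
  have lm: "law_moment k \<tau> a = (\<Sum>j\<le>k. ?c j * (exp (- \<tau> * \<phi> (real j / a)) - 1))" if \<tau>: "0 < \<tau>" for \<tau>
  proof -
    have "law_moment k \<tau> a = (\<integral>\<omega>. (\<Sum>j\<le>k. ?c j * (exp (- (real j / a) * S \<tau> \<omega>) - 1)) \<partial>M)"
      unfolding law_moment_def alternating_binomial[OF k] pw ..
    also have "\<dots> = (\<Sum>j\<le>k. ?c j * ((\<integral>\<omega>. exp (- (real j / a) * S \<tau> \<omega>) \<partial>M) - 1))"
    proof -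
      have i: "integrable M (\<lambda>\<omega>. exp (- (real j / a) * S \<tau> \<omega>))" for j
        using a \<tau> by (intro integrable_exp) auto
      hence i': "integrable M (\<lambda>\<omega>. exp (- (real j / a) * S \<tau> \<omega>) - 1)" for j
        by (intro Bochner_Integration.integrable_diff) auto
      have e: "(\<integral>\<omega>. exp (- (real j / a) * S \<tau> \<omega>) - 1 \<partial>M) = (\<integral>\<omega>. exp (- (real j / a) * S \<tau> \<omega>) \<partial>M) - 1" for j
        by (subst Bochner_Integration.integral_diff[OF i]) (auto simp: prob_space)
      show ?thesis
        by (subst Bochner_Integration.integral_sum)
           (auto intro!: integrable_mult_right i' simp only: integral_mult_right_zero e)
    qed
    finally show ?thesis using a by (simp only: laplace_\<phi>[OF \<tau>] divide_nonneg_pos of_nat_0_le_iff)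
  qed
  have "\<forall>\<^sub>F n in sequentially. (\<Sum>j\<le>k. ?c j * (real n * (exp (- (t / real n) * \<phi> (real j / a)) - 1)))
      = real n * law_moment k (t / real n) a"
    using eventually_gt_at_top[of 0] by eventually_elim (use t in \<open>simp add: lm sum_distrib_left mult_ac\<close>)
  moreover have "(\<lambda>n. \<Sum>j\<le>k. ?c j * (real n * (exp (- (t / real n) * \<phi> (real j / a)) - 1)))
      \<longlonglongrightarrow> (\<Sum>j\<le>k. ?c j * (- t * \<phi> (real j / a)))"
  proof (rule tendsto_sum, rule tendsto_mult[OF tendsto_const])
    fix j
    have "(\<lambda>n. real n * (exp (- (t / real n) * c) - 1)) \<longlonglongrightarrow> - t * c" for c :: real
      by real_asymp
    thus "(\<lambda>n. real n * (exp (- (t / real n) * \<phi> (real j / a)) - 1)) \<longlonglongrightarrow> - t * \<phi> (real j / a)" .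
  qed
  moreover have "(\<Sum>j\<le>k. ?c j * (- t * \<phi> (real j / a))) = t * tail_moment k a"
    unfolding tm sum_distrib_left by (intro sum.cong) auto
  ultimately show ?thesis by (auto dest: Lim_transform_eventually)
qed

end

section \<open>Tail estimates for the law of a subordinator\<close>

lemma powr_le_exp:
  fixes z \<beta> \<delta> :: real assumes "0 < z" "0 < \<beta>" "0 < \<delta>"
  shows "z powr \<beta> \<le> (\<beta> / \<delta>) powr \<beta> * exp (\<delta> * z)"
proof -
  have "\<delta> * z / \<beta> \<le> exp (\<delta> * z / \<beta>)" using exp_ge_add_one_self[of "\<delta> * z / \<beta>"] by linarith
  hence "(\<delta> * z / \<beta>) powr \<beta> \<le> exp (\<delta> * z / \<beta>) powr \<beta>" using assms by (intro powr_mono2) auto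
  also have "\<dots> = exp (\<delta> * z)" using assms by (simp add: powr_def)
  finally have "(\<beta> / \<delta>) powr \<beta> * (\<delta> * z / \<beta>) powr \<beta> \<le> (\<beta> / \<delta>) powr \<beta> * exp (\<delta> * z)"
    by (intro mult_left_mono) auto
  moreover have "(\<beta> / \<delta>) powr \<beta> * (\<delta> * z / \<beta>) powr \<beta> = z powr \<beta>"
    using assms by (simp flip: powr_mult)
  ultimately show ?thesis by simp
qed

lemma one_minus_exp_half: "1 / 2 \<le> 1 - exp (- 1 :: real)"
proof -
  have "2 \<le> exp (1::real)" using exp_ge_add_one_self[of "1::real"] by simp
  thus ?thesis by (simp add: exp_minus field_simps)
qed

context poly_levy
begin

text \<open>
  The order of magnitude of \<open>S t\<close>: the exponent \<open>t \<phi>(1 / T t)\<close> of the Laplace transform at \<open>1 / T t\<close>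
  equals \<open>1\<close>.
\<close>

definition T :: "real \<Rightarrow> real" where "T t = 1 / ginv \<phi> (1 / t)"

lemma T_pos: "0 < t \<Longrightarrow> 0 < T t"
  using ginv_\<phi>[of "1 / t"] by (simp add: T_def)

lemma \<phi>_T: "0 < t \<Longrightarrow> \<phi> (1 / T t) = 1 / t"
  using ginv_\<phi>[of "1 / t"] by (simp add: T_def)

lemma \<phi>_below_T: assumes "0 < t" "0 < e" "e \<le> 1"
  shows "b\<^sub>1 * (1 / e) powr \<beta>\<^sub>1 \<le> t * \<phi> (1 / (e * T t))"
proof -
  have "b\<^sub>1 * (1 / e) powr \<beta>\<^sub>1 * \<phi> (1 / T t) \<le> \<phi> ((1 / e) * (1 / T t))"
    using assms T_pos[of t] by (intro \<phi>_lower) auto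
  hence "b\<^sub>1 * (1 / e) powr \<beta>\<^sub>1 * (1 / t) \<le> \<phi> (1 / (e * T t))" using \<phi>_T[of t] assms by simp
  hence "t * (b\<^sub>1 * (1 / e) powr \<beta>\<^sub>1 * (1 / t)) \<le> t * \<phi> (1 / (e * T t))"
    using assms by (intro mult_left_mono) auto
  thus ?thesis using assms by simp
qed

lemma \<phi>_above_T: assumes "0 < t" "T t \<le> r"
  shows "b\<^sub>1 * (r / T t) powr \<beta>\<^sub>1 * (t * \<phi> (1 / r)) \<le> 1"
proof -
  have r: "0 < r" using assms T_pos[of t] by simp
  have "b\<^sub>1 * (r / T t) powr \<beta>\<^sub>1 * \<phi> (1 / r) \<le> \<phi> ((r / T t) * (1 / r))"
    using assms T_pos[of t] r by (intro \<phi>_lower) auto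
  also have "\<dots> = 1 / t" using r \<phi>_T assms by simp
  finally have "t * (b\<^sub>1 * (r / T t) powr \<beta>\<^sub>1 * \<phi> (1 / r)) \<le> t * (1 / t)"
    using assms by (intro mult_left_mono) auto
  thus ?thesis using assms by (simp add: mult_ac)
qed

lemma tw_le_2: assumes "0 < t" "T t \<le> r" shows "t * w r \<le> 2"
proof -
  have r: "0 < r" using assms T_pos[of t] by simp
  have "1 / 2 * w r \<le> (1 - exp (-1)) ^ 1 * w r"
    using one_minus_exp_half w_pos[OF r] by (intro mult_right_mono) auto
  also have "\<dots> \<le> tail_moment 1 r" using r by (intro tail_moment_ge) auto
  also have "\<dots> = \<phi> (1 / r)" by (simp add: tail_moment_def laplace_exponent_def)
  also have "\<dots> \<le> \<phi> (1 / T t)" using assms T_pos[of t] r by (intro \<phi>_mono) (auto simp: frac_le)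
  also have "\<dots> = 1 / t" using assms \<phi>_T by simp
  finally show ?thesis using assms by (simp add: field_simps)
qed

lemma w_unbounded: assumes "0 < r" shows "\<exists>s. 0 < s \<and> s \<le> r \<and> y \<le> w s"
proof -
  define K where "K = (max 1 (y / (b\<^sub>1 * w r))) powr (1 / \<beta>\<^sub>1)"
  have K1: "1 \<le> K" unfolding K_def using pos by (intro ge_one_powr_ge_zero) auto
  have KK: "K powr \<beta>\<^sub>1 = max 1 (y / (b\<^sub>1 * w r))" unfolding K_def using pos by (simp add: powr_powr)
  have "y / (b\<^sub>1 * w r) \<le> K powr \<beta>\<^sub>1" unfolding KK by simp
  hence "y \<le> b\<^sub>1 * K powr \<beta>\<^sub>1 * w r" using pos w_pos[OF assms] by (simp add: field_simps)
  also have "\<dots> = b\<^sub>1 * (r / (r / K)) powr \<beta>\<^sub>1 * w r" using assms K1 by simp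
  also have "\<dots> \<le> w (r / K)"
    using assms K1 mult_left_mono[of 1 K r] by (intro w_lower) (auto simp: field_simps)
  finally show ?thesis using assms K1 mult_left_mono[of 1 K r]
    by (intro exI[of _ "r / K"]) (auto simp: field_simps)
qed

lemma tail_moment_2: assumes "0 < x" shows "tail_moment 2 (1 / x) = 2 * \<phi> x - \<phi> (2 * x)"
proof -
  have "(1 - exp (- s / (1 / x)))\<^sup>2 = 2 * (1 - exp (- x * s)) - (1 - exp (- (2 * x) * s))" for s
  proof -
    have "exp (- (2 * x) * s) = exp (- x * s) * exp (- x * s)" by (simp flip: exp_add)
    thus ?thesis by (simp add: power2_eq_square algebra_simps)
  qed
  hence "tail_moment 2 (1 / x) = (\<integral>s. 2 * (1 - exp (- x * s)) - (1 - exp (- (2 * x) * s)) \<partial>\<nu>)"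
    unfolding tail_moment_def by simp
  also have "\<dots> = (\<integral>s. 2 * (1 - exp (- x * s)) \<partial>\<nu>) - \<phi> (2 * x)"
    unfolding laplace_exponent_def using assms
    by (intro Bochner_Integration.integral_diff integrable_mult_right integrable_exponent) auto
  also have "\<dots> = 2 * \<phi> x - \<phi> (2 * x)" by (simp only: laplace_exponent_def integral_mult_right_zero)
  finally show ?thesis .
qed

lemma tail_moment_2_double: assumes "0 < x"
  shows "tail_moment 2 (1 / (2 * x)) \<le> 4 * tail_moment 2 (1 / x)"
proof -
  have "tail_moment 2 (1 / (2 * x)) \<le> (\<integral>s. 4 * (1 - exp (- s / (1 / x)))\<^sup>2 \<partial>\<nu>)"
    unfolding tail_moment_def
  proof (rule integral_mono_AE)
    show "AE s in \<nu>. (1 - exp (- s / (1 / (2 * x))))\<^sup>2 \<le> 4 * (1 - exp (- s / (1 / x)))\<^sup>2"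
      using AE_pos
    proof eventually_elim
      case (elim s)
      define y where "y = exp (- x * s)"
      have y: "0 \<le> y" "y \<le> 1" using elim assms by (auto simp: y_def)
      have "exp (- s / (1 / (2 * x))) = y * y" by (simp add: y_def algebra_simps flip: exp_add)
      moreover have "exp (- s / (1 / x)) = y" by (simp add: y_def algebra_simps)
      moreover have "1 - y * y \<le> 2 * (1 - y)" using zero_le_power2[of "1 - y"] by (simp add: power2_eq_square algebra_simps)
      hence "(1 - y * y)\<^sup>2 \<le> (2 * (1 - y))\<^sup>2" using y by (intro power_mono) (auto simp: mult_le_one)
      hence "(1 - y * y)\<^sup>2 \<le> 4 * (1 - y)\<^sup>2" by (simp only: power_mult_distrib) simp
      ultimately show ?case by simp
    qed
  qed (use assms in \<open>intro integrable_mult_right integrable_tail_moment; simp\<close>)+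
  also have "\<dots> = 4 * tail_moment 2 (1 / x)" by (simp add: tail_moment_def)
  finally show ?thesis .
qed

text \<open>
  At \<open>x = 1 / T t\<close> the second difference is at most \<open>\<phi>(x) = 1 / t\<close>, and it is unbounded since \<open>w\<close> is
  unbounded at \<open>0\<close>; so the intermediate value theorem applies.
\<close>

lemma ex_unit_second_difference: assumes t: "0 < t"
  shows "\<exists>x\<ge>1 / T t. t * tail_moment 2 (1 / x) = 1"
proof -
  let ?G = "\<lambda>x. 2 * \<phi> x - \<phi> (2 * x)"
  define x0 where "x0 = 1 / T t"
  have x0: "0 < x0" using T_pos t by (simp add: x0_def)
  have "?G x0 \<le> \<phi> x0" using \<phi>_mono[of x0 "2 * x0"] x0 by simp
  hence low: "?G x0 \<le> 1 / t" using \<phi>_T t by (simp add: x0_def)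
  obtain s where s: "0 < s" "s \<le> T t" "4 / t \<le> w s" using w_unbounded[OF T_pos[OF t]] by blast
  have "1 / t \<le> (1 / 2)\<^sup>2 * w s" using s by (simp add: power2_eq_square)
  also have "\<dots> \<le> (1 - exp (-1))\<^sup>2 * w s"
    using one_minus_exp_half w_pos[OF s(1)] by (intro mult_right_mono power_mono) auto
  also have "\<dots> \<le> tail_moment 2 s" using s by (intro tail_moment_ge) auto
  finally have high: "1 / t \<le> ?G (1 / s)" using tail_moment_2[of "1 / s"] s by simp
  have x0s: "x0 \<le> 1 / s" using s by (simp add: x0_def frac_le)
  have "continuous_on {x0..1 / s} ?G"
    using x0 by (intro continuous_intros continuous_on_compose2[OF \<phi>_continuous]) auto
  then obtain x where "x0 \<le> x" "?G x = 1 / t" using IVT'[of ?G x0 "1 / t" "1 / s", OF low high x0s] by auto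
  moreover from this have "0 < x" using x0 by simp
  ultimately show ?thesis using tail_moment_2[of x] t by (intro exI[of _ x]) (auto simp: x0_def)
qed

end

context poly_subordinator
begin

lemma prob_le_laplace: assumes "0 < t" "0 < s"
  shows "prob {\<omega>\<in>space M. S t \<omega> \<le> s} \<le> exp (1 - t * \<phi> (1 / s))"
proof -
  have [measurable]: "S t \<in> borel_measurable M" using S_measurable assms by simp
  have "prob {\<omega>\<in>space M. S t \<omega> \<le> s} = (\<integral>\<omega>. indicator {\<omega>\<in>space M. S t \<omega> \<le> s} \<omega> \<partial>M)" by simp
  also have "\<dots> \<le> (\<integral>\<omega>. exp 1 * exp (- (1 / s) * S t \<omega>) \<partial>M)"
  proof (rule integral_mono)
    show "integrable M (\<lambda>\<omega>. exp 1 * exp (- (1 / s) * S t \<omega>))"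
      using assms by (intro integrable_mult_right integrable_exp) auto
    show "indicator {\<omega>\<in>space M. S t \<omega> \<le> s} \<omega> \<le> exp 1 * exp (- (1 / s) * S t \<omega>)" for \<omega>
      using assms by (auto simp: indicator_def simp flip: exp_add)
  qed (auto simp: less_top[symmetric])
  also have "\<dots> = exp 1 * exp (- t * \<phi> (1 / s))" using laplace_\<phi>[of t "1 / s"] assms by simp
  also have "\<dots> = exp (1 - t * \<phi> (1 / s))" by (simp flip: exp_add)
  finally show ?thesis .
qed

lemma prob_below_T: assumes "0 < t" "0 < e" "e \<le> 1"
  shows "prob {\<omega>\<in>space M. S t \<omega> \<le> e * T t} \<le> exp (1 - b\<^sub>1 * (1 / e) powr \<beta>\<^sub>1)"
proof -
  have "prob {\<omega>\<in>space M. S t \<omega> \<le> e * T t} \<le> exp (1 - t * \<phi> (1 / (e * T t)))"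
    using assms T_pos[of t] by (intro prob_le_laplace) auto
  also have "\<dots> \<le> exp (1 - b\<^sub>1 * (1 / e) powr \<beta>\<^sub>1)" using \<phi>_below_T[OF assms] by simp
  finally show ?thesis .
qed

text \<open>
  Let \<open>x\<close> be as in \<open>ex_unit_second_difference\<close>.  On \<open>S t \<ge> T t\<close> one has
  \<open>exp (- 2 x S t) \<le> exp (- x T t) exp (- x S t)\<close>, and the choice of \<open>x\<close>, together with the concavity
  of \<open>\<phi>\<close>, makes the expectation of the right side at most \<open>1 / e\<close> times that of \<open>exp (- 2 x S t)\<close>.  A
  fixed portion of the latter is therefore carried by \<open>S t < T t\<close>, and the Cauchy-Schwarz inequality
  bounds the probability of this event from below; the price, \<open>t (2\<phi>(2x) - \<phi>(4x)) \<le> 4\<close>, is again a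
  second difference.
\<close>

lemma prob_less_T: assumes t: "0 < t"
  shows "exp (- 4) * (1 - exp (- 1))\<^sup>2 \<le> prob {\<omega>\<in>space M. S t \<omega> < T t}"
proof -
  obtain x where x: "1 / T t \<le> x" and G: "t * tail_moment 2 (1 / x) = 1"
    using ex_unit_second_difference[OF t] by blast
  have x0: "0 < x" using x T_pos[OF t] by (auto intro: less_le_trans[of _ "1 / T t"])
  have G1: "t * (2 * \<phi> x - \<phi> (2 * x)) = 1" using G tail_moment_2[OF x0] by simp
  have "2 * \<phi> (2 * x) - \<phi> (2 * (2 * x)) \<le> 4 * (2 * \<phi> x - \<phi> (2 * x))"
    using tail_moment_2_double[OF x0] tail_moment_2[of x] tail_moment_2[of "2 * x"] x0 by simp
  hence "t * (2 * \<phi> (2 * x) - \<phi> (2 * (2 * x))) \<le> t * (4 * (2 * \<phi> x - \<phi> (2 * x)))"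
    using t by (intro mult_left_mono) auto
  hence G2: "t * (2 * \<phi> (2 * x) - \<phi> (4 * x)) \<le> 4" using G1 by (simp add: algebra_simps)
  have "\<phi> x = \<phi> ((x * T t) * (1 / T t))" using T_pos[OF t] by simp
  also have "\<dots> \<le> (x * T t) * \<phi> (1 / T t)"
    using T_pos[OF t] x by (intro \<phi>_sublinear) (auto simp: field_simps)
  finally have xT: "t * \<phi> x \<le> x * T t" using \<phi>_T[OF t] t by (simp add: field_simps)
  have [measurable]: "S t \<in> borel_measurable M" using S_measurable t by simp
  define A where "A = {\<omega>\<in>space M. S t \<omega> < T t}"
  have [measurable]: "A \<in> sets M" by (simp add: A_def)
  define p where "p = prob A"
  define a where "a = (1 - exp (- 1)) * exp (- t * \<phi> (2 * x))"
  define B where "B = exp (- t * \<phi> (4 * x))"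
  have ap: "0 < a" "0 < B" using one_minus_exp_half by (auto simp: a_def B_def)
  \<comment> \<open>The Cauchy-Schwarz inequality in the form \<open>2 y \<le> (a / B) y\<^sup>2 + B / a\<close>; here \<open>B\<close> is the second
     moment of \<open>y = exp (- 2 x S t)\<close> and \<open>a\<close> the part of its mean known to come from \<open>S t < T t\<close>.\<close>
  have "exp (- t * \<phi> (2 * x)) = (\<integral>\<omega>. exp (- (2 * x) * S t \<omega>) \<partial>M)"
    using laplace_\<phi>[OF t, of "2 * x"] x0 by simp
  also have "\<dots> \<le> (\<integral>\<omega>. exp (- x * T t) * exp (- x * S t \<omega>)
      + (a / (2 * B) * exp (- (4 * x) * S t \<omega>) + B / (2 * a) * indicator A \<omega>) \<partial>M)"
  proof (rule integral_mono)
    show "integrable M (\<lambda>\<omega>. exp (- (2 * x) * S t \<omega>))" using t x0 by (intro integrable_exp) auto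
    show "integrable M (\<lambda>\<omega>. exp (- x * T t) * exp (- x * S t \<omega>)
      + (a / (2 * B) * exp (- (4 * x) * S t \<omega>) + B / (2 * a) * indicator A \<omega>))"
      using t x0 by (intro Bochner_Integration.integrable_add integrable_mult_right integrable_exp
        integrable_real_indicator) (auto simp: less_top[symmetric])
    fix \<omega> assume \<omega>: "\<omega> \<in> space M"
    show "exp (- (2 * x) * S t \<omega>) \<le> exp (- x * T t) * exp (- x * S t \<omega>)
      + (a / (2 * B) * exp (- (4 * x) * S t \<omega>) + B / (2 * a) * indicator A \<omega>)"
    proof (cases "\<omega> \<in> A")
      case True
      define y where "y = exp (- (2 * x) * S t \<omega>)"
      have y2: "exp (- (4 * x) * S t \<omega>) = y * y" by (simp add: y_def algebra_simps flip: exp_add)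
      have "0 \<le> (a * y - B)\<^sup>2 / (2 * a * B)" using ap by simp
      also have "(a * y - B)\<^sup>2 / (2 * a * B) = a / (2 * B) * (y * y) + B / (2 * a) - y"
        using ap by (simp add: power2_eq_square field_simps)
      finally have "y \<le> a / (2 * B) * (y * y) + B / (2 * a) * 1" by simp
      moreover have "0 \<le> exp (- x * T t) * exp (- x * S t \<omega>)" by simp
      moreover have ind: "indicator A \<omega> = (1 :: real)" using True by simp
      ultimately show ?thesis unfolding y2 y_def[symmetric] ind by linarith
    next
      case False
      hence "x * T t \<le> x * S t \<omega>" using \<omega> x0 by (simp add: A_def not_less)
      hence "exp (- (2 * x) * S t \<omega>) \<le> exp (- x * T t) * exp (- x * S t \<omega>)"
        by (simp flip: exp_add)
      moreover have "0 \<le> a / (2 * B) * exp (- (4 * x) * S t \<omega>)" using ap by simp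
      ultimately show ?thesis using False by simp
    qed
  qed
  also have "\<dots> = exp (- x * T t) * exp (- t * \<phi> x) + (a / (2 * B) * B + B / (2 * a) * p)"
  proof -
    have i: "integrable M (\<lambda>\<omega>. exp (- x * T t) * exp (- x * S t \<omega>))"
      "integrable M (\<lambda>\<omega>. a / (2 * B) * exp (- (4 * x) * S t \<omega>))"
      "integrable M (\<lambda>\<omega>. B / (2 * a) * indicator A \<omega>)"
      using t x0 by (intro integrable_mult_right integrable_exp integrable_real_indicator;
        simp add: less_top[symmetric])+
    have "(\<integral>\<omega>. exp (- x * T t) * exp (- x * S t \<omega>)
      + (a / (2 * B) * exp (- (4 * x) * S t \<omega>) + B / (2 * a) * indicator A \<omega>) \<partial>M)
      = (\<integral>\<omega>. exp (- x * T t) * exp (- x * S t \<omega>) \<partial>M)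
      + (\<integral>\<omega>. a / (2 * B) * exp (- (4 * x) * S t \<omega>) + B / (2 * a) * indicator A \<omega> \<partial>M)"
      by (intro Bochner_Integration.integral_add Bochner_Integration.integrable_add i)
    also have "(\<integral>\<omega>. a / (2 * B) * exp (- (4 * x) * S t \<omega>) + B / (2 * a) * indicator A \<omega> \<partial>M)
      = (\<integral>\<omega>. a / (2 * B) * exp (- (4 * x) * S t \<omega>) \<partial>M) + (\<integral>\<omega>. B / (2 * a) * indicator A \<omega> \<partial>M)"
      by (intro Bochner_Integration.integral_add i)
    finally show ?thesis
      unfolding integral_mult_right_zero
      using laplace_\<phi>[OF t, of x] laplace_\<phi>[OF t, of "4 * x"] x0 by (simp add: p_def B_def)
  qed
  also have "exp (- x * T t) * exp (- t * \<phi> x) \<le> exp (- 1) * exp (- t * \<phi> (2 * x))"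
    using xT G1 by (simp add: algebra_simps flip: exp_add)
  finally have "exp (- t * \<phi> (2 * x)) \<le> exp (- 1) * exp (- t * \<phi> (2 * x)) + (a / (2 * B) * B + B / (2 * a) * p)"
    by simp
  moreover have "a / (2 * B) * B = a / 2" using ap by simp
  moreover have "a = exp (- t * \<phi> (2 * x)) - exp (- 1) * exp (- t * \<phi> (2 * x))"
    by (simp add: a_def algebra_simps)
  ultimately have "a \<le> a / 2 + B / (2 * a) * p" by linarith
  hence "a / 2 * (2 * a / B) \<le> B / (2 * a) * p * (2 * a / B)" using ap by (intro mult_right_mono) auto
  hence "a\<^sup>2 / B \<le> p" using ap by (simp add: power2_eq_square)
  moreover have "exp (- 4) * (1 - exp (- 1))\<^sup>2 \<le> a\<^sup>2 / B"
  proof -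
    have "a\<^sup>2 / B = (1 - exp (- 1))\<^sup>2 * exp (- (t * (2 * \<phi> (2 * x) - \<phi> (4 * x))))"
    proof -
      have "a\<^sup>2 / B = (1 - exp (- 1))\<^sup>2 * (exp (- t * \<phi> (2 * x)) * exp (- t * \<phi> (2 * x)) / B)"
        by (simp add: a_def power2_eq_square)
      also have "exp (- t * \<phi> (2 * x)) * exp (- t * \<phi> (2 * x)) / B
        = exp (- (t * (2 * \<phi> (2 * x) - \<phi> (4 * x))))"
        by (simp add: B_def algebra_simps flip: exp_add exp_diff)
      finally show ?thesis .
    qed
    also have "\<dots> \<ge> (1 - exp (- 1))\<^sup>2 * exp (- 4)" using G2 by (intro mult_left_mono) auto
    finally show ?thesis by (simp add: mult.commute)
  qed
  ultimately show ?thesis unfolding p_def A_def by linarith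
qed

lemma law_moment_ge_prob: assumes "0 < t" "0 < a"
  shows "(1 - exp (- 1)) ^ k * prob {\<omega>\<in>space M. a < S t \<omega>} \<le> law_moment k t a"
proof -
  have [measurable]: "S t \<in> borel_measurable M" using S_measurable assms by simp
  have "(1 - exp (- 1)) ^ k * prob {\<omega>\<in>space M. a < S t \<omega>}
      = (\<integral>\<omega>. (1 - exp (- 1)) ^ k * indicator {\<omega>\<in>space M. a < S t \<omega>} \<omega> \<partial>M)" by simp
  also have "\<dots> \<le> law_moment k t a" unfolding law_moment_def
  proof (rule integral_mono_AE)
    show "integrable M (\<lambda>\<omega>. (1 - exp (- 1) :: real) ^ k * indicator {\<omega>\<in>space M. a < S t \<omega>} \<omega>)"
      by (intro integrable_mult_right integrable_real_indicator) (auto simp: less_top[symmetric])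
    show "AE \<omega> in M. (1 - exp (- 1)) ^ k * indicator {\<omega>\<in>space M. a < S t \<omega>} \<omega> \<le> (1 - exp (- S t \<omega> / a)) ^ k"
      using AE_S_nonneg[OF less_imp_le[OF assms(1)]]
    proof eventually_elim
      case (elim \<omega>)
      thus ?case using assms
        by (auto simp: indicator_def field_simps intro!: power_mono)
    qed
  qed (rule integrable_law_moment[OF assms])
  finally show ?thesis .
qed

text \<open>
  Where \<open>\<theta> S \<le> 1\<close>, \<open>exp (\<theta> S) - 1\<close> is of order \<open>1 - exp (- \<theta> S)\<close>; elsewhere the truncation bounds the
  exponential by \<open>exp (\<theta> a)\<close>, and the \<open>k\<close>-th power of \<open>1 - exp (- \<theta> S)\<close> is bounded below.  The two
  resulting moments have limits for small times.
\<close>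

lemma exp_min_law_moment: assumes \<tau>: "0 < \<tau>" and \<theta>: "0 < \<theta>" and a: "0 < a"
  shows "(\<integral>\<^sup>+\<omega>. ennreal (exp (\<theta> * min (S \<tau> \<omega>) a)) \<partial>M) \<le>
    ennreal (1 + (exp 1 * law_moment 1 \<tau> (1 / \<theta>)
      + exp (\<theta> * a) / (1 - exp (- 1)) ^ k * law_moment k \<tau> (1 / \<theta>)))"
proof -
  define c where "c = exp (\<theta> * a) / (1 - exp (- 1)) ^ k"
  have c0: "0 \<le> c" using one_minus_exp_half by (auto simp: c_def)
  let ?u = "\<lambda>\<omega>. 1 - exp (- S \<tau> \<omega> / (1 / \<theta>))"
  have i1: "integrable M (\<lambda>\<omega>. ?u \<omega> ^ 1)" and ik: "integrable M (\<lambda>\<omega>. ?u \<omega> ^ k)"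
    using \<theta> by (intro integrable_law_moment[OF \<tau>]; simp)+
  have nn: "AE \<omega> in M. 0 \<le> ?u \<omega>" using AE_S_nonneg[of \<tau>] \<tau> \<theta>
    by (auto elim!: eventually_mono)
  have "(\<integral>\<^sup>+\<omega>. ennreal (exp (\<theta> * min (S \<tau> \<omega>) a)) \<partial>M)
      \<le> (\<integral>\<^sup>+\<omega>. ennreal (1 + (exp 1 * ?u \<omega> ^ 1 + c * ?u \<omega> ^ k)) \<partial>M)"
  proof (rule nn_integral_mono_AE)
    show "AE \<omega> in M. ennreal (exp (\<theta> * min (S \<tau> \<omega>) a)) \<le> ennreal (1 + (exp 1 * ?u \<omega> ^ 1 + c * ?u \<omega> ^ k))"
      using AE_S_nonneg[OF less_imp_le[OF \<tau>]]
    proof eventually_elim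
      case (elim \<omega>)
      define z where "z = \<theta> * S \<tau> \<omega>"
      have z: "0 \<le> z" "?u \<omega> = 1 - exp (- z)" using elim \<theta> by (auto simp: z_def mult.commute)
      have u: "0 \<le> 1 - exp (- z)" using z by simp
      have "exp (\<theta> * min (S \<tau> \<omega>) a) \<le> 1 + (exp 1 * ?u \<omega> ^ 1 + c * ?u \<omega> ^ k)"
      proof (cases "z \<le> 1")
        case True
        have "exp (\<theta> * min (S \<tau> \<omega>) a) \<le> exp z" using \<theta> by (simp add: z_def)
        also have "exp z = 1 + exp z * (1 - exp (- z))" by (simp add: algebra_simps flip: exp_add)
        also have "\<dots> \<le> 1 + exp 1 * (1 - exp (- z))" using True u by (intro add_left_mono mult_right_mono) auto
        also have "\<dots> \<le> 1 + (exp 1 * ?u \<omega> ^ 1 + c * ?u \<omega> ^ k)" unfolding z(2) using c0 u by simp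
        finally show ?thesis .
      next
        case False
        have "exp (\<theta> * min (S \<tau> \<omega>) a) \<le> exp (\<theta> * a)" using \<theta> by simp
        also have "exp (\<theta> * a) = c * (1 - exp (- 1)) ^ k" using one_minus_exp_half by (simp add: c_def)
        also have "\<dots> \<le> c * (1 - exp (- z)) ^ k"
          using False c0 by (intro mult_left_mono power_mono) auto
        also have "\<dots> \<le> 1 + (exp 1 * ?u \<omega> ^ 1 + c * ?u \<omega> ^ k)" unfolding z(2) using u by simp
        finally show ?thesis .
      qed
      thus ?case by (rule ennreal_leI)
    qed
  qed
  also have "\<dots> = ennreal (\<integral>\<omega>. 1 + (exp 1 * ?u \<omega> ^ 1 + c * ?u \<omega> ^ k) \<partial>M)"
    using nn c0
    by (intro nn_integral_eq_integral Bochner_Integration.integrable_add integrable_mult_right i1 ik)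
       (auto elim!: eventually_mono)
  also have "(\<integral>\<omega>. 1 + (exp 1 * ?u \<omega> ^ 1 + c * ?u \<omega> ^ k) \<partial>M)
     = 1 + (exp 1 * law_moment 1 \<tau> (1 / \<theta>) + c * law_moment k \<tau> (1 / \<theta>))"
  proof -
    have "(\<integral>\<omega>. 1 + (exp 1 * ?u \<omega> ^ 1 + c * ?u \<omega> ^ k) \<partial>M)
       = (\<integral>\<omega>. 1 \<partial>M) + (\<integral>\<omega>. exp 1 * ?u \<omega> ^ 1 + c * ?u \<omega> ^ k \<partial>M)"
      by (intro Bochner_Integration.integral_add Bochner_Integration.integrable_add integrable_mult_right i1 ik) auto
    also have "(\<integral>\<omega>. exp 1 * ?u \<omega> ^ 1 + c * ?u \<omega> ^ k \<partial>M)
       = (\<integral>\<omega>. exp 1 * ?u \<omega> ^ 1 \<partial>M) + (\<integral>\<omega>. c * ?u \<omega> ^ k \<partial>M)"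
      by (intro Bochner_Integration.integral_add integrable_mult_right i1 ik)
    finally show ?thesis by (simp only: law_moment_def integral_mult_right_zero) (simp add: prob_space)
  qed
  finally show ?thesis by (simp add: c_def)
qed

end

context poly_subordinator
begin

text \<open>
  The truncated Chernoff bound with \<open>a = r / 4\<close>, as the number of increments tends to infinity.
\<close>

lemma tail_bound: assumes t: "0 < t" and r: "0 < r" and \<theta>: "0 < \<theta>" and k: "1 \<le> k"
  defines "c \<equiv> 1 / (1 - exp (- 1)) ^ k"
  shows "prob {\<omega>\<in>space M. r \<le> S t \<omega>} \<le> c * (t * tail_moment k (r / 4))
    + exp (- \<theta> * r) * exp (exp 1 * (t * \<phi> \<theta>) + exp (\<theta> * (r / 4)) * c * (t * tail_moment k (1 / \<theta>)))"
proof (rule LIMSEQ_le_const)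
  let ?m = "\<lambda>k a n. real n * law_moment k (t / real n) a"
  have c0: "0 < c" using one_minus_exp_half by (auto simp: c_def)
  have l1: "?m 1 (1 / \<theta>) \<longlonglongrightarrow> t * \<phi> \<theta>"
    using law_moment_limit[OF t, of "1 / \<theta>" 1] \<theta>
    by (simp add: tail_moment_def laplace_exponent_def mult.commute)
  show "(\<lambda>n. c * ?m k (r / 4) n + exp (- \<theta> * r) * exp (exp 1 * ?m 1 (1 / \<theta>) n + exp (\<theta> * (r / 4)) * c * ?m k (1 / \<theta>) n))
    \<longlonglongrightarrow> c * (t * tail_moment k (r / 4))
    + exp (- \<theta> * r) * exp (exp 1 * (t * \<phi> \<theta>) + exp (\<theta> * (r / 4)) * c * (t * tail_moment k (1 / \<theta>)))"
    using r \<theta> by (intro tendsto_intros l1 law_moment_limit t k) auto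
  show "\<exists>N. \<forall>n\<ge>N. prob {\<omega>\<in>space M. r \<le> S t \<omega>} \<le> c * ?m k (r / 4) n
     + exp (- \<theta> * r) * exp (exp 1 * ?m 1 (1 / \<theta>) n + exp (\<theta> * (r / 4)) * c * ?m k (1 / \<theta>) n)"
  proof (intro exI[of _ 1] allI impI)
    fix n :: nat assume n1: "1 \<le> n"
    hence n: "0 < n" by simp
    define \<tau> where "\<tau> = t / real n"
    have \<tau>: "0 < \<tau>" using t n by (simp add: \<tau>_def)
    define y where "y = exp 1 * law_moment 1 \<tau> (1 / \<theta>) + exp (\<theta> * (r / 4)) * c * law_moment k \<tau> (1 / \<theta>)"
    have lm0: "0 \<le> law_moment j \<tau> (1 / \<theta>)" for j
      unfolding law_moment_def using AE_S_nonneg[of \<tau>] \<tau> \<theta>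
      by (intro integral_nonneg_AE) (auto elim!: eventually_mono)
    have y0: "0 \<le> y" unfolding y_def using lm0 c0 by (intro add_nonneg_nonneg mult_nonneg_nonneg) auto
    have "(\<integral>\<^sup>+\<omega>. ennreal (exp (\<theta> * min (S \<tau> \<omega>) (r / 4))) \<partial>M) \<le> ennreal (1 + y)"
      using exp_min_law_moment[OF \<tau> \<theta>, of "r / 4" k] r by (simp add: y_def c_def)
    also have "\<dots> \<le> ennreal (exp y)" by (intro ennreal_leI) (use exp_ge_add_one_self[of y] in simp)
    finally have "(\<integral>\<^sup>+\<omega>. ennreal (exp (\<theta> * min (S \<tau> \<omega>) (r / 4))) \<partial>M) ^ n \<le> ennreal (exp y) ^ n"
      by (intro power_mono) auto
    also have "\<dots> = ennreal (exp (real n * y))" by (simp add: ennreal_power exp_of_nat_mult)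
    finally have P: "(\<integral>\<^sup>+\<omega>. ennreal (exp (\<theta> * min (S \<tau> \<omega>) (r / 4))) \<partial>M) ^ n \<le> ennreal (exp (real n * y))" .
    have "(1 - exp (- 1)) ^ k * prob {\<omega>\<in>space M. r / 4 < S \<tau> \<omega>} \<le> law_moment k \<tau> (r / 4)"
      using r by (intro law_moment_ge_prob[OF \<tau>]) auto
    hence "c * ((1 - exp (- 1)) ^ k * prob {\<omega>\<in>space M. r / 4 < S \<tau> \<omega>}) \<le> c * law_moment k \<tau> (r / 4)"
      using c0 by (intro mult_left_mono) auto
    hence Q: "prob {\<omega>\<in>space M. r / 4 < S \<tau> \<omega>} \<le> c * law_moment k \<tau> (r / 4)"
      using one_minus_exp_half by (simp add: c_def)
    have "ennreal (prob {\<omega>\<in>space M. r \<le> S t \<omega>}) \<le> of_nat n * emeasure M {\<omega>\<in>space M. r / 4 < S \<tau> \<omega>}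
       + ennreal (exp (- \<theta> * r)) * (\<integral>\<^sup>+\<omega>. ennreal (exp (\<theta> * min (S \<tau> \<omega>) (r / 4))) \<partial>M) ^ n"
      using truncated_chernoff[OF t n less_imp_le[OF \<theta>], of r "r / 4"]
      by (simp add: \<tau>_def emeasure_eq_measure)
    also have "\<dots> \<le> ennreal (real n) * ennreal (c * law_moment k \<tau> (r / 4))
       + ennreal (exp (- \<theta> * r)) * ennreal (exp (real n * y))"
      using Q P by (intro add_mono mult_mono) (auto simp: emeasure_eq_measure ennreal_of_nat_eq_real_of_nat intro!: ennreal_leI)
    also have "\<dots> = ennreal (real n * (c * law_moment k \<tau> (r / 4)) + exp (- \<theta> * r) * exp (real n * y))"
      using order_trans[OF measure_nonneg Q] by (simp add: ennreal_mult'[symmetric])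
    finally have "prob {\<omega>\<in>space M. r \<le> S t \<omega>} \<le> real n * (c * law_moment k \<tau> (r / 4)) + exp (- \<theta> * r) * exp (real n * y)"
      using order_trans[OF measure_nonneg Q] by (subst (asm) ennreal_le_iff) auto
    also have "real n * y = exp 1 * ?m 1 (1 / \<theta>) n + exp (\<theta> * (r / 4)) * c * ?m k (1 / \<theta>) n"
      by (simp add: y_def \<tau>_def algebra_simps)
    also have "real n * (c * law_moment k \<tau> (r / 4)) = c * ?m k (r / 4) n"
      by (simp add: \<tau>_def)
    finally show "prob {\<omega>\<in>space M. r \<le> S t \<omega>} \<le> c * ?m k (r / 4) n
     + exp (- \<theta> * r) * exp (exp 1 * ?m 1 (1 / \<theta>) n + exp (\<theta> * (r / 4)) * c * ?m k (1 / \<theta>) n)" .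
  qed
qed

text \<open>
  With \<open>a = s / \<eta>\<close> and \<open>u = 1 - exp (- X / a)\<close>, \<open>u\<^sup>k\<close> is at most the indicator of \<open>X > s\<close> plus
  \<open>\<eta> u\<^sup>k\<^sup>-\<^sup>1\<close>.  For \<open>X = S (t / n)\<close> this bounds \<open>n P(X > s)\<close> from below in the limit, and
  \<open>P(X \<le> s)\<^sup>n \<le> exp (- n P(X > s))\<close>.
\<close>

lemma prob_le_exp_moments:
  assumes t: "0 < t" and \<eta>: "0 < \<eta>" and s: "0 < s" and k: "2 \<le> k"
  shows "prob {\<omega>\<in>space M. S t \<omega> \<le> s}
    \<le> exp (- (t * tail_moment k (s / \<eta>) - \<eta> * (t * tail_moment (k - 1) (s / \<eta>))))"
proof (rule LIMSEQ_le_const)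
  let ?m = "\<lambda>k n. real n * law_moment k (t / real n) (s / \<eta>)"
  show "(\<lambda>n. exp (- (?m k n - \<eta> * ?m (k - 1) n)))
    \<longlonglongrightarrow> exp (- (t * tail_moment k (s / \<eta>) - \<eta> * (t * tail_moment (k - 1) (s / \<eta>))))"
    using s \<eta> k by (intro tendsto_intros law_moment_limit t) auto
  show "\<exists>N. \<forall>n\<ge>N. prob {\<omega>\<in>space M. S t \<omega> \<le> s} \<le> exp (- (?m k n - \<eta> * ?m (k - 1) n))"
  proof (intro exI[of _ 1] allI impI)
    fix n :: nat assume "1 \<le> n"
    hence n: "0 < n" by simp
    define \<tau> where "\<tau> = t / real n"
    have \<tau>: "0 < \<tau>" using t n by (simp add: \<tau>_def)
    have [measurable]: "S \<tau> \<in> borel_measurable M" using S_measurable \<tau> by simp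
    let ?u = "\<lambda>\<omega>. 1 - exp (- S \<tau> \<omega> / (s / \<eta>))"
    define A where "A = {\<omega>\<in>space M. s < S \<tau> \<omega>}"
    have [measurable]: "A \<in> sets M" by (simp add: A_def)
    have i: "integrable M (\<lambda>\<omega>. ?u \<omega> ^ j)" for j using s \<eta> by (intro integrable_law_moment[OF \<tau>]) simp
    have iA: "integrable M (indicator A :: _ \<Rightarrow> real)"
      by (intro integrable_real_indicator) (auto simp: less_top[symmetric])
    have "law_moment k \<tau> (s / \<eta>) \<le> (\<integral>\<omega>. indicator A \<omega> + \<eta> * ?u \<omega> ^ (k - 1) \<partial>M)"
      unfolding law_moment_def
    proof (rule integral_mono_AE)
      show "AE \<omega> in M. ?u \<omega> ^ k \<le> indicator A \<omega> + \<eta> * ?u \<omega> ^ (k - 1)"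
        using AE_S_nonneg[OF less_imp_le[OF \<tau>]] AE_space
      proof eventually_elim
        case (elim \<omega>)
        have u: "0 \<le> ?u \<omega>" "?u \<omega> \<le> 1" using elim s \<eta> by auto
        show ?case
        proof (cases "\<omega> \<in> A")
          case True
          have "?u \<omega> ^ k \<le> 1" using u by (intro power_le_one)
          moreover have "0 \<le> \<eta> * ?u \<omega> ^ (k - 1)" using u \<eta> by simp
          ultimately show ?thesis using True by simp
        next
          case False
          hence "\<eta> * S \<tau> \<omega> / s \<le> \<eta>" using elim s \<eta> by (simp add: A_def field_simps)
          moreover have "?u \<omega> \<le> \<eta> * S \<tau> \<omega> / s"
            using exp_ge_add_one_self[of "- S \<tau> \<omega> / (s / \<eta>)"] by (simp add: mult.commute)
          ultimately have "?u \<omega> * ?u \<omega> ^ (k - 1) \<le> \<eta> * ?u \<omega> ^ (k - 1)"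
            using u by (intro mult_right_mono) auto
          moreover have "?u \<omega> * ?u \<omega> ^ (k - 1) = ?u \<omega> ^ k" using k by (subst power_Suc[symmetric]) simp
          ultimately show ?thesis using False by simp
        qed
      qed
      show "integrable M (\<lambda>\<omega>. indicator A \<omega> + \<eta> * ?u \<omega> ^ (k - 1))"
        by (intro Bochner_Integration.integrable_add integrable_mult_right i iA)
    qed (rule i)
    also have "\<dots> = (\<integral>\<omega>. indicator A \<omega> \<partial>M) + (\<integral>\<omega>. \<eta> * ?u \<omega> ^ (k - 1) \<partial>M)"
      by (intro Bochner_Integration.integral_add integrable_mult_right i iA)
    also have "\<dots> = prob A + \<eta> * law_moment (k - 1) \<tau> (s / \<eta>)"
      by (simp only: law_moment_def integral_mult_right_zero) simp
    finally have pA: "law_moment k \<tau> (s / \<eta>) - \<eta> * law_moment (k - 1) \<tau> (s / \<eta>) \<le> prob A" by simp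
    have "prob {\<omega>\<in>space M. S \<tau> \<omega> \<le> s} = 1 - prob A"
      using prob_neg[of "\<lambda>\<omega>. s < S \<tau> \<omega>"] by (simp add: A_def not_less)
    also have "\<dots> \<le> exp (- prob A)" using exp_ge_add_one_self[of "- prob A"] by simp
    finally have "prob {\<omega>\<in>space M. S \<tau> \<omega> \<le> s} ^ n \<le> exp (- prob A) ^ n" by (intro power_mono) auto
    also have "\<dots> = exp (- (real n * prob A))" by (simp flip: exp_of_nat_mult)
    also have "\<dots> \<le> exp (- (?m k n - \<eta> * ?m (k - 1) n))"
      using mult_left_mono[OF pA, of "real n"] by (simp add: \<tau>_def algebra_simps)
    finally show "prob {\<omega>\<in>space M. S t \<omega> \<le> s} \<le> exp (- (?m k n - \<eta> * ?m (k - 1) n))"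
      using prob_le_power[OF t n, of s] unfolding \<tau>_def by linarith
  qed
qed

end

context poly_levy
begin

lemma prob_between:
  "\<exists>e c. 0 < e \<and> e \<le> 1 \<and> 0 < c \<and> (\<forall>(M :: 'w measure) S t. driftless_subordinator M S \<nu> \<longrightarrow> 0 < t \<longrightarrow>
     c \<le> measure M {\<omega>\<in>space M. e * T t < S t \<omega> \<and> S t \<omega> \<le> T t})"
proof -
  define c where "c = exp (- 4) * (1 - exp (- 1 :: real))\<^sup>2 / 2"
  have c: "0 < c" using one_minus_exp_half by (auto simp: c_def)
  \<comment> \<open>\<open>1 / K\<close> is so small that at most half of the probability of \<open>S t < T t\<close> is lost below \<open>T t / K\<close>.\<close>
  define K where "K = (max 1 ((1 - ln c) / b\<^sub>1)) powr (1 / \<beta>\<^sub>1)"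
  have K1: "1 \<le> K" unfolding K_def using pos by (intro ge_one_powr_ge_zero) auto
  have KK: "K powr \<beta>\<^sub>1 = max 1 ((1 - ln c) / b\<^sub>1)" unfolding K_def using pos by (simp add: powr_powr)
  have "(1 - ln c) / b\<^sub>1 \<le> K powr \<beta>\<^sub>1" unfolding KK by simp
  hence "1 - b\<^sub>1 * K powr \<beta>\<^sub>1 \<le> ln c" using pos by (simp add: field_simps)
  hence small: "exp (1 - b\<^sub>1 * K powr \<beta>\<^sub>1) \<le> c" using c by (metis exp_le_cancel_iff exp_ln)
  show ?thesis
  proof (rule exI[of _ "1 / K"], rule exI[of _ c], intro conjI allI impI c)
    fix M :: "'w measure" and S t assume sub: "driftless_subordinator M S \<nu>" and t: "0 < (t::real)"
    interpret poly_subordinator M S \<nu> b\<^sub>1 b\<^sub>2 \<beta>\<^sub>1 \<beta>\<^sub>2 by unfold_locales (rule sub)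
    have [measurable]: "S t \<in> borel_measurable M" using S_measurable t by simp
    have "2 * c \<le> prob {\<omega>\<in>space M. S t \<omega> < T t}" using prob_less_T[OF t] by (simp add: c_def)
    also have "\<dots> \<le> prob ({\<omega>\<in>space M. S t \<omega> \<le> 1 / K * T t} \<union> {\<omega>\<in>space M. 1 / K * T t < S t \<omega> \<and> S t \<omega> \<le> T t})"
      by (intro finite_measure_mono) auto
    also have "\<dots> \<le> prob {\<omega>\<in>space M. S t \<omega> \<le> 1 / K * T t} + prob {\<omega>\<in>space M. 1 / K * T t < S t \<omega> \<and> S t \<omega> \<le> T t}"
      by (intro measure_subadditive) (auto simp: emeasure_eq_measure)
    also have "prob {\<omega>\<in>space M. S t \<omega> \<le> 1 / K * T t} \<le> c"
      using prob_below_T[OF t, of "1 / K"] K1 small by simp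
    finally show "c \<le> prob {\<omega>\<in>space M. 1 / K * T t < S t \<omega> \<and> S t \<omega> \<le> T t}" by simp
  qed (use K1 in auto)
qed

text \<open>
  Put \<open>x = t w(r)\<close> and choose \<open>\<theta> = 2 ln (1 / x) / r\<close> in \<open>tail_bound\<close>.  The factor \<open>exp (- \<theta> r)\<close> is
  \<open>x\<^sup>2\<close>.  Half of this exponent pays for the small jumps, since \<open>t \<phi>(1 / r)\<close> is small for \<open>r \<ge> K T\<close>;
  the factor \<open>exp (\<theta> r / 4) = x\<^sup>-\<^sup>1\<^sup>/\<^sup>2\<close> of the remaining term meets a moment of order \<open>x\<close> times a
  power of \<open>ln (1 / x)\<close>, so that term stays bounded.  What is left is of order \<open>x\<close>, as is
  the first summand of the bound.
\<close>

lemma tail_upper_bound: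
  "\<exists>K C. 1 \<le> K \<and> 0 < C \<and> (\<forall>(M :: 'w measure) S t r. driftless_subordinator M S \<nu> \<longrightarrow> 0 < t \<longrightarrow> K * T t \<le> r \<longrightarrow>
     measure M {\<omega>\<in>space M. r \<le> S t \<omega>} \<le> C * (t * w r))"
proof -
  have \<beta>2: "0 < \<beta>\<^sub>2" using pos by linarith
  define k where "k = nat \<lceil>\<beta>\<^sub>2 + 1\<rceil>"
  have k: "\<beta>\<^sub>2 + 1 \<le> real k" "1 \<le> k" using pos unfolding k_def by linarith+
  define c where "c = 1 / (1 - exp (- 1 :: real)) ^ k"
  have c: "0 < c" using one_minus_exp_half by (auto simp: c_def)
  define Q where "Q = real k * (1 + b\<^sub>2)"
  have Q: "0 < Q" using k pos by (auto simp: Q_def intro!: mult_pos_pos)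
  define C1 where "C1 = c * Q * b\<^sub>2 * (4 * \<beta>\<^sub>2) powr \<beta>\<^sub>2"
  define C where "C = max 2 (c * Q * b\<^sub>2 * 4 powr \<beta>\<^sub>2 + exp C1)"
  \<comment> \<open>This \<open>K\<close> makes \<open>t \<phi>(1 / r) \<le> 1 / (2 e)\<close>.\<close>
  define K where "K = (max 1 (2 * exp 1 / b\<^sub>1)) powr (1 / \<beta>\<^sub>1)"
  have K1: "1 \<le> K" unfolding K_def using pos by (intro ge_one_powr_ge_zero) auto
  have KK: "K powr \<beta>\<^sub>1 = max 1 (2 * exp 1 / b\<^sub>1)" unfolding K_def using pos by (simp add: powr_powr)
  have "2 * exp 1 / b\<^sub>1 \<le> K powr \<beta>\<^sub>1" unfolding KK by simp
  hence K2: "2 * exp 1 \<le> b\<^sub>1 * K powr \<beta>\<^sub>1" using pos by (simp add: field_simps)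
  show ?thesis
  proof (rule exI[of _ K], rule exI[of _ C], intro conjI allI impI K1)
    show "0 < C" by (simp add: C_def)
    fix M :: "'w measure" and S and t r :: real
    assume sub: "driftless_subordinator M S \<nu>" and t: "0 < t" and Kr: "K * T t \<le> r"
    interpret poly_subordinator M S \<nu> b\<^sub>1 b\<^sub>2 \<beta>\<^sub>1 \<beta>\<^sub>2 by unfold_locales (rule sub)
    have T0: "0 < T t" using T_pos[OF t] .
    have "1 * T t \<le> K * T t" using K1 T0 by (intro mult_right_mono) auto
    hence Tr: "T t \<le> r" using Kr by simp
    have r: "0 < r" using T0 Tr by simp
    have \<phi>r: "t * \<phi> (1 / r) * (2 * exp 1) \<le> 1"
    proof -
      have "0 \<le> t * \<phi> (1 / r)" using \<phi>_nonneg[of "1 / r"] t r by simp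
      moreover have "K \<le> r / T t" using Kr T0 by (simp add: pos_le_divide_eq)
      hence "2 * exp 1 \<le> b\<^sub>1 * (r / T t) powr \<beta>\<^sub>1"
        using K1 pos by (intro order_trans[OF K2] mult_left_mono powr_mono2) auto
      ultimately have "t * \<phi> (1 / r) * (2 * exp 1) \<le> t * \<phi> (1 / r) * (b\<^sub>1 * (r / T t) powr \<beta>\<^sub>1)"
        by (intro mult_left_mono)
      also have "\<dots> \<le> 1" using \<phi>_above_T[OF t Tr] by (simp add: mult_ac)
      finally show ?thesis .
    qed
    define x where "x = t * w r"
    have x: "0 < x" using t w_pos[OF r] by (simp add: x_def)
    show "prob {\<omega>\<in>space M. r \<le> S t \<omega>} \<le> C * (t * w r)"
    proof (cases "1 / 2 \<le> x")
      case True
      have "prob {\<omega>\<in>space M. r \<le> S t \<omega>} \<le> 1" by (rule prob_le_1)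
      also have "1 \<le> 2 * x" using True by simp
      also have "\<dots> \<le> C * x" using x by (intro mult_right_mono) (auto simp: C_def)
      finally show ?thesis by (simp add: x_def)
    next
      case False
      define y where "y = - ln x"
      have "x < exp (- (1 / 2))"
        using exp_ge_add_one_self[of "- (1 / 2) :: real"] False by linarith
      hence "ln x < - (1 / 2)" using x by (metis exp_less_cancel_iff exp_ln)
      hence y: "1 / 2 < y" by (simp add: y_def)
      have ex: "exp (- y) = x" using x by (simp add: y_def)
      define \<theta> where "\<theta> = 2 * y / r"
      have \<theta>: "0 < \<theta>" using y r by (simp add: \<theta>_def)
      have \<theta>r: "\<theta> * r = 2 * y" using r by (simp add: \<theta>_def)
      have "\<phi> \<theta> = \<phi> ((2 * y) * (1 / r))" by (simp add: \<theta>_def)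
      also have "\<dots> \<le> (2 * y) * \<phi> (1 / r)" using y r by (intro \<phi>_sublinear) auto
      finally have "exp 1 * (t * \<phi> \<theta>) \<le> exp 1 * (t * ((2 * y) * \<phi> (1 / r)))"
        using t by (intro mult_left_mono) auto
      also have "\<dots> = y * (t * \<phi> (1 / r) * (2 * exp 1))" by simp
      also have "\<dots> \<le> y * 1" using \<phi>r y by (intro mult_left_mono) auto
      finally have e1: "exp 1 * (t * \<phi> \<theta>) \<le> y" by simp
      have "1 / \<theta> = r / (2 * y)" by (simp add: \<theta>_def)
      also have "\<dots> \<le> r / 1" using y r by (intro divide_left_mono) auto
      finally have \<theta>r': "1 / \<theta> \<le> r" by simp
      have "tail_moment k (1 / \<theta>) \<le> Q * w (1 / \<theta>)"
        unfolding Q_def using \<theta> k by (intro tail_moment_le) auto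
      also have "\<dots> \<le> Q * (b\<^sub>2 * (r / (1 / \<theta>)) powr \<beta>\<^sub>2 * w r)"
        using w_upper[of "1 / \<theta>" r] \<theta> \<theta>r' Q by (intro mult_left_mono) auto
      also have "r / (1 / \<theta>) = 2 * y" using \<theta>r by (simp add: mult.commute)
      finally have "t * tail_moment k (1 / \<theta>) \<le> t * (Q * (b\<^sub>2 * (2 * y) powr \<beta>\<^sub>2 * w r))"
        using t by (intro mult_left_mono) auto
      also have "\<dots> = Q * b\<^sub>2 * (2 * y) powr \<beta>\<^sub>2 * exp (- y)" unfolding ex by (simp add: x_def)
      also have "\<dots> \<le> Q * b\<^sub>2 * ((\<beta>\<^sub>2 / (1 / 4)) powr \<beta>\<^sub>2 * exp (1 / 4 * (2 * y))) * exp (- y)"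
        using y \<beta>2 Q pos by (intro mult_right_mono mult_left_mono powr_le_exp) auto
      finally have "exp (\<theta> * (r / 4)) * c * (t * tail_moment k (1 / \<theta>)) \<le>
         exp (\<theta> * (r / 4)) * c * (Q * b\<^sub>2 * ((\<beta>\<^sub>2 / (1 / 4)) powr \<beta>\<^sub>2 * exp (1 / 4 * (2 * y))) * exp (- y))"
        using c by (intro mult_left_mono) auto
      also have "\<dots> = C1 * (exp (\<theta> * (r / 4)) * exp (1 / 4 * (2 * y)) * exp (- y))"
        by (simp add: C1_def mult_ac)
      also have "exp (\<theta> * (r / 4)) * exp (1 / 4 * (2 * y)) * exp (- y) = 1"
        using \<theta>r by (simp flip: exp_add)
      finally have e2: "exp (\<theta> * (r / 4)) * c * (t * tail_moment k (1 / \<theta>)) \<le> C1" by simp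
      have "exp (- \<theta> * r) * exp (exp 1 * (t * \<phi> \<theta>) + exp (\<theta> * (r / 4)) * c * (t * tail_moment k (1 / \<theta>)))
         \<le> exp (- y + C1)" unfolding exp_add[symmetric] using e1 e2 \<theta>r by simp
      also have "\<dots> = exp C1 * x" unfolding exp_add ex by simp
      finally have p2: "exp (- \<theta> * r) * exp (exp 1 * (t * \<phi> \<theta>) + exp (\<theta> * (r / 4)) * c * (t * tail_moment k (1 / \<theta>)))
         \<le> exp C1 * x" .
      have "tail_moment k (r / 4) \<le> Q * w (r / 4)"
        unfolding Q_def using r k by (intro tail_moment_le) auto
      also have "\<dots> \<le> Q * (b\<^sub>2 * (r / (r / 4)) powr \<beta>\<^sub>2 * w r)"
        using w_upper[of "r / 4" r] r Q by (intro mult_left_mono) auto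
      finally have "c * (t * tail_moment k (r / 4)) \<le> c * (t * (Q * (b\<^sub>2 * (r / (r / 4)) powr \<beta>\<^sub>2 * w r)))"
        using t c by (intro mult_left_mono) auto
      also have "\<dots> = c * Q * b\<^sub>2 * 4 powr \<beta>\<^sub>2 * x" using r by (simp add: x_def)
      finally have p1: "c * (t * tail_moment k (r / 4)) \<le> c * Q * b\<^sub>2 * 4 powr \<beta>\<^sub>2 * x" .
      have "prob {\<omega>\<in>space M. r \<le> S t \<omega>} \<le> c * Q * b\<^sub>2 * 4 powr \<beta>\<^sub>2 * x + exp C1 * x"
        using tail_bound[OF t r \<theta> k(2)] p1 p2 unfolding c_def by linarith
      also have "\<dots> = (c * Q * b\<^sub>2 * 4 powr \<beta>\<^sub>2 + exp C1) * x" by (simp add: algebra_simps)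
      also have "\<dots> \<le> C * x" using x by (intro mult_right_mono) (auto simp: C_def)
      finally show ?thesis by (simp add: x_def)
    qed
  qed
qed

text \<open>
  In \<open>prob_le_exp_moments\<close> both moments are comparable with \<open>w(s / \<eta>)\<close>, so a fixed small \<open>\<eta>\<close> lets the
  first of them dominate.
\<close>

lemma tail_lower_bound:
  "\<exists>c>0. \<forall>(M :: 'w measure) S t s. driftless_subordinator M S \<nu> \<longrightarrow> 0 < t \<longrightarrow> 0 < s \<longrightarrow>
     measure M {\<omega>\<in>space M. S t \<omega> \<le> s} \<le> exp (- (c * (t * w s)))"
proof -
  define k where "k = nat \<lceil>\<beta>\<^sub>2 + 1\<rceil> + 1"
  have k: "\<beta>\<^sub>2 + 1 \<le> real (k - 1)" "2 \<le> k" using pos unfolding k_def by simp_all linarith+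
  define q where "q = (1 - exp (- 1 :: real)) ^ k"
  have q: "0 < q" "q \<le> 1" using one_minus_exp_half by (auto simp: q_def intro!: power_le_one)
  define Q where "Q = real (k - 1) * (1 + b\<^sub>2)"
  have Q: "1 \<le> Q" using k pos mult_mono[of 1 "real (k - 1)" 1 "1 + b\<^sub>2"] by (simp add: Q_def)
  define \<eta> where "\<eta> = q / (2 * Q)"
  have \<eta>: "0 < \<eta>" "\<eta> \<le> 1" using q Q by (auto simp: \<eta>_def)
  define c where "c = q / 2 * (\<eta> powr \<beta>\<^sub>2 / b\<^sub>2)"
  show ?thesis
  proof (intro exI[of _ c] conjI allI impI)
    show "0 < c" using q \<eta> pos by (simp add: c_def)
    fix M :: "'w measure" and S and t s :: real
    assume sub: "driftless_subordinator M S \<nu>" and t: "0 < t" and s: "0 < s"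
    interpret poly_subordinator M S \<nu> b\<^sub>1 b\<^sub>2 \<beta>\<^sub>1 \<beta>\<^sub>2 by unfold_locales (rule sub)
    have a: "0 < s / \<eta>" "s \<le> s / \<eta>" using s \<eta> by (auto simp: pos_le_divide_eq mult_left_le)
    have "q * w (s / \<eta>) - \<eta> * (Q * w (s / \<eta>)) \<le> tail_moment k (s / \<eta>) - \<eta> * tail_moment (k - 1) (s / \<eta>)"
      unfolding q_def Q_def using a k \<eta>
      by (intro diff_mono tail_moment_ge mult_left_mono tail_moment_le) auto
    moreover have "q * w (s / \<eta>) - \<eta> * (Q * w (s / \<eta>)) = q / 2 * w (s / \<eta>)"
      using Q by (simp add: \<eta>_def field_simps)
    moreover have "\<eta> powr \<beta>\<^sub>2 / b\<^sub>2 * w s \<le> w (s / \<eta>)"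
    proof -
      have "w s \<le> b\<^sub>2 * ((s / \<eta>) / s) powr \<beta>\<^sub>2 * w (s / \<eta>)" using w_upper[OF s a(2)] .
      also have "(s / \<eta>) / s = 1 / \<eta>" using s by simp
      finally have "\<eta> powr \<beta>\<^sub>2 / b\<^sub>2 * w s \<le> \<eta> powr \<beta>\<^sub>2 / b\<^sub>2 * (b\<^sub>2 * (1 / \<eta>) powr \<beta>\<^sub>2 * w (s / \<eta>))"
        using pos by (intro mult_left_mono) auto
      also have "\<dots> = (\<eta> powr \<beta>\<^sub>2 * (1 / \<eta>) powr \<beta>\<^sub>2) * w (s / \<eta>)" using pos by simp
      also have "\<eta> powr \<beta>\<^sub>2 * (1 / \<eta>) powr \<beta>\<^sub>2 = 1" using \<eta> by (simp flip: powr_mult)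
      finally show ?thesis by simp
    qed
    moreover from this have "q / 2 * (\<eta> powr \<beta>\<^sub>2 / b\<^sub>2 * w s) \<le> q / 2 * w (s / \<eta>)"
      using q by (intro mult_left_mono) auto
    moreover have "c * w s = q / 2 * (\<eta> powr \<beta>\<^sub>2 / b\<^sub>2 * w s)" by (simp add: c_def)
    ultimately have "c * w s \<le> tail_moment k (s / \<eta>) - \<eta> * tail_moment (k - 1) (s / \<eta>)" by linarith
    hence "t * (c * w s) \<le> t * (tail_moment k (s / \<eta>) - \<eta> * tail_moment (k - 1) (s / \<eta>))"
      using t by (intro mult_left_mono) auto
    hence "c * (t * w s) \<le> t * tail_moment k (s / \<eta>) - \<eta> * (t * tail_moment (k - 1) (s / \<eta>))"
      by (simp add: algebra_simps)
    thus "prob {\<omega>\<in>space M. S t \<omega> \<le> s} \<le> exp (- (c * (t * w s)))"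
      using prob_le_exp_moments[OF t \<eta>(1) s k(2)] by (auto elim!: order_trans)
  qed
qed

text \<open>
  The difference of the lower bound for \<open>P(S t > a)\<close> and the upper bound for \<open>P(S t \<ge> N a)\<close>; the
  lower scaling of \<open>w\<close> makes the latter small for large \<open>N\<close>.  \<open>N \<ge> 4\<close> lets the block that
  ends at \<open>4 \<Phi> r\<close> begin below \<open>\<Phi> r\<close>, in \<open>big_jump_lower\<close>.
\<close>

lemma block_lower_bound:
  "\<exists>N c. 4 \<le> N \<and> 0 < c \<and> (\<forall>(M :: 'w measure) S t a. driftless_subordinator M S \<nu> \<longrightarrow> 0 < t \<longrightarrow> T t \<le> a \<longrightarrow>
     c * (t * w a) \<le> measure M {\<omega>\<in>space M. a < S t \<omega> \<and> S t \<omega> \<le> N * a})"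
proof -
  obtain K C where K: "1 \<le> K" "0 < C" and up: "\<And>(M :: 'w measure) S t r. driftless_subordinator M S \<nu> \<Longrightarrow>
     0 < t \<Longrightarrow> K * T t \<le> r \<Longrightarrow> measure M {\<omega>\<in>space M. r \<le> S t \<omega>} \<le> C * (t * w r)"
    using tail_upper_bound by blast
  obtain c where c: "0 < c" and low: "\<And>(M :: 'w measure) S t s. driftless_subordinator M S \<nu> \<Longrightarrow>
     0 < t \<Longrightarrow> 0 < s \<Longrightarrow> measure M {\<omega>\<in>space M. S t \<omega> \<le> s} \<le> exp (- (c * (t * w s)))"
    using tail_lower_bound by blast
  define d where "d = c * exp (- 2 * c) / 2"
  have d: "0 < d" using c by (simp add: d_def)
  define N where "N = max (max 4 K) ((C / (b\<^sub>1 * d)) powr (1 / \<beta>\<^sub>1))"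
  have N: "4 \<le> N" "K \<le> N" by (auto simp: N_def)
  have "C / (b\<^sub>1 * d) = ((C / (b\<^sub>1 * d)) powr (1 / \<beta>\<^sub>1)) powr \<beta>\<^sub>1"
    using pos K d by (simp add: powr_powr)
  also have "\<dots> \<le> N powr \<beta>\<^sub>1" using pos by (intro powr_mono2) (auto simp: N_def)
  finally have NC: "C \<le> d * (b\<^sub>1 * N powr \<beta>\<^sub>1)" using pos d by (simp add: field_simps)
  show ?thesis
  proof (rule exI[of _ N], rule exI[of _ d], intro conjI allI impI N d)
    fix M :: "'w measure" and S and t a :: real
    assume sub: "driftless_subordinator M S \<nu>" and t: "0 < t" and Ta: "T t \<le> a"
    interpret poly_subordinator M S \<nu> b\<^sub>1 b\<^sub>2 \<beta>\<^sub>1 \<beta>\<^sub>2 by unfold_locales (rule sub)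
    have [measurable]: "S t \<in> borel_measurable M" using S_measurable t by simp
    have a: "0 < a" using T_pos[OF t] Ta by simp
    have Na: "a \<le> N * a" using N(1) a by (simp add: mult_le_cancel_right1)
    have "K * T t \<le> N * a" using N K Ta T_pos[OF t] by (intro mult_mono) auto
    hence "prob {\<omega>\<in>space M. N * a \<le> S t \<omega>} \<le> C * (t * w (N * a))" by (rule up[OF sub t])
    also have "\<dots> \<le> d * (b\<^sub>1 * N powr \<beta>\<^sub>1) * (t * w (N * a))"
      using NC t w_pos[of "N * a"] a N by (intro mult_right_mono) auto
    also have "\<dots> = d * t * (b\<^sub>1 * ((N * a) / a) powr \<beta>\<^sub>1 * w (N * a))" using a by simp
    also have "\<dots> \<le> d * t * w a" using a Na d t by (intro mult_left_mono w_lower) auto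
    finally have p1: "prob {\<omega>\<in>space M. N * a \<le> S t \<omega>} \<le> d * (t * w a)" by simp
    define y where "y = c * (t * w a)"
    have y: "0 \<le> y" "y \<le> 2 * c" using tw_le_2[OF t Ta] c t w_pos[OF a] by (auto simp: y_def)
    have "2 * d * (t * w a) = exp (- 2 * c) * y" by (simp add: d_def y_def)
    also have "\<dots> \<le> exp (- y) * y" using y by (intro mult_right_mono) auto
    also have "y \<le> exp y - 1" using exp_ge_add_one_self[of y] by linarith
    hence "exp (- y) * y \<le> exp (- y) * (exp y - 1)" by (intro mult_left_mono) auto
    also have "\<dots> = 1 - exp (- y)" by (simp add: algebra_simps flip: exp_add)
    also have "\<dots> \<le> 1 - prob {\<omega>\<in>space M. S t \<omega> \<le> a}" using low[OF sub t a] by (simp add: y_def)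
    also have "\<dots> = prob {\<omega>\<in>space M. a < S t \<omega>}"
      using prob_neg[of "\<lambda>\<omega>. S t \<omega> \<le> a"] by (simp add: not_le)
    also have "\<dots> \<le> prob ({\<omega>\<in>space M. a < S t \<omega> \<and> S t \<omega> \<le> N * a} \<union> {\<omega>\<in>space M. N * a \<le> S t \<omega>})"
      by (intro finite_measure_mono) auto
    also have "\<dots> \<le> prob {\<omega>\<in>space M. a < S t \<omega> \<and> S t \<omega> \<le> N * a} + prob {\<omega>\<in>space M. N * a \<le> S t \<omega>}"
      by (intro measure_subadditive) (auto simp: emeasure_eq_measure)
    finally show "d * (t * w a) \<le> prob {\<omega>\<in>space M. a < S t \<omega> \<and> S t \<omega> \<le> N * a}"
      using p1 by simp
  qed
qed

end

section \<open>Moments by dyadic decomposition\<close>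

lemma nn_integral_dyadic_le:
  fixes f c :: "_ \<Rightarrow> real"
  assumes [simp, measurable_cong]: "sets \<mu> = sets borel" and d: "0 \<le> d"
    and [measurable]: "\<And>j::nat. B j \<in> sets borel"
    and cover: "\<And>s. s \<in> A \<Longrightarrow> \<exists>j. s \<in> B j \<and> f s \<le> c j"
    and bound: "\<And>j. ennreal (c j) * emeasure \<mu> (B j) \<le> ennreal (d * (1 / 2) ^ j)"
  shows "(\<integral>\<^sup>+s. ennreal (f s) * indicator A s \<partial>\<mu>) \<le> ennreal (2 * d)"
proof -
  have "(\<integral>\<^sup>+s. ennreal (f s) * indicator A s \<partial>\<mu>) \<le> (\<integral>\<^sup>+s. (\<Sum>j. ennreal (c j) * indicator (B j) s) \<partial>\<mu>)"
  proof (rule nn_integral_mono)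
    fix s
    show "ennreal (f s) * indicator A s \<le> (\<Sum>j. ennreal (c j) * indicator (B j) s)"
    proof (cases "s \<in> A")
      case True
      then obtain j where j: "s \<in> B j" "f s \<le> c j" using cover by blast
      have "ennreal (f s) \<le> ennreal (c j)" using j by (intro ennreal_leI)
      also have "\<dots> = (\<Sum>i\<in>{j}. ennreal (c i) * indicator (B i) s)" using j by simp
      also have "\<dots> \<le> (\<Sum>j. ennreal (c j) * indicator (B j) s)" by (rule sum_le_suminf) auto
      finally show ?thesis using True by simp
    qed simp
  qed
  also have "\<dots> = (\<Sum>j. (\<integral>\<^sup>+s. ennreal (c j) * indicator (B j) s \<partial>\<mu>))"
    by (rule nn_integral_suminf) simp
  also have "\<dots> = (\<Sum>j. ennreal (c j) * emeasure \<mu> (B j))"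
    by (intro suminf_cong nn_integral_cmult_indicator) simp
  also have "\<dots> \<le> (\<Sum>j. ennreal (d * (1 / 2) ^ j))" by (intro suminf_le bound) auto
  also have "\<dots> = ennreal (2 * d)"
  proof (rule suminf_ennreal_eq)
    have "(\<lambda>j. d * (1 / 2) ^ j) sums (d * (1 / (1 - 1 / 2)))"
      by (intro sums_mult geometric_sums) simp
    thus "(\<lambda>j. d * (1 / 2) ^ j) sums (2 * d)" by (simp add: mult.commute)
  qed (use d in auto)
  finally show ?thesis .
qed

lemma ex_dyadic: fixes s u :: real assumes "0 < s" "s \<le> u"
  shows "\<exists>j::nat. u / 2 ^ Suc j < s \<and> s \<le> u / 2 ^ j"
proof -
  obtain n :: nat where n: "u / s < 2 ^ n" using real_arch_pow[of 2 "u / s"] by auto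
  hence ex: "\<exists>n. u / 2 ^ n < s" using assms by (intro exI[of _ n]) (simp add: field_simps)
  define k where "k = (LEAST n. u / 2 ^ n < s)"
  have k: "u / 2 ^ k < s" unfolding k_def using ex by (rule LeastI_ex)
  have "k \<noteq> 0" using k assms by (intro notI) simp
  then obtain j where j: "k = Suc j" by (cases k) auto
  have "\<not> u / 2 ^ j < s" using not_less_Least[of j "\<lambda>n. u / 2 ^ n < s"] j by (simp add: k_def)
  thus ?thesis using k j by auto
qed

text \<open>
  The hypothesis is the conclusion of \<open>prob_below_T\<close>: its decay in \<open>e = 2\<^sup>-\<^sup>j\<close> outweighs the growth
  of the integrand on the \<open>j\<close>-th dyadic block.
\<close>

lemma negative_moment:
  fixes \<kappa> b \<beta> :: real assumes "0 \<le> \<kappa>" "0 < b" "0 < \<beta>"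
  shows "\<exists>C>0. \<forall>\<mu> u. sets \<mu> = sets borel \<longrightarrow> 0 < u \<longrightarrow>
     (\<forall>e. 0 < e \<and> e \<le> 1 \<longrightarrow> emeasure \<mu> {..e * u} \<le> ennreal (exp (1 - b * (1 / e) powr \<beta>))) \<longrightarrow>
     (\<integral>\<^sup>+s. ennreal ((u / s) powr \<kappa>) * indicator {0<..u} s \<partial>\<mu>) \<le> ennreal C"
proof -
  define \<gamma> where "\<gamma> = (\<kappa> + 1) / \<beta>"
  define d where "d = exp 1 * 2 powr \<kappa> * (\<gamma> / b) powr \<gamma>"
  have \<gamma>: "0 < \<gamma>" using assms by (simp add: \<gamma>_def)
  have d: "0 < d" using \<gamma> assms by (simp add: d_def)
  show ?thesis
  proof (rule exI[of _ "2 * d"], intro conjI allI impI)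
    fix \<mu> :: "real measure" and u :: real
    assume sets: "sets \<mu> = sets borel" and u: "0 < u"
      and *: "\<forall>e. 0 < e \<and> e \<le> 1 \<longrightarrow> emeasure \<mu> {..e * u} \<le> ennreal (exp (1 - b * (1 / e) powr \<beta>))"
    show "(\<integral>\<^sup>+s. ennreal ((u / s) powr \<kappa>) * indicator {0<..u} s \<partial>\<mu>) \<le> ennreal (2 * d)"
    proof (rule nn_integral_dyadic_le[OF sets, where B = "\<lambda>j. {..u / 2 ^ j}" and c = "\<lambda>j. (2 ^ Suc j) powr \<kappa>"])
      fix s assume "s \<in> {0<..u}"
      then obtain j where j: "0 < s" "u / 2 ^ Suc j < s" "s \<le> u / 2 ^ j" using ex_dyadic[of s u] by auto
      have "u / s \<le> 2 ^ Suc j" using j by (simp add: field_simps)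
      thus "\<exists>j. s \<in> {..u / 2 ^ j} \<and> (u / s) powr \<kappa> \<le> (2 ^ Suc j) powr \<kappa>"
        using j u assms by (intro exI[of _ j] conjI powr_mono2) auto
    next
      fix j :: nat
      define z :: real where "z = 2 ^ j"
      have z: "1 \<le> z" by (simp add: z_def)
      have "emeasure \<mu> {..u / 2 ^ j} \<le> ennreal (exp (1 - b * z powr \<beta>))"
        using *[rule_format, of "1 / z"] z by (simp add: z_def)
      hence "ennreal (2 powr \<kappa> * z powr \<kappa>) * emeasure \<mu> {..u / 2 ^ j}
        \<le> ennreal (2 powr \<kappa> * z powr \<kappa>) * ennreal (exp (1 - b * z powr \<beta>))" by (intro mult_left_mono) auto
      also have "\<dots> = ennreal (2 powr \<kappa> * z powr \<kappa> * exp (1 - b * z powr \<beta>))" by (simp add: ennreal_mult')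
      also have "2 powr \<kappa> * z powr \<kappa> * exp (1 - b * z powr \<beta>) \<le> d * (1 / 2) ^ j"
      proof -
        have "z powr (\<kappa> + 1) = (z powr \<beta>) powr \<gamma>" using assms by (simp add: powr_powr \<gamma>_def)
        also have "\<dots> \<le> (\<gamma> / b) powr \<gamma> * exp (b * z powr \<beta>)" using z \<gamma> assms by (intro powr_le_exp) auto
        finally have "z powr \<kappa> * z \<le> (\<gamma> / b) powr \<gamma> * exp (b * z powr \<beta>)" using z by (simp add: powr_add)
        hence "z powr \<kappa> * exp (- (b * z powr \<beta>)) \<le> (\<gamma> / b) powr \<gamma> / z"
          using z by (simp add: exp_minus field_simps)
        hence "2 powr \<kappa> * exp 1 * (z powr \<kappa> * exp (- (b * z powr \<beta>))) \<le> 2 powr \<kappa> * exp 1 * ((\<gamma> / b) powr \<gamma> / z)"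
          by (intro mult_left_mono) auto
        also have "\<dots> = d * (1 / z)" by (simp add: d_def)
        also have "1 / z = (1 / 2) ^ j" by (simp add: z_def power_one_over)
        also have "2 powr \<kappa> * exp 1 * (z powr \<kappa> * exp (- (b * z powr \<beta>)))
            = 2 powr \<kappa> * z powr \<kappa> * exp (1 - b * z powr \<beta>)" by (simp add: exp_diff exp_minus divide_inverse)
        finally show ?thesis .
      qed
      finally show "ennreal ((2 ^ Suc j) powr \<kappa>) * emeasure \<mu> {..u / 2 ^ j} \<le> ennreal (d * (1 / 2) ^ j)"
        by (simp add: ennreal_leI z_def powr_mult)
    qed (use d in auto)
  qed (use d in auto)
qed

text \<open>
  On the dyadic block below \<open>F / 2\<^sup>j\<close> the mass is at most \<open>C w(F)\<close> times \<open>2\<close> to the power \<open>(j + 1) \<beta>\<^sub>2\<close>,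
  and \<open>L \<ge> \<beta>\<^sub>2 + 1\<close> makes the integrand small enough to sum over the blocks.
\<close>

lemma (in poly_levy) truncated_moment:
  assumes L: "\<beta>\<^sub>2 + 1 \<le> L" and [simp]: "sets \<mu> = sets borel" and F: "0 < F" and s0: "0 < s0" and C: "0 \<le> C"
    and tail: "\<And>s. s0 \<le> s \<Longrightarrow> emeasure \<mu> {s..} \<le> ennreal (C * w s)"
  shows "(\<integral>\<^sup>+s. ennreal ((s / F) powr L) * indicator {s0<..F} s \<partial>\<mu>) \<le> ennreal (2 * (C * b\<^sub>2 * 2 powr \<beta>\<^sub>2 * w F))"
proof (rule nn_integral_dyadic_le[where B = "\<lambda>j. {max s0 (F / 2 ^ Suc j)..}" and c = "\<lambda>j. (1 / 2 ^ j) powr L"])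
  have L0: "0 \<le> L" using L pos by linarith
  show "0 \<le> C * b\<^sub>2 * 2 powr \<beta>\<^sub>2 * w F" using C pos w_pos[OF F] by simp
  fix s assume "s \<in> {s0<..F}"
  then obtain j where j: "s0 < s" "0 < s" "F / 2 ^ Suc j < s" "s \<le> F / 2 ^ j" using ex_dyadic[of s F] s0 by auto
  have "s / F \<le> 1 / 2 ^ j" using j F by (simp add: field_simps)
  thus "\<exists>j. s \<in> {max s0 (F / 2 ^ Suc j)..} \<and> (s / F) powr L \<le> (1 / 2 ^ j) powr L"
    using j F L0 by (intro exI[of _ j] conjI powr_mono2) auto
next
  fix j :: nat
  define z :: real where "z = 2 ^ j"
  have z: "1 \<le> z" by (simp add: z_def)
  have F2: "0 < F / 2 ^ Suc j" "F / 2 ^ Suc j \<le> F" using F by (auto simp: divide_le_eq mult_le_cancel_left1 one_le_power[of "2::real" "Suc j", simplified] simp del: power_Suc)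
  have "emeasure \<mu> {max s0 (F / 2 ^ Suc j)..} \<le> ennreal (C * w (max s0 (F / 2 ^ Suc j)))" by (rule tail) simp
  also have "\<dots> \<le> ennreal (C * (b\<^sub>2 * (2 * z) powr \<beta>\<^sub>2 * w F))"
  proof (intro ennreal_leI mult_left_mono C)
    have "w (max s0 (F / 2 ^ Suc j)) \<le> w (F / 2 ^ Suc j)" using F2 by (intro w_antimono) auto
    also have "\<dots> \<le> b\<^sub>2 * (F / (F / 2 ^ Suc j)) powr \<beta>\<^sub>2 * w F" using F2 by (intro w_upper)
    also have "F / (F / 2 ^ Suc j) = 2 * z" using F by (simp add: z_def)
    finally show "w (max s0 (F / 2 ^ Suc j)) \<le> b\<^sub>2 * (2 * z) powr \<beta>\<^sub>2 * w F" .
  qed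
  finally have "ennreal ((1 / 2 ^ j) powr L) * emeasure \<mu> {max s0 (F / 2 ^ Suc j)..}
     \<le> ennreal ((1 / 2 ^ j) powr L) * ennreal (C * (b\<^sub>2 * (2 * z) powr \<beta>\<^sub>2 * w F))" by (intro mult_left_mono) auto
  also have "\<dots> = ennreal ((1 / z) powr L * (C * (b\<^sub>2 * (2 * z) powr \<beta>\<^sub>2 * w F)))" by (simp add: ennreal_mult' z_def)
  also have "\<dots> \<le> ennreal (C * b\<^sub>2 * 2 powr \<beta>\<^sub>2 * w F * (1 / 2) ^ j)"
  proof (rule ennreal_leI)
    have "(1 / z) powr L * z powr \<beta>\<^sub>2 = z powr (\<beta>\<^sub>2 - L)"
      using z by (simp add: powr_divide powr_diff)
    also have "\<dots> \<le> z powr (- 1)" using z L by (intro powr_mono) auto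
    also have "\<dots> = (1 / 2) ^ j" using z by (simp add: powr_minus z_def power_one_over inverse_eq_divide)
    finally have "(C * b\<^sub>2 * 2 powr \<beta>\<^sub>2 * w F) * ((1 / z) powr L * z powr \<beta>\<^sub>2) \<le> (C * b\<^sub>2 * 2 powr \<beta>\<^sub>2 * w F) * (1 / 2) ^ j"
      using C pos w_pos[OF F] by (intro mult_left_mono) auto
    thus "(1 / z) powr L * (C * (b\<^sub>2 * (2 * z) powr \<beta>\<^sub>2 * w F)) \<le> C * b\<^sub>2 * 2 powr \<beta>\<^sub>2 * w F * (1 / 2) ^ j"
      by (simp add: powr_mult mult_ac)
  qed
  finally show "ennreal ((1 / 2 ^ j) powr L) * emeasure \<mu> {max s0 (F / 2 ^ Suc j)..}
     \<le> ennreal (C * b\<^sub>2 * 2 powr \<beta>\<^sub>2 * w F * (1 / 2) ^ j)" .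
qed auto

section \<open>The setting for the subordinate heat kernel\<close>

text \<open>
  The constants of all hypotheses are fixed, and the bounds for \<open>p\<close> are stated in terms of real
  numbers.  The assumptions on \<open>law x t\<close>, which stands for the law of \<open>S t\<close> under the measure that
  belongs to \<open>x\<close>, are the estimates proved above.
\<close>

locale subordinate_kernel =
  scale: scale_function \<Phi> \<alpha>\<^sub>1 \<alpha>\<^sub>2 a\<^sub>1 a\<^sub>2 + poly_levy \<nu> b\<^sub>1 b\<^sub>2 \<beta>\<^sub>1 \<beta>\<^sub>2
  for \<Phi> \<alpha>\<^sub>1 \<alpha>\<^sub>2 a\<^sub>1 a\<^sub>2 \<nu> b\<^sub>1 b\<^sub>2 \<beta>\<^sub>1 \<beta>\<^sub>2 +
  fixes \<Psi> :: "real \<Rightarrow> real" and D :: "'e::metric_space set" and V :: "'e \<Rightarrow> real \<Rightarrow> real"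
    and h :: "real \<Rightarrow> 'e \<Rightarrow> 'e \<Rightarrow> real" and p :: "real \<Rightarrow> 'e \<Rightarrow> 'e \<Rightarrow> ennreal"
    and law :: "'e \<Rightarrow> real \<Rightarrow> real measure"
    and C\<^sub>0 C\<^sub>V d C\<^sub>h \<gamma> k\<^sub>1 k\<^sub>2 k\<^sub>3 k\<^sub>4 e c\<^sub>e K C\<^sub>K N c\<^sub>N :: real
  assumes \<Psi>: "\<And>r. 0 \<le> r \<Longrightarrow> \<Phi> r \<le> \<Psi> r" and C0: "0 \<le> C\<^sub>0"
    and V_pos: "\<And>x r. 0 < r \<Longrightarrow> 0 < V x r"
    and V_mono: "\<And>x r R. r \<le> R \<Longrightarrow> V x r \<le> V x R"
    and V_growth: "1 \<le> C\<^sub>V" "0 < d" "\<And>x r R. 0 < r \<Longrightarrow> r \<le> R \<Longrightarrow> V x R \<le> C\<^sub>V * (R / r) powr d * V x r"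
    and h_bounds: "\<And>s x y. 0 < s \<Longrightarrow> x \<in> D \<Longrightarrow> y \<in> D \<Longrightarrow> 0 \<le> h s x y \<and> h s x y \<le> 1"
    and h_antimono: "\<And>s u x y. 0 < s \<Longrightarrow> s \<le> u \<Longrightarrow> x \<in> D \<Longrightarrow> y \<in> D \<Longrightarrow> h u x y \<le> h s x y"
    and h_scaling: "0 < C\<^sub>h" "0 \<le> \<gamma>" "\<And>s u x y. 0 < s \<Longrightarrow> s \<le> u \<Longrightarrow> below_diam D \<Phi> u \<Longrightarrow>
      x \<in> D \<Longrightarrow> y \<in> D \<Longrightarrow> s powr \<gamma> * h s x y \<le> C\<^sub>h * u powr \<gamma> * h u x y"
    and k_pos: "0 < k\<^sub>1" "0 < k\<^sub>2" "0 < k\<^sub>3" "0 < k\<^sub>4"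
    and p_upper: "\<And>s x y. 0 < s \<Longrightarrow> x \<in> D \<Longrightarrow> y \<in> D \<Longrightarrow> p s x y \<le> ennreal (k\<^sub>3 * h s x y / V x (ginv \<Phi> s))"
    and p_upper_off: "\<And>s x y. 0 < s \<Longrightarrow> x \<in> D \<Longrightarrow> y \<in> D \<Longrightarrow> 0 < dist x y \<Longrightarrow>
      p s x y \<le> ennreal (k\<^sub>3 * h s x y * (C\<^sub>0 * s / (V x (dist x y) * \<Psi> (dist x y))
        + exp (- k\<^sub>4 * (dist x y)\<^sup>2 / (ginv \<Phi> s)\<^sup>2) / V x (ginv \<Phi> s)))"
    and p_lower: "\<And>s x y. 0 < s \<Longrightarrow> x \<in> D \<Longrightarrow> y \<in> D \<Longrightarrow>
      ennreal (k\<^sub>1 * h s x y * (exp (- k\<^sub>2 * (dist x y)\<^sup>2 / (ginv \<Phi> s)\<^sup>2) / V x (ginv \<Phi> s))) \<le> p s x y"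
    and p_lower_jump: "\<And>s x y. 0 < s \<Longrightarrow> x \<in> D \<Longrightarrow> y \<in> D \<Longrightarrow> 0 < dist x y \<Longrightarrow> s \<le> \<Phi> (dist x y) \<Longrightarrow>
      ennreal (k\<^sub>1 * h s x y * (C\<^sub>0 * s / (V x (dist x y) * \<Psi> (dist x y)))) \<le> p s x y"
    and law_prob: "\<And>x t. x \<in> D \<Longrightarrow> 0 < t \<Longrightarrow> prob_space (law x t)"
    and law_sets: "\<And>x t. x \<in> D \<Longrightarrow> 0 < t \<Longrightarrow> sets (law x t) = sets borel"
    and law_between: "0 < e" "e \<le> 1" "0 < c\<^sub>e" "\<And>x t. x \<in> D \<Longrightarrow> 0 < t \<Longrightarrow>
      c\<^sub>e \<le> measure (law x t) {e * T t<..T t}"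
    and law_below: "\<And>x t \<epsilon>. x \<in> D \<Longrightarrow> 0 < t \<Longrightarrow> 0 < \<epsilon> \<Longrightarrow> \<epsilon> \<le> 1 \<Longrightarrow>
      measure (law x t) {..\<epsilon> * T t} \<le> exp (1 - b\<^sub>1 * (1 / \<epsilon>) powr \<beta>\<^sub>1)"
    and law_tail: "2 \<le> K" "0 < C\<^sub>K" "\<And>x t r. x \<in> D \<Longrightarrow> 0 < t \<Longrightarrow> K * T t \<le> r \<Longrightarrow>
      measure (law x t) {r..} \<le> C\<^sub>K * (t * w r)"
    and law_block: "4 \<le> N" "0 < c\<^sub>N" "\<And>x t a. x \<in> D \<Longrightarrow> 0 < t \<Longrightarrow> T t \<le> a \<Longrightarrow>
      c\<^sub>N * (t * w a) \<le> measure (law x t) {a<..N * a}"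
begin

abbreviation "\<R> \<equiv> ginv \<Phi>"

abbreviation jump :: "'e \<Rightarrow> real \<Rightarrow> real" where
  "jump x r \<equiv> C\<^sub>0 / (V x r * \<Psi> r)"

abbreviation gauss :: "real \<Rightarrow> real \<Rightarrow> real \<Rightarrow> real" where
  "gauss c r s \<equiv> exp (- c * r\<^sup>2 / (\<R> s)\<^sup>2)"

definition q :: "real \<Rightarrow> 'e \<Rightarrow> 'e \<Rightarrow> ennreal" where
  "q t x y = (\<integral>\<^sup>+s\<in>{0<..}. p s x y \<partial>law x t)"

text \<open>
  \<open>h\<close> is given at positive times only.  The value \<open>1\<close> elsewhere keeps the extension monotone in time,
  which makes it Borel measurable.
\<close>

definition H :: "'e \<Rightarrow> 'e \<Rightarrow> real \<Rightarrow> real" where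
  "H x y s = (if 0 < s then h s x y else 1)"

lemma H_measurable: assumes "x \<in> D" "y \<in> D" shows "H x y \<in> borel_measurable borel"
proof -
  have "mono (\<lambda>s. - H x y s)"
    using h_bounds[of _ x y] h_antimono[of _ _ x y] assms by (auto intro!: monoI simp: H_def)
  from borel_measurable_mono[OF this] show ?thesis by (simp add: borel_measurable_uminus_eq)
qed

lemma emeasure_law: assumes "x \<in> D" "0 < t" shows "emeasure (law x t) A = ennreal (measure (law x t) A)"
proof -
  interpret prob_space "law x t" by (rule law_prob[OF assms])
  show ?thesis by (rule emeasure_eq_measure)
qed

lemma h_small: assumes "0 < s" "s \<le> u" "below_diam D \<Phi> u" "x \<in> D" "y \<in> D"
  shows "h s x y \<le> C\<^sub>h * (u / s) powr \<gamma> * h u x y"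
proof -
  have "s powr \<gamma> * h s x y \<le> C\<^sub>h * u powr \<gamma> * h u x y" using assms by (rule h_scaling(3))
  thus ?thesis using assms by (simp add: powr_divide field_simps)
qed

lemma below_diam_\<Phi>: assumes "x \<in> D" "y \<in> D" "s \<le> 4 * \<Phi> (dist x y)" shows "below_diam D \<Phi> s"
  unfolding below_diam_def
proof
  assume "bounded D"
  hence "dist x y \<le> diameter D" using assms by (intro diameter_bounded_bound)
  hence "\<Phi> (dist x y) \<le> \<Phi> (diameter D)" by (intro scale.mono) auto
  thus "s < 4 * \<Phi> (diameter D) + 1" using assms by simp
qed

lemma q_ge_const:
  assumes "x \<in> D" "0 < t" "A \<in> sets borel" "A \<subseteq> {0<..}" "0 \<le> g" "\<And>s. s \<in> A \<Longrightarrow> ennreal g \<le> p s x y"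
  shows "ennreal (g * measure (law x t) A) \<le> q t x y"
proof -
  have "ennreal (g * measure (law x t) A) = ennreal g * emeasure (law x t) A"
    using assms by (simp add: emeasure_law ennreal_mult)
  also have "\<dots> = (\<integral>\<^sup>+s. ennreal g * indicator A s \<partial>law x t)"
    using assms law_sets by (intro nn_integral_cmult_indicator[symmetric]) auto
  also have "\<dots> \<le> q t x y" unfolding q_def
    using assms by (intro nn_integral_mono) (auto split: split_indicator)
  finally show ?thesis .
qed

lemma \<R>_scaling: obtains C where "1 \<le> C" "\<And>s u. 0 < s \<Longrightarrow> s \<le> u \<Longrightarrow> \<R> u \<le> C * (u / s) powr (1 / \<alpha>\<^sub>1) * \<R> s"
  using scale.ginv_scaling by blast

lemma V_\<R>_scaling: "\<exists>C\<ge>1. \<forall>x s u. 0 < s \<and> s \<le> u \<longrightarrow> 1 / V x (\<R> s) \<le> C * (u / s) powr (d / \<alpha>\<^sub>1) / V x (\<R> u)"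
proof -
  obtain C where C: "1 \<le> C" "\<And>s u. 0 < s \<Longrightarrow> s \<le> u \<Longrightarrow> \<R> u \<le> C * (u / s) powr (1 / \<alpha>\<^sub>1) * \<R> s"
    using \<R>_scaling by blast
  show ?thesis
  proof (intro exI[of _ "C\<^sub>V * C powr d"] conjI allI impI)
    show "1 \<le> C\<^sub>V * C powr d" using C V_growth mult_mono[of 1 C\<^sub>V 1 "C powr d"] by (simp add: ge_one_powr_ge_zero)
    fix x s u assume su: "0 < s \<and> s \<le> (u :: real)"
    hence R: "0 < \<R> s" "\<R> s \<le> \<R> u" "0 < \<R> u" using scale.ginv_pos[of s] scale.ginv_pos[of u] scale.ginv_mono by auto
    have "V x (\<R> u) \<le> C\<^sub>V * (\<R> u / \<R> s) powr d * V x (\<R> s)" using R by (intro V_growth)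
    also have "(\<R> u / \<R> s) powr d \<le> (C * (u / s) powr (1 / \<alpha>\<^sub>1)) powr d"
      using C(2)[of s u] su R V_growth by (intro powr_mono2) (auto simp: pos_divide_le_eq)
    also have "\<dots> = C powr d * (u / s) powr (d / \<alpha>\<^sub>1)" by (simp add: powr_mult powr_powr)
    finally have "V x (\<R> u) \<le> C\<^sub>V * (C powr d * (u / s) powr (d / \<alpha>\<^sub>1)) * V x (\<R> s)"
      using V_growth V_pos[OF R(1), of x] by (simp add: mult_left_mono mult_right_mono)
    thus "1 / V x (\<R> s) \<le> C\<^sub>V * C powr d * (u / s) powr (d / \<alpha>\<^sub>1) / V x (\<R> u)"
      using V_pos[OF R(1), of x] V_pos[OF R(3), of x] by (simp add: field_simps)
  qed
qed

end

section \<open>Lower bounds for the subordinate heat kernel\<close>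

context subordinate_kernel
begin

text \<open>
  The probability that \<open>S t\<close> lies between \<open>e T\<close> and \<open>T\<close> is bounded below.  There the Gaussian part of
  \<open>p\<close> is at least its value at \<open>T\<close> with a larger constant in the exponent, and \<open>h\<close> is at least
  \<open>h (T t) x y\<close> by monotonicity.
\<close>

lemma gaussian_lower:
  "\<exists>c>0. \<exists>c'>0. \<forall>t>0. \<forall>x\<in>D. \<forall>y\<in>D.
    ennreal (c * (h (T t) x y / V x (\<R> (T t)) * gauss c' (dist x y) (T t))) \<le> q t x y"
proof -
  obtain C where C: "1 \<le> C" "\<And>s u. 0 < s \<Longrightarrow> s \<le> u \<Longrightarrow> \<R> u \<le> C * (u / s) powr (1 / \<alpha>\<^sub>1) * \<R> s"
    using \<R>_scaling by blast
  define B where "B = C * (1 / e) powr (1 / \<alpha>\<^sub>1)"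
  have B: "0 < B" using C law_between by (simp add: B_def)
  have p1: "0 < k\<^sub>1 * c\<^sub>e" and p2: "0 < k\<^sub>2 * B\<^sup>2" using k_pos law_between B by auto
  show ?thesis
  proof (rule exI[of _ "k\<^sub>1 * c\<^sub>e"], rule conjI[OF p1], rule exI[of _ "k\<^sub>2 * B\<^sup>2"],
      rule conjI[OF p2], intro allI ballI impI)
    fix t x y assume t: "0 < (t::real)" and xy: "x \<in> D" "y \<in> D"
    let ?r = "dist x y"
    have T0: "0 < T t" using T_pos t .
    hence RT: "0 < \<R> (T t)" by (rule scale.ginv_pos)
    define g where "g = k\<^sub>1 * h (T t) x y * (gauss (k\<^sub>2 * B\<^sup>2) ?r (T t) / V x (\<R> (T t)))"
    have hT: "0 \<le> h (T t) x y" using h_bounds[OF T0 xy] by simp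
    have g0: "0 \<le> g" unfolding g_def using k_pos hT V_pos[OF RT, of x] by simp
    have "ennreal (g * measure (law x t) {e * T t<..T t}) \<le> q t x y"
    proof (rule q_ge_const[OF xy(1) t _ _ g0])
      have eT: "0 < e * T t" using T0 law_between by simp
      thus "{e * T t<..T t} \<subseteq> {0<..}" by auto
      fix s assume "s \<in> {e * T t<..T t}"
      hence s: "0 < s" "e * T t < s" "s \<le> T t" using eT by auto
      have R: "0 < \<R> s" "\<R> s \<le> \<R> (T t)" using scale.ginv_pos scale.ginv_mono s by auto
      have "T t / s \<le> 1 / e" using s law_between by (simp add: field_simps)
      hence "(T t / s) powr (1 / \<alpha>\<^sub>1) \<le> (1 / e) powr (1 / \<alpha>\<^sub>1)"
        using T0 s scale.pos by (intro powr_mono2) auto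
      hence "C * (T t / s) powr (1 / \<alpha>\<^sub>1) * \<R> s \<le> B * \<R> s"
        unfolding B_def using C R by (intro mult_right_mono mult_left_mono) auto
      hence "\<R> (T t) \<le> B * \<R> s" using C(2)[of s "T t"] s by simp
      hence "(\<R> (T t))\<^sup>2 \<le> (B * \<R> s)\<^sup>2" using RT by (intro power_mono) auto
      hence "1 / (\<R> s)\<^sup>2 \<le> B\<^sup>2 / (\<R> (T t))\<^sup>2" using R RT by (simp add: field_simps power_mult_distrib)
      hence "(k\<^sub>2 * ?r\<^sup>2) * (1 / (\<R> s)\<^sup>2) \<le> (k\<^sub>2 * ?r\<^sup>2) * (B\<^sup>2 / (\<R> (T t))\<^sup>2)"
        using k_pos by (intro mult_left_mono) auto
      hence ex: "gauss (k\<^sub>2 * B\<^sup>2) ?r (T t) \<le> gauss k\<^sub>2 ?r s"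
        by (simp add: mult_ac)
      have "g \<le> k\<^sub>1 * h s x y * (gauss k\<^sub>2 ?r s / V x (\<R> s))"
        unfolding g_def using k_pos hT ex h_antimono[OF s(1,3) xy] V_mono[OF R(2), of x] V_pos[OF R(1), of x] V_pos[OF RT, of x]
        by (intro mult_mono frac_le mult_left_mono) auto
      thus "ennreal g \<le> p s x y" using p_lower[OF s(1) xy] by (auto intro: order_trans ennreal_leI)
    qed simp
    moreover have "g * c\<^sub>e \<le> g * measure (law x t) {e * T t<..T t}"
      using law_between(4)[OF xy(1) t] g0 by (intro mult_left_mono)
    ultimately have "ennreal (g * c\<^sub>e) \<le> q t x y" by (auto intro: order_trans ennreal_leI)
    thus "ennreal (k\<^sub>1 * c\<^sub>e * (h (T t) x y / V x (\<R> (T t)) * gauss (k\<^sub>2 * B\<^sup>2) ?r (T t))) \<le> q t x y"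
      by (simp add: g_def mult_ac)
  qed
qed

lemma V\<Psi>_pos: "0 < r \<Longrightarrow> 0 < V x r * \<Psi> r"
  using V_pos[of r x] \<Psi>[of r] scale.\<Phi>_pos[of r] by simp

text \<open>
  The same event, with the jump part of \<open>p\<close> in place of the Gaussian part.
\<close>

lemma jump_lower_T:
  "\<exists>c>0. \<forall>t>0. \<forall>x\<in>D. \<forall>y\<in>D. 0 < dist x y \<and> T t \<le> \<Phi> (dist x y) \<longrightarrow>
    ennreal (c * (jump x (dist x y) * (T t * h (T t) x y))) \<le> q t x y"
proof (rule exI[of _ "k\<^sub>1 * e * c\<^sub>e"], intro conjI allI ballI impI, simp add: k_pos law_between)
  fix t x y assume t: "0 < (t::real)" and xy: "x \<in> D" "y \<in> D" and "0 < dist x y \<and> T t \<le> \<Phi> (dist x y)"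
  hence r: "0 < dist x y" "T t \<le> \<Phi> (dist x y)" by auto
  let ?r = "dist x y"
  have T0: "0 < T t" using T_pos t .
  have hT: "0 \<le> h (T t) x y" using h_bounds[OF T0 xy] by simp
  note vp = V\<Psi>_pos[OF r(1), of x]
  define g where "g = k\<^sub>1 * h (T t) x y * (C\<^sub>0 * (e * T t) / (V x ?r * \<Psi> ?r))"
  have g0: "0 \<le> g" unfolding g_def using k_pos hT vp C0 T0 law_between by simp
  have "ennreal (g * measure (law x t) {e * T t<..T t}) \<le> q t x y"
  proof (rule q_ge_const[OF xy(1) t _ _ g0])
    have eT: "0 < e * T t" using T0 law_between by simp
    thus "{e * T t<..T t} \<subseteq> {0<..}" by auto
    fix s assume "s \<in> {e * T t<..T t}"
    hence s: "0 < s" "e * T t < s" "s \<le> T t" using eT by auto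
    have "C\<^sub>0 * (e * T t) / (V x ?r * \<Psi> ?r) \<le> C\<^sub>0 * s / (V x ?r * \<Psi> ?r)"
      using C0 s vp by (intro divide_right_mono mult_left_mono) auto
    moreover have "0 \<le> C\<^sub>0 * (e * T t) / (V x ?r * \<Psi> ?r)"
      using C0 T0 law_between(1) vp by (intro divide_nonneg_pos mult_nonneg_nonneg) auto
    moreover have "k\<^sub>1 * h (T t) x y \<le> k\<^sub>1 * h s x y"
      using k_pos h_antimono[OF s(1,3) xy] by (intro mult_left_mono) auto
    moreover have "0 \<le> k\<^sub>1 * h s x y" using k_pos h_bounds[OF s(1) xy] by simp
    ultimately have "g \<le> k\<^sub>1 * h s x y * (C\<^sub>0 * s / (V x ?r * \<Psi> ?r))"
      unfolding g_def by - (rule mult_mono)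
    thus "ennreal g \<le> p s x y" using p_lower_jump[OF s(1) xy r(1)] s r by (auto intro: order_trans ennreal_leI)
  qed simp
  moreover have "g * c\<^sub>e \<le> g * measure (law x t) {e * T t<..T t}"
    using law_between(4)[OF xy(1) t] g0 by (intro mult_left_mono)
  ultimately have "ennreal (g * c\<^sub>e) \<le> q t x y" by (auto intro: order_trans ennreal_leI)
  thus "ennreal (k\<^sub>1 * e * c\<^sub>e * (jump x ?r * (T t * h (T t) x y))) \<le> q t x y"
    by (simp add: g_def mult_ac)
qed

text \<open>
  \<open>\<B>\<^sub>h(t, x, y)\<close> is the case \<open>a = 2 T t\<close>, \<open>b = 4 \<Phi> (dist x y)\<close>.
\<close>

definition J :: "'e \<Rightarrow> 'e \<Rightarrow> real \<Rightarrow> real \<Rightarrow> real" where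
  "J x y a b = (LBINT s:{a..b}. h s x y * w s)"

lemma J_nn:
  assumes a: "0 < a" and xy: "x \<in> D" "y \<in> D"
  shows "(\<integral>\<^sup>+s. ennreal (H x y s * w s) * indicator {a..b} s \<partial>lborel) = ennreal (J x y a b)"
    and "0 \<le> J x y a b"
proof -
  note [measurable] = H_measurable[OF xy]
  have eq: "indicator {a..b} s *\<^sub>R (h s x y * w s) = indicator {a..b} s * (H x y s * w s)" for s
    using a by (auto simp: H_def split: split_indicator)
  have b: "0 \<le> indicator {a..b} s * (H x y s * w s) \<and> indicator {a..b} s * (H x y s * w s) \<le> w a * indicator {a..b} s" for s
    using a h_bounds[of s x y] xy w_antimono[of a s] w_pos[of s] mult_mono[of "h s x y" 1 "w s" "w a"]
    by (auto simp: H_def split: split_indicator)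
  have int: "integrable lborel (\<lambda>s. indicator {a..b} s * (H x y s * w s))"
  proof (rule Bochner_Integration.integrable_bound)
    show "integrable lborel (\<lambda>s. w a * indicator {a..b} s)"
      by (intro integrable_mult_right integrable_real_indicator) (auto simp: emeasure_lborel_Icc_eq)
  qed (use b in \<open>auto intro!: AE_I2 order_trans[OF _ abs_ge_self]\<close>)
  have J: "J x y a b = (\<integral>s. indicator {a..b} s * (H x y s * w s) \<partial>lborel)"
    unfolding J_def set_lebesgue_integral_def eq ..
  show "0 \<le> J x y a b" unfolding J using b by (intro integral_nonneg_AE) auto
  have "(\<integral>\<^sup>+s. ennreal (H x y s * w s) * indicator {a..b} s \<partial>lborel)
     = (\<integral>\<^sup>+s. ennreal (indicator {a..b} s * (H x y s * w s)) \<partial>lborel)"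
    by (intro nn_integral_cong) (auto split: split_indicator)
  also have "\<dots> = ennreal (J x y a b)" unfolding J
    using b by (intro nn_integral_eq_integral int) auto
  finally show "(\<integral>\<^sup>+s. ennreal (H x y s * w s) * indicator {a..b} s \<partial>lborel) = ennreal (J x y a b)" .
qed

text \<open>
  For fixed \<open>s\<close>, the integral of \<open>h (N u)\<close> over the \<open>u\<close> with \<open>u < s \<le> N u\<close> is at most \<open>s h s\<close>, because
  \<open>h (N u) \<le> h s\<close> there.  Tonelli's theorem then turns the expectation into an integral of
  \<open>h (N u) P(u < S t \<le> N u)\<close>, where the block bound applies, and \<open>w(u) \<ge> w(N u)\<close>.
\<close>

lemma truncated_mean_lower:
  assumes t: "0 < t" and xy: "x \<in> D" "y \<in> D"
  shows "ennreal (c\<^sub>N / N * (t * J x y (N * T t) F))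
     \<le> (\<integral>\<^sup>+s. ennreal (s * H x y s) * indicator {T t<..F} s \<partial>law x t)"
proof -
  have T0: "0 < T t" using T_pos t .
  have N0: "0 < N" using law_block by simp
  note [measurable] = H_measurable[OF xy]
  note [measurable_cong] = law_sets[OF xy(1) t]
  interpret P: prob_space "law x t" by (rule law_prob[OF xy(1) t])
  interpret pair_sigma_finite lborel "law x t" by unfold_locales
  let ?I = "\<lambda>u. indicator {T t..F / N} u :: ennreal"
  let ?W = "\<lambda>u s. (if u < s \<and> s \<le> N * u then 1 else 0 :: ennreal)"
  have H0: "0 \<le> H x y s" for s using h_bounds[of s x y] xy by (auto simp: H_def)
  have "ennreal (c\<^sub>N / N * (t * J x y (N * T t) F)) = ennreal (c\<^sub>N * t / N) * ennreal (J x y (N * T t) F)"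
    using law_block t J_nn(2)[of "N * T t" x y F] T0 xy N0 by (subst ennreal_mult[symmetric]) (auto simp: mult_ac)
  also have "ennreal (J x y (N * T t) F) = (\<integral>\<^sup>+s. ennreal (H x y s * w s) * indicator {N * T t..F} s \<partial>lborel)"
    using T0 N0 xy by (intro J_nn(1)[symmetric]) auto
  also have "\<dots> = ennreal N * (\<integral>\<^sup>+u. ennreal (H x y (N * u) * w (N * u)) * ?I u \<partial>lborel)"
  proof -
    have "(\<integral>\<^sup>+s. ennreal (H x y s * w s) * indicator {N * T t..F} s \<partial>lborel)
      = ennreal \<bar>N\<bar> * (\<integral>\<^sup>+u. ennreal (H x y (0 + N * u) * w (0 + N * u)) * indicator {N * T t..F} (0 + N * u) \<partial>lborel)"
      using N0 by (intro nn_integral_real_affine) auto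
    also have "(\<integral>\<^sup>+u. ennreal (H x y (0 + N * u) * w (0 + N * u)) * indicator {N * T t..F} (0 + N * u) \<partial>lborel)
      = (\<integral>\<^sup>+u. ennreal (H x y (N * u) * w (N * u)) * ?I u \<partial>lborel)"
      using N0 by (intro nn_integral_cong) (auto simp: indicator_def field_simps)
    finally show ?thesis using N0 by simp
  qed
  also have "ennreal (c\<^sub>N * t / N) * (ennreal N * (\<integral>\<^sup>+u. ennreal (H x y (N * u) * w (N * u)) * ?I u \<partial>lborel))
     = (\<integral>\<^sup>+u. ennreal (c\<^sub>N * t) * (ennreal (H x y (N * u) * w (N * u)) * ?I u) \<partial>lborel)"
    using N0 law_block t by (subst nn_integral_cmult) (auto simp: mult.assoc[symmetric] ennreal_mult[symmetric])
  also have "\<dots> \<le> (\<integral>\<^sup>+u. (\<integral>\<^sup>+s. ennreal (H x y (N * u)) * ?I u * ?W u s \<partial>law x t) \<partial>lborel)"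
  proof (rule nn_integral_mono)
    fix u
    show "ennreal (c\<^sub>N * t) * (ennreal (H x y (N * u) * w (N * u)) * ?I u)
       \<le> (\<integral>\<^sup>+s. ennreal (H x y (N * u)) * ?I u * ?W u s \<partial>law x t)"
    proof (cases "u \<in> {T t..F / N}")
      case True
      hence u: "T t \<le> u" "0 < u" using T0 by auto
      have "u \<le> N * u" using u law_block(1) by (simp add: mult_le_cancel_right1)
      hence "w (N * u) \<le> w u" using u by (intro w_antimono) auto
      hence "c\<^sub>N * (t * w (N * u)) \<le> c\<^sub>N * (t * w u)" using law_block t by (intro mult_left_mono) auto
      also have "\<dots> \<le> measure (law x t) {u<..N * u}" using law_block(3)[OF xy(1) t u(1)] .
      finally have "H x y (N * u) * (c\<^sub>N * (t * w (N * u))) \<le> H x y (N * u) * measure (law x t) {u<..N * u}"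
        using H0 by (intro mult_left_mono)
      hence "ennreal (c\<^sub>N * t) * (ennreal (H x y (N * u) * w (N * u)) * ?I u)
        \<le> ennreal (H x y (N * u) * measure (law x t) {u<..N * u})"
        using True law_block t by (simp add: ennreal_mult'[symmetric] mult_ac ennreal_leI)
      also have "\<dots> = ennreal (H x y (N * u)) * emeasure (law x t) {u<..N * u}"
        using H0 by (simp add: P.emeasure_eq_measure ennreal_mult)
      also have "\<dots> = (\<integral>\<^sup>+s. ennreal (H x y (N * u)) * indicator {u<..N * u} s \<partial>law x t)"
        by (intro nn_integral_cmult_indicator[symmetric]) simp
      also have "\<dots> = (\<integral>\<^sup>+s. ennreal (H x y (N * u)) * ?I u * ?W u s \<partial>law x t)"
        using True by (intro nn_integral_cong) (auto split: split_indicator)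
      finally show ?thesis .
    qed simp
  qed
  also have "\<dots> = (\<integral>\<^sup>+s. (\<integral>\<^sup>+u. ennreal (H x y (N * u)) * ?I u * ?W u s \<partial>lborel) \<partial>law x t)"
    by (rule Fubini'[symmetric]) measurable
  also have "\<dots> \<le> (\<integral>\<^sup>+s. ennreal (s * H x y s) * indicator {T t<..F} s \<partial>law x t)"
  proof (rule nn_integral_mono)
    fix s
    have "(\<integral>\<^sup>+u. ennreal (H x y (N * u)) * ?I u * ?W u s \<partial>lborel)
       \<le> (\<integral>\<^sup>+u. (ennreal (H x y s) * indicator {T t<..F} s) * indicator {0..s} u \<partial>lborel)"
    proof (rule nn_integral_mono)
      fix u
      show "ennreal (H x y (N * u)) * ?I u * ?W u s \<le> (ennreal (H x y s) * indicator {T t<..F} s) * indicator {0..s} u"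
      proof (cases "u \<in> {T t..F / N} \<and> u < s \<and> s \<le> N * u")
        case True
        hence u: "T t \<le> u" "u < s" "s \<le> N * u" "u \<le> F / N" by auto
        have "N * u \<le> F" using u N0 by (simp add: field_simps)
        moreover have "H x y (N * u) \<le> H x y s" using u T0 h_antimono[of s "N * u" x y] xy by (auto simp: H_def)
        ultimately show ?thesis using True u T0 by (auto intro!: ennreal_leI)
      qed auto
    qed
    also have "\<dots> = (ennreal (H x y s) * indicator {T t<..F} s) * emeasure lborel {0..s}"
      by (rule nn_integral_cmult_indicator) simp
    also have "\<dots> = ennreal (s * H x y s) * indicator {T t<..F} s"
      using T0 H0 by (auto split: split_indicator simp: ennreal_mult mult.commute)
    finally show "(\<integral>\<^sup>+u. ennreal (H x y (N * u)) * ?I u * ?W u s \<partial>lborel)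
       \<le> ennreal (s * H x y s) * indicator {T t<..F} s" .
  qed
  finally show ?thesis .
qed

lemma jump_lower_integral:
  "\<exists>c>0. \<forall>t>0. \<forall>x\<in>D. \<forall>y\<in>D. 0 < dist x y \<and> T t \<le> \<Phi> (dist x y) \<longrightarrow>
    ennreal (c * (jump x (dist x y) * (t * J x y (N * T t) (\<Phi> (dist x y))))) \<le> q t x y"
proof (rule exI[of _ "k\<^sub>1 * c\<^sub>N / N"], intro conjI allI ballI impI)
  show "0 < k\<^sub>1 * c\<^sub>N / N" using k_pos law_block by simp
  fix t x y assume t: "0 < (t::real)" and xy: "x \<in> D" "y \<in> D" and "0 < dist x y \<and> T t \<le> \<Phi> (dist x y)"
  hence r: "0 < dist x y" "T t \<le> \<Phi> (dist x y)" by auto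
  let ?r = "dist x y"
  have T0: "0 < T t" using T_pos t .
  note [measurable] = H_measurable[OF xy]
  note [measurable_cong] = law_sets[OF xy(1) t]
  note vp = V\<Psi>_pos[OF r(1), of x]
  define A where "A = k\<^sub>1 * (jump x ?r)"
  have A: "0 \<le> A" using k_pos C0 vp by (simp add: A_def)
  have J0: "0 \<le> c\<^sub>N / N * (t * J x y (N * T t) (\<Phi> ?r))"
    using J_nn(2)[of "N * T t" x y] xy T0 law_block t by auto
  have "ennreal (A * (c\<^sub>N / N * (t * J x y (N * T t) (\<Phi> ?r))))
     = ennreal A * ennreal (c\<^sub>N / N * (t * J x y (N * T t) (\<Phi> ?r)))" by (rule ennreal_mult[OF A J0])
  also have "\<dots> \<le> ennreal A * (\<integral>\<^sup>+s. ennreal (s * H x y s) * indicator {T t<..\<Phi> ?r} s \<partial>law x t)"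
    by (intro mult_left_mono truncated_mean_lower t xy) auto
  also have "\<dots> = (\<integral>\<^sup>+s. ennreal A * (ennreal (s * H x y s) * indicator {T t<..\<Phi> ?r} s) \<partial>law x t)"
    by (rule nn_integral_cmult[symmetric]) measurable
  also have "\<dots> \<le> q t x y" unfolding q_def
  proof (rule nn_integral_mono)
    fix s
    show "ennreal A * (ennreal (s * H x y s) * indicator {T t<..\<Phi> ?r} s) \<le> p s x y * indicator {0<..} s"
    proof (cases "s \<in> {T t<..\<Phi> ?r}")
      case True
      hence s: "0 < s" "s \<le> \<Phi> ?r" using T0 by auto
      have "ennreal A * ennreal (s * H x y s) = ennreal (k\<^sub>1 * h s x y * (C\<^sub>0 * s / (V x ?r * \<Psi> ?r)))"
        using A s h_bounds[of s x y] xy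
        by (subst ennreal_mult[symmetric]) (auto simp: A_def H_def mult_ac)
      also have "\<dots> \<le> p s x y" using s r xy by (intro p_lower_jump)
      finally show ?thesis using True s by simp
    qed simp
  qed
  finally show "ennreal (k\<^sub>1 * c\<^sub>N / N * (jump x ?r * (t * J x y (N * T t) (\<Phi> ?r)))) \<le> q t x y"
    by (simp add: A_def mult_ac)
qed

text \<open>
  The block used is \<open>(a, N a]\<close> with \<open>N a = 4 \<Phi> r\<close>, because for bounded \<open>D\<close> the range of (H2)
  may end just beyond \<open>4 \<Phi> r\<close>.  If this block starts below \<open>T\<close>, then \<open>\<Phi> r\<close> and \<open>T\<close> are comparable and the
  Gaussian lower bound is already of the required order, since \<open>t w(\<Phi> r) \<le> 2\<close>.
\<close>

lemma big_jump_lower: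
  "\<exists>c>0. \<forall>t>0. \<forall>x\<in>D. \<forall>y\<in>D. 0 < dist x y \<and> T t \<le> \<Phi> (dist x y) \<longrightarrow>
    ennreal (c * (h (\<Phi> (dist x y)) x y * (t * w (\<Phi> (dist x y)) / V x (dist x y)))) \<le> q t x y"
proof -
  obtain cg c' where cg: "0 < cg" "0 < c'" and gauss: "\<And>t x y. 0 < t \<Longrightarrow> x \<in> D \<Longrightarrow> y \<in> D \<Longrightarrow>
    ennreal (cg * (h (T t) x y / V x (\<R> (T t)) * gauss c' (dist x y) (T t))) \<le> q t x y"
    using gaussian_lower by blast
  obtain C where C: "1 \<le> C" "\<And>s u. 0 < s \<Longrightarrow> s \<le> u \<Longrightarrow> \<R> u \<le> C * (u / s) powr (1 / \<alpha>\<^sub>1) * \<R> s"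
    using \<R>_scaling by blast
  define B where "B = C * N powr (1 / \<alpha>\<^sub>1)"
  have B: "1 \<le> B" unfolding B_def
    using C law_block scale.pos mult_mono[of 1 C 1 "N powr (1 / \<alpha>\<^sub>1)"] by (simp add: ge_one_powr_ge_zero)
  define v where "v = C\<^sub>V * (C * 4 powr (1 / \<alpha>\<^sub>1)) powr d"
  have C4: "1 \<le> C * 4 powr (1 / \<alpha>\<^sub>1)"
    using C scale.pos mult_mono[of 1 C 1 "4 powr (1 / \<alpha>\<^sub>1)"] by (simp add: ge_one_powr_ge_zero)
  have "0 < (C * 4 powr (1 / \<alpha>\<^sub>1)) powr d" using C4 by (subst powr_gt_zero) linarith
  hence v: "0 < v" unfolding v_def using V_growth(1) by (intro mult_pos_pos) auto
  define c1 where "c1 = k\<^sub>1 * (1 / (C\<^sub>h * 4 powr \<gamma>)) * exp (- k\<^sub>2 * B\<^sup>2) / v * c\<^sub>N"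
  have c1: "0 < c1" unfolding c1_def using k_pos h_scaling v law_block by simp
  define c2 where "c2 = cg * exp (- c' * B\<^sup>2) / 2"
  have c2: "0 < c2" unfolding c2_def using cg by simp
  show ?thesis
  proof (rule exI[of _ "min c1 c2"], intro conjI allI ballI impI)
    show "0 < min c1 c2" using c1 c2 by simp
    fix t x y assume t: "0 < (t::real)" and xy: "x \<in> D" "y \<in> D" and "0 < dist x y \<and> T t \<le> \<Phi> (dist x y)"
    hence r: "0 < dist x y" "T t \<le> \<Phi> (dist x y)" by auto
    define r where "r = dist x y"
    define F where "F = \<Phi> r"
    have r0: "0 < r" and TF: "T t \<le> F" using r by (auto simp: r_def F_def)
    have T0: "0 < T t" using T_pos t .
    have F0: "0 < F" using T0 TF by simp
    have rR: "r \<le> \<R> F" "\<R> F \<le> r" using scale.ginv_lower[of r F] scale.ginv_upper[of r F] r0 by (auto simp: F_def)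
    have hF: "0 \<le> h F x y" using h_bounds[OF F0 xy] by simp
    have Vr: "0 < V x r" using V_pos r0 .
    define X where "X = h F x y * (t * w F / V x r)"
    have X0: "0 \<le> X" unfolding X_def using hF t w_pos[OF F0] Vr by simp
    have "ennreal (min c1 c2 * X) \<le> q t x y"
    proof (cases "T t \<le> 4 * F / N")
      case True
      define a where "a = 4 * F / N"
      have a: "0 < a" "a \<le> F" "N * a = 4 * F" using F0 law_block by (auto simp: a_def field_simps)
      define g where "g = k\<^sub>1 * ((1 / (C\<^sub>h * 4 powr \<gamma>)) * h F x y) * (exp (- k\<^sub>2 * B\<^sup>2) / (v * V x r))"
      have g0: "0 \<le> g" unfolding g_def using k_pos h_scaling hF v Vr by simp
      have "ennreal (g * measure (law x t) {a<..N * a}) \<le> q t x y"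
      proof (rule q_ge_const[OF xy(1) t _ _ g0])
        show "{a<..N * a} \<subseteq> {0<..}" using a by auto
        fix s assume "s \<in> {a<..N * a}"
        hence s: "a < s" "s \<le> 4 * F" "0 < s" using a by auto
        have bd: "below_diam D \<Phi> (4 * F)" using below_diam_\<Phi>[OF xy] by (simp add: F_def r_def)
        have "h F x y \<le> C\<^sub>h * (4 * F / F) powr \<gamma> * h (4 * F) x y" using F0 bd xy by (intro h_small) auto
        also have "h (4 * F) x y \<le> h s x y" using s xy by (intro h_antimono) auto
        finally have "h F x y \<le> C\<^sub>h * 4 powr \<gamma> * h s x y" using F0 h_scaling by simp
        hence hs: "(1 / (C\<^sub>h * 4 powr \<gamma>)) * h F x y \<le> h s x y" using h_scaling by (simp add: field_simps)
        have R: "0 < \<R> s" using scale.ginv_pos s by simp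
        have "r \<le> B * \<R> s"
        proof (cases "s \<le> F")
          case True
          have "\<R> F \<le> C * (F / s) powr (1 / \<alpha>\<^sub>1) * \<R> s" using C(2) s True by simp
          also have "\<dots> \<le> B * \<R> s" unfolding B_def
          proof (intro mult_right_mono mult_left_mono powr_mono2)
            have "4 * F \<le> N * s" using s a law_block by (metis less_imp_le mult_left_mono order_trans zero_le_numeral)
            thus "F / s \<le> N" using s F0 by (simp add: field_simps)
          qed (use scale.pos s F0 C R in auto)
          finally show ?thesis using rR by simp
        next
          case False
          have "r \<le> 1 * \<R> s" using rR scale.ginv_mono[of F s] F0 False by simp
          also have "\<dots> \<le> B * \<R> s" using B R by (intro mult_right_mono) auto
          finally show ?thesis .
        qed
        hence "r\<^sup>2 \<le> (B * \<R> s)\<^sup>2" using r0 by (intro power_mono) auto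
        hence "r\<^sup>2 / (\<R> s)\<^sup>2 \<le> B\<^sup>2" using R by (simp add: power_mult_distrib field_simps)
        hence "k\<^sub>2 * (r\<^sup>2 / (\<R> s)\<^sup>2) \<le> k\<^sub>2 * B\<^sup>2" using k_pos by (intro mult_left_mono) auto
        hence ex: "exp (- k\<^sub>2 * B\<^sup>2) \<le> gauss k\<^sub>2 r s" by simp
        have "\<R> s \<le> \<R> (4 * F)" using s by (intro scale.ginv_mono)
        also have "\<dots> \<le> C * (4 * F / F) powr (1 / \<alpha>\<^sub>1) * \<R> F" using F0 by (intro C) auto
        also have "\<dots> \<le> C * 4 powr (1 / \<alpha>\<^sub>1) * r" using F0 rR C by (simp add: mult_left_mono)
        finally have "V x (\<R> s) \<le> V x (C * 4 powr (1 / \<alpha>\<^sub>1) * r)" by (rule V_mono)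
        also have "\<dots> \<le> C\<^sub>V * (C * 4 powr (1 / \<alpha>\<^sub>1) * r / r) powr d * V x r"
          using r0 C4 mult_right_mono[of 1 "C * 4 powr (1 / \<alpha>\<^sub>1)" r] by (intro V_growth) auto
        also have "\<dots> = v * V x r" using r0 by (simp add: v_def)
        finally have Vs: "V x (\<R> s) \<le> v * V x r" .
        have "g \<le> k\<^sub>1 * h s x y * (gauss k\<^sub>2 r s / V x (\<R> s))"
          unfolding g_def using k_pos hs ex Vs V_pos[OF R, of x] hF h_scaling v Vr h_bounds[OF s(3) xy]
          by (intro mult_mono frac_le mult_left_mono order_trans[OF _ hs]) auto
        thus "ennreal g \<le> p s x y" using p_lower[OF s(3) xy] unfolding r_def by (auto intro: order_trans ennreal_leI)
      qed simp
      moreover have "min c1 c2 * X \<le> g * measure (law x t) {a<..N * a}"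
      proof -
        have "c\<^sub>N * (t * w F) \<le> c\<^sub>N * (t * w a)"
          using w_antimono[OF a(1,2)] t law_block by (intro mult_left_mono) auto
        also have "\<dots> \<le> measure (law x t) {a<..N * a}" using True by (intro law_block xy t) (simp add: a_def)
        finally have "g * (c\<^sub>N * (t * w F)) \<le> g * measure (law x t) {a<..N * a}" using g0 by (intro mult_left_mono)
        moreover have "g * (c\<^sub>N * (t * w F)) = c1 * X" by (simp add: g_def c1_def X_def mult_ac)
        moreover have "min c1 c2 * X \<le> c1 * X" using X0 by (intro mult_right_mono) auto
        ultimately show ?thesis by linarith
      qed
      ultimately show ?thesis by (auto intro: order_trans ennreal_leI)
    next
      case False
      have RT: "0 < \<R> (T t)" using scale.ginv_pos T0 .
      have "r \<le> \<R> F" using rR by simp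
      also have "\<dots> \<le> C * (F / T t) powr (1 / \<alpha>\<^sub>1) * \<R> (T t)" using T0 TF by (intro C)
      also have "\<dots> \<le> B * \<R> (T t)" unfolding B_def
      proof (intro mult_right_mono mult_left_mono powr_mono2)
        have "4 * F < N * T t" using False law_block by (simp add: field_simps)
        thus "F / T t \<le> N" using T0 F0 by (simp add: field_simps)
      qed (use scale.pos T0 F0 C RT in auto)
      finally have "r\<^sup>2 \<le> (B * \<R> (T t))\<^sup>2" using r0 by (intro power_mono) auto
      hence "r\<^sup>2 / (\<R> (T t))\<^sup>2 \<le> B\<^sup>2" using RT by (simp add: power_mult_distrib field_simps)
      hence "c' * (r\<^sup>2 / (\<R> (T t))\<^sup>2) \<le> c' * B\<^sup>2" using cg by (intro mult_left_mono) auto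
      hence ex: "exp (- c' * B\<^sup>2) \<le> gauss c' r (T t)" by simp
      have VT: "V x (\<R> (T t)) \<le> V x r" using scale.ginv_mono[OF T0 TF] rR by (intro V_mono) simp
      have "X \<le> h (T t) x y * (2 / V x (\<R> (T t)))" unfolding X_def
        using h_antimono[OF T0 TF xy] tw_le_2[OF t TF] VT V_pos[OF RT, of x] Vr hF t w_pos[OF F0] h_bounds[OF T0 xy]
        by (intro mult_mono frac_le) auto
      hence "c2 * X \<le> c2 * (h (T t) x y * (2 / V x (\<R> (T t))))" using c2 by (intro mult_left_mono) auto
      also have "\<dots> = cg * (h (T t) x y / V x (\<R> (T t)) * exp (- c' * B\<^sup>2))" by (simp add: c2_def)
      also have "\<dots> \<le> cg * (h (T t) x y / V x (\<R> (T t)) * gauss c' r (T t))"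
        using cg ex h_bounds[OF T0 xy] V_pos[OF RT, of x] by (intro mult_left_mono) auto
      finally have "min c1 c2 * X \<le> cg * (h (T t) x y / V x (\<R> (T t)) * gauss c' r (T t))"
        using X0 mult_right_mono[of "min c1 c2" c2 X] by simp
      thus ?thesis using gauss[OF t xy] unfolding r_def by (auto intro: order_trans ennreal_leI)
    qed
    thus "ennreal (min c1 c2 * (h (\<Phi> (dist x y)) x y * (t * w (\<Phi> (dist x y)) / V x (dist x y)))) \<le> q t x y"
      by (simp only: X_def F_def r_def)
  qed
qed

end

section \<open>Upper bounds for the subordinate heat kernel\<close>

context subordinate_kernel
begin

text \<open>The power of \<open>1 / s\<close> with which \<open>h s x y / V x (\<R> s)\<close> can grow as \<open>s\<close> decreases.\<close>

definition \<kappa> :: real where "\<kappa> = \<gamma> + d / \<alpha>\<^sub>1"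

lemma law_negative_moment:
  "\<exists>C>0. \<forall>t>0. \<forall>x\<in>D. (\<integral>\<^sup>+s. ennreal ((T t / s) powr \<kappa>) * indicator {0<..T t} s \<partial>law x t) \<le> ennreal C"
proof -
  have "0 \<le> \<kappa>" using h_scaling V_growth scale.pos by (simp add: \<kappa>_def)
  then obtain C where C: "0 < C" "\<And>\<mu> u. sets \<mu> = sets borel \<Longrightarrow> 0 < u \<Longrightarrow>
     (\<forall>e. 0 < e \<and> e \<le> 1 \<longrightarrow> emeasure \<mu> {..e * u} \<le> ennreal (exp (1 - b\<^sub>1 * (1 / e) powr \<beta>\<^sub>1))) \<Longrightarrow>
     (\<integral>\<^sup>+s. ennreal ((u / s) powr \<kappa>) * indicator {0<..u} s \<partial>\<mu>) \<le> ennreal C"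
    using negative_moment[of \<kappa> b\<^sub>1 \<beta>\<^sub>1] pos by blast
  show ?thesis
  proof (intro exI[of _ C] conjI allI ballI impI C(1))
    fix t x assume t: "0 < (t::real)" and x: "x \<in> D"
    show "(\<integral>\<^sup>+s. ennreal ((T t / s) powr \<kappa>) * indicator {0<..T t} s \<partial>law x t) \<le> ennreal C"
      using law_below[OF x t] law_sets[OF x t] T_pos[OF t]
      by (intro C) (auto simp: emeasure_law[OF x t] intro!: ennreal_leI)
  qed
qed

lemma h_over_V_small:
  "\<exists>A>0. \<forall>x\<in>D. \<forall>y\<in>D. \<forall>s u. 0 < s \<and> s \<le> u \<and> below_diam D \<Phi> u \<longrightarrow>
     h s x y / V x (\<R> s) \<le> A * (u / s) powr \<kappa> * (h u x y / V x (\<R> u))"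
proof -
  obtain C where C: "1 \<le> C" "\<And>x s u. 0 < s \<Longrightarrow> s \<le> u \<Longrightarrow> 1 / V x (\<R> s) \<le> C * (u / s) powr (d / \<alpha>\<^sub>1) / V x (\<R> u)"
    using V_\<R>_scaling by blast
  show ?thesis
  proof (rule exI[of _ "C\<^sub>h * C"], intro conjI allI ballI impI)
    show "0 < C\<^sub>h * C" using C h_scaling by simp
    fix x y s u assume xy: "x \<in> D" "y \<in> D" and "0 < s \<and> s \<le> u \<and> below_diam D \<Phi> u"
    hence s: "0 < s" "s \<le> u" "below_diam D \<Phi> u" "0 < u" by auto
    have "h s x y * (1 / V x (\<R> s)) \<le> (C\<^sub>h * (u / s) powr \<gamma> * h u x y) * (C * (u / s) powr (d / \<alpha>\<^sub>1) / V x (\<R> u))"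
      using s xy C h_bounds[OF s(4) xy] h_scaling V_pos[OF scale.ginv_pos[OF s(1)], of x]
      by (intro mult_mono h_small) auto
    also have "\<dots> = C\<^sub>h * C * ((u / s) powr \<gamma> * (u / s) powr (d / \<alpha>\<^sub>1)) * (h u x y / V x (\<R> u))" by simp
    also have "(u / s) powr \<gamma> * (u / s) powr (d / \<alpha>\<^sub>1) = (u / s) powr \<kappa>" by (simp add: \<kappa>_def powr_add)
    finally show "h s x y / V x (\<R> s) \<le> C\<^sub>h * C * (u / s) powr \<kappa> * (h u x y / V x (\<R> u))" by simp
  qed
qed

text \<open>
  Above \<open>T\<close>, \<open>h\<close> and \<open>1 / V\<close> are at most their values at \<open>T\<close>; below \<open>T\<close>, they exceed them by a power of
  \<open>T / s\<close> with bounded expectation.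
\<close>

lemma near_diagonal_upper:
  "\<exists>C>0. \<forall>t>0. \<forall>x\<in>D. \<forall>y\<in>D. below_diam D \<Phi> (T t) \<longrightarrow> q t x y \<le> ennreal (C * (h (T t) x y / V x (\<R> (T t))))"
proof -
  obtain A where A: "0 < A" "\<And>x y s u. x \<in> D \<Longrightarrow> y \<in> D \<Longrightarrow> 0 < s \<Longrightarrow> s \<le> u \<Longrightarrow> below_diam D \<Phi> u \<Longrightarrow>
     h s x y / V x (\<R> s) \<le> A * (u / s) powr \<kappa> * (h u x y / V x (\<R> u))"
    using h_over_V_small by metis
  obtain B where B: "0 < B" "\<And>t x. 0 < t \<Longrightarrow> x \<in> D \<Longrightarrow>
      (\<integral>\<^sup>+s. ennreal ((T t / s) powr \<kappa>) * indicator {0<..T t} s \<partial>law x t) \<le> ennreal B"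
    using law_negative_moment by metis
  show ?thesis
  proof (rule exI[of _ "k\<^sub>3 * A * B + k\<^sub>3"], intro conjI allI ballI impI)
    show "0 < k\<^sub>3 * A * B + k\<^sub>3" using k_pos A B by (simp add: add_pos_pos)
    fix t x y assume t: "0 < (t::real)" and xy: "x \<in> D" "y \<in> D" and bd: "below_diam D \<Phi> (T t)"
    note [measurable_cong] = law_sets[OF xy(1) t]
    interpret P: prob_space "law x t" by (rule law_prob[OF xy(1) t])
    have T0: "0 < T t" using T_pos t .
    have RT: "0 < \<R> (T t)" using scale.ginv_pos T0 .
    define Z where "Z = h (T t) x y / V x (\<R> (T t))"
    have Z: "0 \<le> Z" using h_bounds[OF T0 xy] V_pos[OF RT, of x] by (simp add: Z_def)
    have "q t x y \<le> (\<integral>\<^sup>+s. ennreal (k\<^sub>3 * A * Z) * (ennreal ((T t / s) powr \<kappa>) * indicator {0<..T t} s)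
        + ennreal (k\<^sub>3 * Z) * indicator {T t<..} s \<partial>law x t)"
      unfolding q_def
    proof (rule nn_integral_mono)
      fix s
      show "p s x y * indicator {0<..} s \<le> ennreal (k\<^sub>3 * A * Z) * (ennreal ((T t / s) powr \<kappa>) * indicator {0<..T t} s)
        + ennreal (k\<^sub>3 * Z) * indicator {T t<..} s"
      proof (cases "0 < s")
        case s: True
        have p: "p s x y \<le> ennreal (k\<^sub>3 * (h s x y / V x (\<R> s)))" using p_upper[OF s xy] by simp
        show ?thesis
        proof (cases "s \<le> T t")
          case True
          have "k\<^sub>3 * (h s x y / V x (\<R> s)) \<le> k\<^sub>3 * (A * (T t / s) powr \<kappa> * Z)"
            unfolding Z_def using k_pos A(2)[OF xy s True bd] by (intro mult_left_mono) auto
          also have "\<dots> = (k\<^sub>3 * A * Z) * (T t / s) powr \<kappa>" by simp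
          finally have "p s x y \<le> ennreal ((k\<^sub>3 * A * Z) * (T t / s) powr \<kappa>)" using p by (auto intro: order_trans ennreal_leI)
          thus ?thesis using True s k_pos A Z by (simp add: ennreal_mult')
        next
          case False
          hence sT: "T t \<le> s" by simp
          have "h s x y / V x (\<R> s) \<le> Z" unfolding Z_def
            using h_antimono[OF T0 sT xy] V_mono[OF scale.ginv_mono[OF T0 sT], of x] V_pos[OF RT, of x] h_bounds[OF T0 xy]
            by (intro frac_le) auto
          hence "k\<^sub>3 * (h s x y / V x (\<R> s)) \<le> k\<^sub>3 * Z" using k_pos by (intro mult_left_mono) auto
          hence "p s x y \<le> ennreal (k\<^sub>3 * Z)" by (rule order_trans[OF p ennreal_leI])
          thus ?thesis using False s by simp
        qed
      qed simp
    qed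
    also have "\<dots> = ennreal (k\<^sub>3 * A * Z) * (\<integral>\<^sup>+s. ennreal ((T t / s) powr \<kappa>) * indicator {0<..T t} s \<partial>law x t)
        + ennreal (k\<^sub>3 * Z) * emeasure (law x t) {T t<..}"
      by (subst nn_integral_add) (auto simp: nn_integral_cmult nn_integral_cmult_indicator)
    also have "\<dots> \<le> ennreal (k\<^sub>3 * A * Z) * ennreal B + ennreal (k\<^sub>3 * Z) * 1"
      by (intro add_mono mult_left_mono B t xy) (auto simp: P.emeasure_le_1)
    also have "\<dots> = ennreal ((k\<^sub>3 * A * B + k\<^sub>3) * Z)"
      using k_pos A B Z by (simp add: ennreal_mult[symmetric] ennreal_plus[symmetric] algebra_simps del: ennreal_plus)
    finally show "q t x y \<le> ennreal ((k\<^sub>3 * A * B + k\<^sub>3) * (h (T t) x y / V x (\<R> (T t))))" by (simp add: Z_def)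
  qed
qed

text \<open>
  By monotonicity \<open>s h s\<close> is at most twice the integral of \<open>h\<close> over \<open>{s / 2..s}\<close>; Tonelli's theorem and
  the tail bound, which is available from \<open>K T\<close> on, give the integral of \<open>h w\<close>.
\<close>

lemma truncated_mean_upper:
  assumes t: "0 < t" and xy: "x \<in> D" "y \<in> D"
  shows "(\<integral>\<^sup>+s. ennreal (s * H x y s) * indicator {2 * K * T t<..F} s \<partial>law x t)
    \<le> ennreal (2 * C\<^sub>K * (t * J x y (K * T t) F))"
proof -
  have T0: "0 < T t" using T_pos t .
  have K0: "0 < K" using law_tail by simp
  note [measurable] = H_measurable[OF xy]
  note [measurable_cong] = law_sets[OF xy(1) t]
  interpret P: prob_space "law x t" by (rule law_prob[OF xy(1) t])
  interpret pair_sigma_finite lborel "law x t" by unfold_locales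
  let ?I = "\<lambda>u. indicator {K * T t..F} u :: ennreal"
  let ?W = "\<lambda>u s. (if u \<le> s then 1 else 0 :: ennreal)"
  have H0: "0 \<le> H x y s" for s using h_bounds[of s x y] xy by (auto simp: H_def)
  have "(\<integral>\<^sup>+s. ennreal (s * H x y s) * indicator {2 * K * T t<..F} s \<partial>law x t)
    \<le> (\<integral>\<^sup>+s. (\<integral>\<^sup>+u. 2 * ennreal (H x y u) * ?I u * ?W u s \<partial>lborel) \<partial>law x t)"
  proof (rule nn_integral_mono)
    fix s
    show "ennreal (s * H x y s) * indicator {2 * K * T t<..F} s
      \<le> (\<integral>\<^sup>+u. 2 * ennreal (H x y u) * ?I u * ?W u s \<partial>lborel)"
    proof (cases "s \<in> {2 * K * T t<..F}")
      case True
      hence s: "2 * K * T t < s" "s \<le> F" "0 < s" using T0 K0 by (auto intro: less_trans[of 0 "2 * K * T t"])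
      have "ennreal (s * H x y s) = 2 * ennreal (H x y s) * emeasure lborel {s / 2..s}"
        using s H0 by (simp add: ennreal_mult[symmetric] flip: ennreal_numeral)
      also have "\<dots> = (\<integral>\<^sup>+u. 2 * ennreal (H x y s) * indicator {s / 2..s} u \<partial>lborel)"
        by (rule nn_integral_cmult_indicator[symmetric]) simp
      also have "\<dots> \<le> (\<integral>\<^sup>+u. 2 * ennreal (H x y u) * ?I u * ?W u s \<partial>lborel)"
      proof (rule nn_integral_mono)
        fix u
        show "2 * ennreal (H x y s) * indicator {s / 2..s} u \<le> 2 * ennreal (H x y u) * ?I u * ?W u s"
        proof (cases "u \<in> {s / 2..s}")
          case True
          hence u: "0 < u" "u \<le> s" "K * T t \<le> u" "u \<le> F" using s by auto
          hence "H x y s \<le> H x y u" using s h_antimono[of u s x y] xy by (simp add: H_def)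
          thus ?thesis using True u by (auto intro!: mult_left_mono ennreal_leI)
        qed simp
      qed
      finally show ?thesis using True by simp
    qed simp
  qed
  also have "\<dots> = (\<integral>\<^sup>+u. (\<integral>\<^sup>+s. 2 * ennreal (H x y u) * ?I u * ?W u s \<partial>law x t) \<partial>lborel)"
    by (rule Fubini') measurable
  also have "\<dots> \<le> (\<integral>\<^sup>+u. ennreal (2 * C\<^sub>K * t) * (ennreal (H x y u * w u) * ?I u) \<partial>lborel)"
  proof (rule nn_integral_mono)
    fix u
    show "(\<integral>\<^sup>+s. 2 * ennreal (H x y u) * ?I u * ?W u s \<partial>law x t) \<le> ennreal (2 * C\<^sub>K * t) * (ennreal (H x y u * w u) * ?I u)"
    proof (cases "u \<in> {K * T t..F}")
      case True
      hence u: "K * T t \<le> u" by simp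
      have "(\<integral>\<^sup>+s. 2 * ennreal (H x y u) * ?I u * ?W u s \<partial>law x t)
         = (\<integral>\<^sup>+s. ennreal (2 * H x y u) * indicator {u..} s \<partial>law x t)"
        using True H0 by (intro nn_integral_cong) (auto simp: ennreal_mult split: split_indicator)
      also have "\<dots> = ennreal (2 * H x y u * measure (law x t) {u..})"
        using H0 by (simp add: nn_integral_cmult_indicator P.emeasure_eq_measure ennreal_mult)
      also have "\<dots> \<le> ennreal (2 * H x y u * (C\<^sub>K * (t * w u)))"
        using H0 law_tail(3)[OF xy(1) t u] by (intro ennreal_leI mult_left_mono) auto
      also have "\<dots> = ennreal (2 * C\<^sub>K * t) * (ennreal (H x y u * w u) * ?I u)"
        using True law_tail t by (simp add: ennreal_mult'[symmetric] mult_ac)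
      finally show ?thesis .
    qed simp
  qed
  also have "\<dots> = ennreal (2 * C\<^sub>K * t) * ennreal (J x y (K * T t) F)"
    using J_nn(1)[of "K * T t" x y F] xy T0 K0 by (subst nn_integral_cmult) auto
  also have "\<dots> = ennreal (2 * C\<^sub>K * (t * J x y (K * T t) F))"
    using law_tail t by (simp add: ennreal_mult'[symmetric] mult_ac)
  finally show ?thesis .
qed

lemma J_mono:
  assumes "0 < a'" "a' \<le> a" "b \<le> b'" "x \<in> D" "y \<in> D" shows "J x y a b \<le> J x y a' b'"
proof -
  have "ennreal (J x y a b) \<le> ennreal (J x y a' b')"
    using assms by (subst (1 2) J_nn(1)[symmetric])
      (auto intro!: nn_integral_mono split: split_indicator)
  thus ?thesis using J_nn(2)[of a' x y b'] assms by (simp add: ennreal_le_iff)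
qed

lemma upper_below_T:
  "\<exists>a>0. \<forall>t>0. \<forall>x\<in>D. \<forall>y\<in>D. \<forall>s. 0 < dist x y \<and> T t \<le> \<Phi> (dist x y) \<and> 0 < s \<and> s \<le> T t \<longrightarrow>
     p s x y \<le> ennreal (a * (T t / s) powr \<kappa> * (jump x (dist x y) * (T t * h (T t) x y)
       + h (T t) x y / V x (\<R> (T t)) * gauss k\<^sub>4 (dist x y) (T t)))"
proof -
  obtain A where A: "0 < A" "\<And>x y s u. x \<in> D \<Longrightarrow> y \<in> D \<Longrightarrow> 0 < s \<Longrightarrow> s \<le> u \<Longrightarrow> below_diam D \<Phi> u \<Longrightarrow>
     h s x y / V x (\<R> s) \<le> A * (u / s) powr \<kappa> * (h u x y / V x (\<R> u))"
    using h_over_V_small by metis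
  show ?thesis
  proof (rule exI[of _ "k\<^sub>3 * (C\<^sub>h + A)"], intro conjI allI ballI impI)
    show "0 < k\<^sub>3 * (C\<^sub>h + A)" using k_pos h_scaling A by simp
    fix t x y s assume t: "0 < (t::real)" and xy: "x \<in> D" "y \<in> D"
      and "0 < dist x y \<and> T t \<le> \<Phi> (dist x y) \<and> 0 < s \<and> s \<le> T t"
    hence r: "0 < dist x y" "T t \<le> \<Phi> (dist x y)" and s: "0 < s" "s \<le> T t" by auto
    define r where "r = dist x y"
    have T0: "0 < T t" using T_pos t .
    have bd: "below_diam D \<Phi> (T t)" using r T0 by (intro below_diam_\<Phi>[OF xy]) auto
    have R: "0 < \<R> s" "\<R> s \<le> \<R> (T t)" using scale.ginv_pos scale.ginv_mono s by auto
    have RT: "0 < \<R> (T t)" using R by simp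
    define z where "z = (T t / s) powr \<kappa>"
    define P where "P = jump x r"
    have P: "0 \<le> P" unfolding P_def using C0 V\<Psi>_pos[OF r(1), of x] by (simp add: r_def)
    have hT: "0 \<le> h (T t) x y" using h_bounds[OF T0 xy] by simp
    have z1: "(T t / s) powr \<gamma> \<le> z" unfolding z_def
      using s V_growth scale.pos by (intro powr_mono) (auto simp: \<kappa>_def)
    have "h s x y \<le> C\<^sub>h * (T t / s) powr \<gamma> * h (T t) x y" by (rule h_small[OF s bd xy])
    also have "\<dots> \<le> C\<^sub>h * z * h (T t) x y" using z1 h_scaling hT by (intro mult_right_mono mult_left_mono) auto
    finally have "h s x y * (s * P) \<le> (C\<^sub>h * z * h (T t) x y) * (T t * P)"
      using s P h_bounds[OF s(1) xy] h_scaling hT by (intro mult_mono) (auto simp: z_def)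
    hence e1: "h s x y * (s * P) \<le> C\<^sub>h * z * (P * (T t * h (T t) x y))" by (simp add: mult_ac)
    have "1 / (\<R> (T t))\<^sup>2 \<le> 1 / (\<R> s)\<^sup>2" using R RT by (intro divide_left_mono power_mono mult_pos_pos) auto
    hence "(k\<^sub>4 * r\<^sup>2) * (1 / (\<R> (T t))\<^sup>2) \<le> (k\<^sub>4 * r\<^sup>2) * (1 / (\<R> s)\<^sup>2)" using k_pos by (intro mult_left_mono) auto
    hence "gauss k\<^sub>4 r s \<le> gauss k\<^sub>4 r (T t)" by simp
    hence "(h s x y / V x (\<R> s)) * gauss k\<^sub>4 r s
        \<le> (A * z * (h (T t) x y / V x (\<R> (T t)))) * gauss k\<^sub>4 r (T t)"
      using A(2)[OF xy s bd] A(1) hT V_pos[OF RT, of x] unfolding z_def by (intro mult_mono) auto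
    hence e2: "h s x y * (gauss k\<^sub>4 r s / V x (\<R> s))
        \<le> A * z * (h (T t) x y / V x (\<R> (T t)) * gauss k\<^sub>4 r (T t))" by (simp add: mult_ac)
    define Z1 where "Z1 = P * (T t * h (T t) x y)"
    define Z2 where "Z2 = h (T t) x y / V x (\<R> (T t)) * gauss k\<^sub>4 r (T t)"
    have Z: "0 \<le> Z1" "0 \<le> Z2" unfolding Z1_def Z2_def using P T0 hT V_pos[OF RT, of x] by auto
    have z0: "0 \<le> z" by (simp add: z_def)
    have "h s x y * (s * P) + h s x y * (gauss k\<^sub>4 r s / V x (\<R> s)) \<le> C\<^sub>h * z * Z1 + A * z * Z2"
      using e1 e2 unfolding Z1_def Z2_def by linarith
    also have "\<dots> \<le> (C\<^sub>h + A) * z * (Z1 + Z2)"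
    proof -
      have "0 \<le> C\<^sub>h * z * Z2" "0 \<le> A * z * Z1" using Z z0 A h_scaling by auto
      thus ?thesis by (simp add: algebra_simps)
    qed
    finally have "k\<^sub>3 * (h s x y * (s * P) + h s x y * (gauss k\<^sub>4 r s / V x (\<R> s))) \<le> k\<^sub>3 * ((C\<^sub>h + A) * z * (Z1 + Z2))"
      using k_pos by (intro mult_left_mono) auto
    moreover have "k\<^sub>3 * h s x y * (C\<^sub>0 * s / (V x r * \<Psi> r) + gauss k\<^sub>4 r s / V x (\<R> s))
       = k\<^sub>3 * (h s x y * (s * P) + h s x y * (gauss k\<^sub>4 r s / V x (\<R> s)))"
      by (simp add: P_def algebra_simps)
    ultimately have "k\<^sub>3 * h s x y * (C\<^sub>0 * s / (V x r * \<Psi> r) + gauss k\<^sub>4 r s / V x (\<R> s))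
       \<le> k\<^sub>3 * (C\<^sub>h + A) * z * (Z1 + Z2)" by (simp only: mult.assoc)
    hence "p s x y \<le> ennreal (k\<^sub>3 * (C\<^sub>h + A) * z * (Z1 + Z2))"
      using p_upper_off[OF s(1) xy r(1)] unfolding r_def by (auto intro: order_trans ennreal_leI)
    thus "p s x y \<le> ennreal (k\<^sub>3 * (C\<^sub>h + A) * (T t / s) powr \<kappa> * (jump x (dist x y) * (T t * h (T t) x y)
       + h (T t) x y / V x (\<R> (T t)) * gauss k\<^sub>4 (dist x y) (T t)))"
      by (simp only: z_def Z1_def Z2_def P_def r_def)
  qed
qed

lemma upper_near_T:
  "\<exists>a>0. \<exists>c>0. c \<le> k\<^sub>4 \<and> (\<forall>t>0. \<forall>x\<in>D. \<forall>y\<in>D. \<forall>s. 0 < dist x y \<and> T t < s \<and> s \<le> 2 * K * T t \<longrightarrow>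
     p s x y \<le> ennreal (a * (jump x (dist x y) * (T t * h (T t) x y)
       + h (T t) x y / V x (\<R> (T t)) * gauss c (dist x y) (T t))))"
proof -
  obtain C where C: "1 \<le> C" "\<And>s u. 0 < s \<Longrightarrow> s \<le> u \<Longrightarrow> \<R> u \<le> C * (u / s) powr (1 / \<alpha>\<^sub>1) * \<R> s"
    using \<R>_scaling by blast
  define B where "B = C * (2 * K) powr (1 / \<alpha>\<^sub>1)"
  have B: "1 \<le> B" unfolding B_def
    using C law_tail scale.pos mult_mono[of 1 C 1 "(2 * K) powr (1 / \<alpha>\<^sub>1)"] by (simp add: ge_one_powr_ge_zero)
  have p1: "0 < k\<^sub>3 * (2 * K)" "0 < k\<^sub>4 / B\<^sup>2" using k_pos law_tail B by auto
  have "1 \<le> B\<^sup>2" using B by simp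
  hence p2: "k\<^sub>4 / B\<^sup>2 \<le> k\<^sub>4" using k_pos B by (simp add: divide_le_eq mult_le_cancel_left1)
  show ?thesis
  proof (rule exI[of _ "k\<^sub>3 * (2 * K)"], rule conjI[OF p1(1)], rule exI[of _ "k\<^sub>4 / B\<^sup>2"], rule conjI[OF p1(2)],
      rule conjI[OF p2], intro allI ballI impI)
    fix t x y s assume t: "0 < (t::real)" and xy: "x \<in> D" "y \<in> D"
      and "0 < dist x y \<and> T t < s \<and> s \<le> 2 * K * T t"
    hence r: "0 < dist x y" and s: "T t < s" "s \<le> 2 * K * T t" by auto
    define r where "r = dist x y"
    have T0: "0 < T t" using T_pos t .
    have s0: "0 < s" "T t \<le> s" using s T0 by auto
    have RT: "0 < \<R> (T t)" using scale.ginv_pos T0 .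
    have R: "0 < \<R> s" "\<R> (T t) \<le> \<R> s" using scale.ginv_pos scale.ginv_mono s0 T0 by auto
    have hT: "0 \<le> h (T t) x y" using h_bounds[OF T0 xy] by simp
    have hs: "0 \<le> h s x y" "h s x y \<le> h (T t) x y" using h_bounds[OF s0(1) xy] h_antimono[OF T0 s0(2) xy] by auto
    define P where "P = jump x r"
    have P: "0 \<le> P" unfolding P_def using C0 V\<Psi>_pos[OF r, of x] by (simp add: r_def)
    have "s / T t \<le> 2 * K" using s T0 by (simp add: field_simps)
    hence "(s / T t) powr (1 / \<alpha>\<^sub>1) \<le> (2 * K) powr (1 / \<alpha>\<^sub>1)" using T0 s0 scale.pos by (intro powr_mono2) auto
    hence "C * (s / T t) powr (1 / \<alpha>\<^sub>1) * \<R> (T t) \<le> B * \<R> (T t)"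
      unfolding B_def using C RT by (intro mult_right_mono mult_left_mono) auto
    hence "\<R> s \<le> B * \<R> (T t)" using C(2)[OF T0 s0(2)] by simp
    hence "(\<R> s)\<^sup>2 \<le> (B * \<R> (T t))\<^sup>2" using R by (intro power_mono) auto
    hence "1 / (B * \<R> (T t))\<^sup>2 \<le> 1 / (\<R> s)\<^sup>2" using R RT B by (intro divide_left_mono) (auto intro!: mult_pos_pos)
    hence "(k\<^sub>4 * r\<^sup>2) * (1 / (B * \<R> (T t))\<^sup>2) \<le> (k\<^sub>4 * r\<^sup>2) * (1 / (\<R> s)\<^sup>2)" using k_pos by (intro mult_left_mono) auto
    hence "gauss k\<^sub>4 r s \<le> gauss (k\<^sub>4 / B\<^sup>2) r (T t)" by (simp add: power_mult_distrib)
    moreover have "h s x y / V x (\<R> s) \<le> h (T t) x y / V x (\<R> (T t))"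
      using hs hT V_mono[OF R(2), of x] V_pos[OF RT, of x] by (intro frac_le) auto
    ultimately have "(h s x y / V x (\<R> s)) * gauss k\<^sub>4 r s
        \<le> (h (T t) x y / V x (\<R> (T t))) * gauss (k\<^sub>4 / B\<^sup>2) r (T t)"
      using hT V_pos[OF RT, of x] by (intro mult_mono) auto
    moreover define Z2 where "Z2 = h (T t) x y / V x (\<R> (T t)) * gauss (k\<^sub>4 / B\<^sup>2) r (T t)"
    ultimately have e2: "h s x y * (gauss k\<^sub>4 r s / V x (\<R> s)) \<le> Z2" by (simp add: mult_ac)
    define Z1 where "Z1 = P * (T t * h (T t) x y)"
    have Z: "0 \<le> Z1" "0 \<le> Z2" unfolding Z1_def Z2_def using P T0 hT V_pos[OF RT, of x] by auto
    have "h s x y * (s * P) \<le> h (T t) x y * ((2 * K * T t) * P)"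
      using hs s s0 P hT by (intro mult_mono) auto
    also have "\<dots> = 2 * K * Z1" by (simp add: Z1_def)
    finally have e1: "h s x y * (s * P) \<le> 2 * K * Z1" .
    have "1 * Z2 \<le> (2 * K) * Z2" using Z law_tail by (intro mult_right_mono) auto
    hence "h s x y * (s * P) + h s x y * (gauss k\<^sub>4 r s / V x (\<R> s)) \<le> (2 * K) * (Z1 + Z2)"
      using e1 e2 by (simp add: distrib_left)
    hence "k\<^sub>3 * (h s x y * (s * P) + h s x y * (gauss k\<^sub>4 r s / V x (\<R> s))) \<le> k\<^sub>3 * ((2 * K) * (Z1 + Z2))"
      using k_pos by (intro mult_left_mono) auto
    moreover have "k\<^sub>3 * h s x y * (C\<^sub>0 * s / (V x r * \<Psi> r) + gauss k\<^sub>4 r s / V x (\<R> s))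
       = k\<^sub>3 * (h s x y * (s * P) + h s x y * (gauss k\<^sub>4 r s / V x (\<R> s)))"
      by (simp add: P_def algebra_simps)
    ultimately have "k\<^sub>3 * h s x y * (C\<^sub>0 * s / (V x r * \<Psi> r) + gauss k\<^sub>4 r s / V x (\<R> s))
       \<le> k\<^sub>3 * (2 * K) * (Z1 + Z2)" by (simp only: mult.assoc)
    hence "p s x y \<le> ennreal (k\<^sub>3 * (2 * K) * (Z1 + Z2))"
      using p_upper_off[OF s0(1) xy r(1)] unfolding r_def by (auto intro: order_trans ennreal_leI)
    thus "p s x y \<le> ennreal (k\<^sub>3 * (2 * K) * (jump x (dist x y) * (T t * h (T t) x y)
       + h (T t) x y / V x (\<R> (T t)) * gauss (k\<^sub>4 / B\<^sup>2) (dist x y) (T t)))"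
      by (simp only: Z1_def Z2_def P_def r_def)
  qed
qed

text \<open>
  With \<open>z = r / \<R> s\<close>, the losses from (H2), from volume doubling and from the extra factor
  \<open>(\<Phi> r / s)\<^sup>L\<close> are powers of \<open>z\<close>, and \<open>exp (- k\<^sub>4 z\<^sup>2)\<close> absorbs any power of \<open>z\<close>.
\<close>

lemma gaussian_part_upper:
  assumes L: "0 < L"
  shows "\<exists>a>0. \<forall>x\<in>D. \<forall>y\<in>D. \<forall>s. 0 < dist x y \<and> 0 < s \<and> s \<le> \<Phi> (dist x y) \<longrightarrow>
     h s x y * (gauss k\<^sub>4 (dist x y) s / V x (\<R> s))
       \<le> a * (s / \<Phi> (dist x y)) powr L * (h (\<Phi> (dist x y)) x y / V x (dist x y))"
proof -
  define B where "B = a\<^sub>2 * 2 powr \<alpha>\<^sub>2"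
  have B: "0 < B" using scale.pos by (simp add: B_def)
  define \<delta> where "\<delta> = (\<alpha>\<^sub>2 * (\<gamma> + L) + d) / 2"
  have "0 < \<gamma> + L" using h_scaling(2) L by simp
  hence "0 < \<alpha>\<^sub>2 * (\<gamma> + L)" using scale.pos(2) by (intro mult_pos_pos)
  hence \<delta>: "0 < \<delta>" using V_growth(2) by (simp add: \<delta>_def)
  define G where "G = (\<delta> / k\<^sub>4) powr \<delta>"
  have G: "0 < G" using \<delta> k_pos by (simp add: G_def)
  show ?thesis
  proof (rule exI[of _ "C\<^sub>h * C\<^sub>V * B powr (\<gamma> + L) * G"], intro conjI allI ballI impI)
    show "0 < C\<^sub>h * C\<^sub>V * B powr (\<gamma> + L) * G" using h_scaling V_growth B G by (intro mult_pos_pos) auto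
    fix x y s assume xy: "x \<in> D" "y \<in> D" and "0 < dist x y \<and> 0 < s \<and> s \<le> \<Phi> (dist x y)"
    define r where "r = dist x y"
    define F where "F = \<Phi> r"
    have r: "0 < r" and s: "0 < s" "s \<le> F" using \<open>0 < dist x y \<and> _\<close> by (auto simp: r_def F_def)
    have F0: "0 < F" using s by simp
    have bd: "below_diam D \<Phi> F" using F0 by (intro below_diam_\<Phi>[OF xy]) (simp add: F_def r_def)
    have hF: "0 \<le> h F x y" using h_bounds[OF F0 xy] by simp
    have R: "0 < \<R> s" "\<R> s \<le> r" using scale.ginv_pos[OF s(1)] scale.ginv_upper[of r s] r s by (auto simp: F_def)
    have Vr: "0 < V x r" using V_pos r .
    define z where "z = r / \<R> s"
    have z: "0 < z" using R r by (simp add: z_def)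
    have "F / s \<le> B * z powr \<alpha>\<^sub>2" unfolding F_def B_def z_def
      using s r by (intro scale.\<Phi>_over_upper) (auto simp: F_def)
    hence "(F / s) powr (\<gamma> + L) \<le> (B * z powr \<alpha>\<^sub>2) powr (\<gamma> + L)"
      using h_scaling L s F0 by (intro powr_mono2) auto
    also have "\<dots> = B powr (\<gamma> + L) * z powr (\<alpha>\<^sub>2 * (\<gamma> + L))" by (simp add: powr_mult powr_powr)
    finally have Fs: "(F / s) powr (\<gamma> + L) \<le> B powr (\<gamma> + L) * z powr (\<alpha>\<^sub>2 * (\<gamma> + L))" .
    have "(F / s) powr \<gamma> = (F / s) powr (\<gamma> + L) * (s / F) powr L"
      using s F0 by (simp add: powr_add powr_divide)
    also have "\<dots> \<le> B powr (\<gamma> + L) * z powr (\<alpha>\<^sub>2 * (\<gamma> + L)) * (s / F) powr L"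
      by (intro mult_right_mono Fs) auto
    finally have Fs': "(F / s) powr \<gamma> \<le> B powr (\<gamma> + L) * z powr (\<alpha>\<^sub>2 * (\<gamma> + L)) * (s / F) powr L" .
    have "h s x y \<le> C\<^sub>h * (F / s) powr \<gamma> * h F x y" by (rule h_small[OF s bd xy])
    also have "\<dots> \<le> C\<^sub>h * (B powr (\<gamma> + L) * z powr (\<alpha>\<^sub>2 * (\<gamma> + L)) * (s / F) powr L) * h F x y"
      using Fs' h_scaling hF by (intro mult_right_mono mult_left_mono) auto
    finally have e1: "h s x y \<le> C\<^sub>h * (B powr (\<gamma> + L) * z powr (\<alpha>\<^sub>2 * (\<gamma> + L)) * (s / F) powr L) * h F x y" .
    have "V x r \<le> C\<^sub>V * z powr d * V x (\<R> s)" unfolding z_def using R by (intro V_growth)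
    hence e2: "1 / V x (\<R> s) \<le> C\<^sub>V * z powr d / V x r" using Vr V_pos[OF R(1), of x] by (simp add: field_simps)
    have "z powr (2 * \<delta>) = (z\<^sup>2) powr \<delta>" using z by (simp add: powr_powr flip: powr_numeral)
    also have "\<dots> \<le> G * exp (k\<^sub>4 * z\<^sup>2)" unfolding G_def using z \<delta> k_pos by (intro powr_le_exp) auto
    finally have "z powr (2 * \<delta>) * exp (- (k\<^sub>4 * z\<^sup>2)) \<le> G * exp (k\<^sub>4 * z\<^sup>2) * exp (- (k\<^sub>4 * z\<^sup>2))"
      by (intro mult_right_mono) auto
    also have "\<dots> = G" by (simp add: mult.assoc flip: exp_add)
    finally have zG: "z powr (2 * \<delta>) * exp (- (k\<^sub>4 * z\<^sup>2)) \<le> G" .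
    have zz: "z powr (\<alpha>\<^sub>2 * (\<gamma> + L)) * z powr d = z powr (2 * \<delta>)"
    proof -
      have "2 * \<delta> = \<alpha>\<^sub>2 * (\<gamma> + L) + d" 
        unfolding \<delta>_def by (simp only: times_divide_eq_right nonzero_mult_div_cancel_left zero_neq_numeral not_False_eq_True)
      thus ?thesis by (simp only: powr_add)
    qed
    have ex: "gauss k\<^sub>4 r s = exp (- (k\<^sub>4 * z\<^sup>2))" by (simp add: z_def power_divide)
    have "h s x y * (1 / V x (\<R> s)) \<le>
       (C\<^sub>h * (B powr (\<gamma> + L) * z powr (\<alpha>\<^sub>2 * (\<gamma> + L)) * (s / F) powr L) * h F x y) * (C\<^sub>V * z powr d / V x r)"
      using e1 e2 h_bounds[OF s(1) xy] h_scaling hF V_pos[OF R(1), of x] by (intro mult_mono) auto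
    hence "h s x y * (1 / V x (\<R> s)) * exp (- (k\<^sub>4 * z\<^sup>2)) \<le>
       (C\<^sub>h * (B powr (\<gamma> + L) * z powr (\<alpha>\<^sub>2 * (\<gamma> + L)) * (s / F) powr L) * h F x y) * (C\<^sub>V * z powr d / V x r) * exp (- (k\<^sub>4 * z\<^sup>2))"
      by (intro mult_right_mono) auto
    also have "\<dots> = (C\<^sub>h * C\<^sub>V * B powr (\<gamma> + L) * (s / F) powr L * (h F x y / V x r)) *
         ((z powr (\<alpha>\<^sub>2 * (\<gamma> + L)) * z powr d) * exp (- (k\<^sub>4 * z\<^sup>2)))" by simp
    also have "\<dots> \<le> (C\<^sub>h * C\<^sub>V * B powr (\<gamma> + L) * (s / F) powr L * (h F x y / V x r)) * G"
      unfolding zz using zG h_scaling V_growth hF Vr by (intro mult_left_mono) auto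
    finally have "h s x y * (gauss k\<^sub>4 r s / V x (\<R> s))
       \<le> C\<^sub>h * C\<^sub>V * B powr (\<gamma> + L) * G * (s / F) powr L * (h F x y / V x r)" unfolding ex by (simp add: mult_ac)
    thus "h s x y * (gauss k\<^sub>4 (dist x y) s / V x (\<R> s))
       \<le> C\<^sub>h * C\<^sub>V * B powr (\<gamma> + L) * G * (s / \<Phi> (dist x y)) powr L * (h (\<Phi> (dist x y)) x y / V x (dist x y))"
      by (simp only: r_def F_def)
  qed
qed

end

section \<open>Two-sided bounds off the diagonal\<close>

context subordinate_kernel
begin

lemma J_le: assumes "0 < a" "0 \<le> b" "x \<in> D" "y \<in> D" shows "J x y a b \<le> b * (h a x y * w a)"
proof -
  have h0: "0 \<le> h a x y * w a" using h_bounds[of a x y] w_pos[of a] assms by simp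
  have "ennreal (J x y a b) = (\<integral>\<^sup>+s. ennreal (H x y s * w s) * indicator {a..b} s \<partial>lborel)"
    using assms by (intro J_nn(1)[symmetric])
  also have "\<dots> \<le> (\<integral>\<^sup>+s. ennreal (h a x y * w a) * indicator {0..b} s \<partial>lborel)"
  proof (rule nn_integral_mono)
    fix s
    show "ennreal (H x y s * w s) * indicator {a..b} s \<le> ennreal (h a x y * w a) * indicator {0..b} s"
    proof (cases "s \<in> {a..b}")
      case True
      hence s: "0 < s" "a \<le> s" using assms by auto
      have "h s x y * w s \<le> h a x y * w a"
        using h_antimono[of a s x y] h_bounds[of s x y] h_bounds[of a x y] w_antimono[of a s] w_pos[OF s(1)] assms s by (intro mult_mono) auto
      thus ?thesis using True s by (simp add: H_def ennreal_leI)
    qed simp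
  qed
  also have "\<dots> = ennreal (b * (h a x y * w a))"
    using assms h0 by (subst nn_integral_cmult_indicator) (auto simp: ennreal_mult'[symmetric] mult.commute)
  finally show ?thesis using assms h0 by (subst (asm) ennreal_le_iff) auto
qed

text \<open>
  Near the ends of the range the integrand is bounded by monotonicity: the part up to \<open>N T\<close> is of the
  order of the summand \<open>T h (T)\<close>, and the part beyond \<open>F = \<Phi> r\<close> is of the order of the last summand of
  the theorem.  \<open>truncated_mean_lower\<close> covers the rest.
\<close>

lemma J_split_le:
  assumes t: "0 < t" and TF: "T t \<le> F" and xy: "x \<in> D" "y \<in> D"
  shows "t * J x y (2 * T t) (4 * F) \<le> 2 * N * (T t * h (T t) x y) + t * J x y (N * T t) F + 4 * F * (h F x y * (t * w F))"
proof -
  note [measurable] = H_measurable[OF xy]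
  have T0: "0 < T t" using T_pos t .
  have N0: "0 < N" using law_block by simp
  have F0: "0 < F" using T0 TF by simp
  let ?g = "\<lambda>s. ennreal (H x y s * w s)"
  have "ennreal (J x y (2 * T t) (4 * F)) = (\<integral>\<^sup>+s. ?g s * indicator {2 * T t..4 * F} s \<partial>lborel)"
    using T0 xy by (intro J_nn(1)[symmetric]) auto
  also have "\<dots> \<le> (\<integral>\<^sup>+s. ?g s * indicator {2 * T t..N * T t} s + (?g s * indicator {N * T t..F} s + ?g s * indicator {F..4 * F} s) \<partial>lborel)"
    by (intro nn_integral_mono) (auto split: split_indicator)
  also have "\<dots> = ennreal (J x y (2 * T t) (N * T t)) + (ennreal (J x y (N * T t) F) + ennreal (J x y F (4 * F)))"
    using T0 N0 F0 xy by (simp add: nn_integral_add J_nn(1))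
  also have "\<dots> = ennreal (J x y (2 * T t) (N * T t) + (J x y (N * T t) F + J x y F (4 * F)))"
    using T0 N0 F0 xy by (simp add: ennreal_plus J_nn(2) add_nonneg_nonneg)
  finally have "J x y (2 * T t) (4 * F) \<le> J x y (2 * T t) (N * T t) + (J x y (N * T t) F + J x y F (4 * F))"
    using T0 N0 F0 xy by (subst (asm) ennreal_le_iff) (auto simp: J_nn(2) add_nonneg_nonneg)
  also have "\<dots> \<le> N * T t * (h (T t) x y * w (2 * T t)) + (J x y (N * T t) F + 4 * F * (h F x y * w F))"
  proof (intro add_mono order_refl)
    have "J x y (2 * T t) (N * T t) \<le> N * T t * (h (2 * T t) x y * w (2 * T t))" using T0 N0 xy by (intro J_le) auto
    also have "\<dots> \<le> N * T t * (h (T t) x y * w (2 * T t))"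
      using h_antimono[of "T t" "2 * T t" x y] T0 N0 xy w_pos[of "2 * T t"] by (intro mult_left_mono mult_right_mono) auto
    finally show "J x y (2 * T t) (N * T t) \<le> N * T t * (h (T t) x y * w (2 * T t))" .
    show "J x y F (4 * F) \<le> 4 * F * (h F x y * w F)" using F0 xy by (intro J_le) auto
  qed
  finally have "t * J x y (2 * T t) (4 * F) \<le> t * (N * T t * (h (T t) x y * w (2 * T t)) + (J x y (N * T t) F + 4 * F * (h F x y * w F)))"
    using t by (intro mult_left_mono) auto
  also have "\<dots> = N * T t * h (T t) x y * (t * w (2 * T t)) + t * J x y (N * T t) F + 4 * F * (h F x y * (t * w F))"
    by (simp add: algebra_simps)
  also have "N * T t * h (T t) x y * (t * w (2 * T t)) \<le> N * T t * h (T t) x y * 2"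
    using tw_le_2[OF t, of "2 * T t"] T0 N0 h_bounds[OF T0 xy] by (intro mult_left_mono) auto
  finally show ?thesis by (simp add: mult_ac)
qed

text \<open>
  The right-hand side of the off-diagonal estimate; \<open>\<R> (T t)\<close> is the inverse of \<open>\<psi>\<close> at \<open>t\<close>.
\<close>

definition profile :: "real \<Rightarrow> real \<Rightarrow> 'e \<Rightarrow> 'e \<Rightarrow> real" where
  "profile c t x y = jump x (dist x y) * (t * J x y (2 * T t) (4 * \<Phi> (dist x y)) + T t * h (T t) x y)
     + h (T t) x y / V x (\<R> (T t)) * gauss c (dist x y) (T t)
     + h (\<Phi> (dist x y)) x y * (t * w (\<Phi> (dist x y)) / V x (dist x y))"

lemma off_diagonal_lower:
  "\<exists>a>0. \<exists>c>0. \<forall>t>0. \<forall>x\<in>D. \<forall>y\<in>D. 0 < dist x y \<and> T t \<le> \<Phi> (dist x y) \<longrightarrow> ennreal (a * profile c t x y) \<le> q t x y"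
proof -
  obtain c1 c where c1: "0 < c1" "0 < c" and l1: "\<And>t x y. 0 < t \<Longrightarrow> x \<in> D \<Longrightarrow> y \<in> D \<Longrightarrow>
    ennreal (c1 * (h (T t) x y / V x (\<R> (T t)) * gauss c (dist x y) (T t))) \<le> q t x y"
    using gaussian_lower by blast
  obtain c2 where c2: "0 < c2" and l2: "\<And>t x y. 0 < t \<Longrightarrow> x \<in> D \<Longrightarrow> y \<in> D \<Longrightarrow> 0 < dist x y \<Longrightarrow> T t \<le> \<Phi> (dist x y) \<Longrightarrow>
    ennreal (c2 * (jump x (dist x y) * (T t * h (T t) x y))) \<le> q t x y"
    using jump_lower_T by blast
  obtain c3 where c3: "0 < c3" and l3: "\<And>t x y. 0 < t \<Longrightarrow> x \<in> D \<Longrightarrow> y \<in> D \<Longrightarrow> 0 < dist x y \<Longrightarrow> T t \<le> \<Phi> (dist x y) \<Longrightarrow>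
    ennreal (c3 * (jump x (dist x y) * (t * J x y (N * T t) (\<Phi> (dist x y))))) \<le> q t x y"
    using jump_lower_integral by blast
  obtain c4 where c4: "0 < c4" and l4: "\<And>t x y. 0 < t \<Longrightarrow> x \<in> D \<Longrightarrow> y \<in> D \<Longrightarrow> 0 < dist x y \<Longrightarrow> T t \<le> \<Phi> (dist x y) \<Longrightarrow>
    ennreal (c4 * (h (\<Phi> (dist x y)) x y * (t * w (\<Phi> (dist x y)) / V x (dist x y)))) \<le> q t x y"
    using big_jump_lower by blast
  define A where "A = (2 * N + 1) / c2 + 1 / c3 + (4 * C\<^sub>0 + 1) / c4 + 1 / c1"
  have "0 < (2 * N + 1) / c2" "0 < 1 / c3" "0 < (4 * C\<^sub>0 + 1) / c4" "0 < 1 / c1"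
    using c1 c2 c3 c4 C0 law_block(1) by simp_all
  hence A: "0 < A" unfolding A_def by linarith
  have A1: "0 < 1 / A" using A by simp
  show ?thesis
  proof (rule exI[of _ "1 / A"], rule conjI[OF A1], rule exI[of _ c], rule conjI[OF c1(2)], intro allI ballI impI)
    fix t x y assume t: "0 < (t::real)" and xy: "x \<in> D" "y \<in> D" and "0 < dist x y \<and> T t \<le> \<Phi> (dist x y)"
    hence r: "0 < dist x y" "T t \<le> \<Phi> (dist x y)" by auto
    let ?r = "dist x y"
    define F where "F = \<Phi> ?r"
    have F0: "0 < F" using r scale.\<Phi>_pos by (simp add: F_def)
    have T0: "0 < T t" using T_pos t .
    define P where "P = jump x ?r"
    have P: "0 \<le> P" unfolding P_def using C0 V\<Psi>_pos[OF r(1), of x] by simp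
    have Vr: "0 < V x ?r" using V_pos[OF r(1)] .
    have hF: "0 \<le> h F x y" using h_bounds[OF F0 xy] by simp
    define X1 where "X1 = h (T t) x y / V x (\<R> (T t)) * gauss c ?r (T t)"
    define X2 where "X2 = P * (T t * h (T t) x y)"
    define X3 where "X3 = P * (t * J x y (N * T t) F)"
    define X4 where "X4 = h F x y * (t * w F / V x ?r)"
    have "P * (4 * F * (h F x y * (t * w F))) = 4 * C\<^sub>0 * (F / \<Psi> ?r) * X4"
      by (simp add: P_def X4_def mult_ac)
    also have "\<dots> \<le> 4 * C\<^sub>0 * 1 * X4"
      using \<Psi>[of ?r] F0 C0 hF t w_pos[OF F0] Vr by (intro mult_right_mono mult_left_mono) (auto simp: F_def X4_def)
    finally have e4: "P * (4 * F * (h F x y * (t * w F))) \<le> 4 * C\<^sub>0 * X4" by simp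
    have "P * (t * J x y (2 * T t) (4 * F))
       \<le> P * (2 * N * (T t * h (T t) x y) + t * J x y (N * T t) F + 4 * F * (h F x y * (t * w F)))"
      using P r by (intro mult_left_mono J_split_le t xy) (simp add: F_def)
    also have "\<dots> = 2 * N * X2 + X3 + P * (4 * F * (h F x y * (t * w F)))"
      by (simp add: X2_def X3_def algebra_simps)
    finally have "P * (t * J x y (2 * T t) (4 * F)) \<le> 2 * N * X2 + X3 + 4 * C\<^sub>0 * X4" using e4 by linarith
    moreover have "profile c t x y = P * (t * J x y (2 * T t) (4 * F)) + X2 + X1 + X4"
      by (simp add: profile_def P_def X2_def X1_def X4_def F_def distrib_left)
    ultimately have prof: "profile c t x y \<le> (2 * N + 1) * X2 + X3 + (4 * C\<^sub>0 + 1) * X4 + X1" by (simp add: algebra_simps)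
    show "ennreal (1 / A * profile c t x y) \<le> q t x y"
    proof (cases "q t x y")
      case (real Q)
      have "ennreal (c1 * X1) \<le> ennreal Q" using l1[OF t xy] by (simp add: X1_def real)
      hence q1: "X1 \<le> Q / c1" using real c1 by (simp add: ennreal_le_iff field_simps)
      have "ennreal (c2 * X2) \<le> ennreal Q" using l2[OF t xy r] by (simp add: X2_def P_def real)
      hence q2: "X2 \<le> Q / c2" using real c2 by (simp add: ennreal_le_iff field_simps)
      have "ennreal (c3 * X3) \<le> ennreal Q" using l3[OF t xy r] by (simp add: X3_def P_def F_def real)
      hence q3: "X3 \<le> Q / c3" using real c3 by (simp add: ennreal_le_iff field_simps)
      have "ennreal (c4 * X4) \<le> ennreal Q" using l4[OF t xy r] by (simp add: X4_def F_def real)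
      hence q4: "X4 \<le> Q / c4" using real c4 by (simp add: ennreal_le_iff field_simps)
      have "(2 * N + 1) * X2 + X3 + (4 * C\<^sub>0 + 1) * X4 + X1
        \<le> (2 * N + 1) * (Q / c2) + Q / c3 + (4 * C\<^sub>0 + 1) * (Q / c4) + Q / c1"
        using q1 q2 q3 q4 C0 law_block by (intro add_mono mult_left_mono) auto
      also have "\<dots> = A * Q" by (simp add: A_def distrib_right add_divide_distrib)
      finally have "profile c t x y \<le> A * Q" using prof by linarith
      hence "1 / A * profile c t x y \<le> Q" using A by (simp add: field_simps)
      thus ?thesis using real by (simp add: ennreal_leI)
    qed simp
  qed
qed

text \<open>
  The five summands of the majorant cover, in this order, \<open>s \<le> T\<close>, then \<open>s \<le> 2 K T\<close>, then the jump and
  the Gaussian part up to \<open>\<Phi> r\<close>, and the times beyond both \<open>2 K T\<close> and \<open>\<Phi> r\<close>.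
\<close>

lemma off_diagonal_upper:
  "\<exists>a>0. \<exists>c>0. \<forall>t>0. \<forall>x\<in>D. \<forall>y\<in>D. 0 < dist x y \<and> T t \<le> \<Phi> (dist x y) \<longrightarrow> q t x y \<le> ennreal (a * profile c t x y)"
proof -
  obtain a1 where a1: "0 < a1" and u1: "\<And>t x y s. 0 < t \<Longrightarrow> x \<in> D \<Longrightarrow> y \<in> D \<Longrightarrow> 0 < dist x y \<Longrightarrow> T t \<le> \<Phi> (dist x y) \<Longrightarrow>
     0 < s \<Longrightarrow> s \<le> T t \<Longrightarrow>
     p s x y \<le> ennreal (a1 * (T t / s) powr \<kappa> * (jump x (dist x y) * (T t * h (T t) x y)
       + h (T t) x y / V x (\<R> (T t)) * gauss k\<^sub>4 (dist x y) (T t)))"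
    using upper_below_T by blast
  obtain a2 c where a2: "0 < a2" and c: "0 < c" "c \<le> k\<^sub>4" and u2: "\<And>t x y s. 0 < t \<Longrightarrow> x \<in> D \<Longrightarrow> y \<in> D \<Longrightarrow> 0 < dist x y \<Longrightarrow>
     T t < s \<Longrightarrow> s \<le> 2 * K * T t \<Longrightarrow>
     p s x y \<le> ennreal (a2 * (jump x (dist x y) * (T t * h (T t) x y)
       + h (T t) x y / V x (\<R> (T t)) * gauss c (dist x y) (T t)))"
    using upper_near_T by blast
  define L where "L = \<beta>\<^sub>2 + 1"
  have L: "0 < L" "\<beta>\<^sub>2 + 1 \<le> L" using pos by (auto simp: L_def)
  obtain a3 where a3: "0 < a3" and u3: "\<And>x y s. x \<in> D \<Longrightarrow> y \<in> D \<Longrightarrow> 0 < dist x y \<Longrightarrow> 0 < s \<Longrightarrow> s \<le> \<Phi> (dist x y) \<Longrightarrow>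
     h s x y * (gauss k\<^sub>4 (dist x y) s / V x (\<R> s))
       \<le> a3 * (s / \<Phi> (dist x y)) powr L * (h (\<Phi> (dist x y)) x y / V x (dist x y))"
    using gaussian_part_upper[OF L(1)] by blast
  obtain m1 where m1: "0 < m1" "\<And>t x. 0 < t \<Longrightarrow> x \<in> D \<Longrightarrow>
      (\<integral>\<^sup>+s. ennreal ((T t / s) powr \<kappa>) * indicator {0<..T t} s \<partial>law x t) \<le> ennreal m1"
    using law_negative_moment by metis
  define g1 where "g1 = a1 * m1 + a2"
  define g2 where "g2 = 2 * k\<^sub>3 * C\<^sub>K"
  define g3 where "g3 = k\<^sub>3 * a3 * (2 * (C\<^sub>K * b\<^sub>2 * 2 powr \<beta>\<^sub>2)) + k\<^sub>3 * C\<^sub>K"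
  have g: "0 < g1" "0 < g2" "0 < g3" unfolding g1_def g2_def g3_def
    using a1 a2 a3 m1 k_pos law_tail pos by (auto intro!: add_pos_pos)
  have gg: "0 < g1 + g2 + g3" using g by simp
  show ?thesis
  proof (rule exI[of _ "g1 + g2 + g3"], rule conjI[OF gg], rule exI[of _ c], rule conjI[OF c(1)], intro allI ballI impI)
    fix t x y assume t: "0 < (t::real)" and xy: "x \<in> D" "y \<in> D" and "0 < dist x y \<and> T t \<le> \<Phi> (dist x y)"
    hence r: "0 < dist x y" "T t \<le> \<Phi> (dist x y)" by auto
    let ?r = "dist x y"
    note [measurable] = H_measurable[OF xy]
    note [measurable_cong] = law_sets[OF xy(1) t]
    interpret Pr: prob_space "law x t" by (rule law_prob[OF xy(1) t])
    define F where "F = \<Phi> ?r"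
    have F0: "0 < F" using r scale.\<Phi>_pos by (simp add: F_def)
    have T0: "0 < T t" using T_pos t .
    have RT: "0 < \<R> (T t)" using scale.ginv_pos T0 .
    have K0: "0 < K" "2 \<le> K" using law_tail by auto
    define s0 where "s0 = 2 * K * T t"
    have s0: "0 < s0" "T t \<le> s0" "K * T t \<le> s0"
      using K0 T0 mult_right_mono[of 1 "2 * K" "T t"] by (auto simp: s0_def)
    define P where "P = jump x ?r"
    have P: "0 \<le> P" unfolding P_def using C0 V\<Psi>_pos[OF r(1), of x] by simp
    have Vr: "0 < V x ?r" using V_pos[OF r(1)] .
    have hF: "0 \<le> h F x y" using h_bounds[OF F0 xy] by simp
    have hT: "0 \<le> h (T t) x y" using h_bounds[OF T0 xy] by simp
    define W where "W = h F x y / V x ?r"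
    have W: "0 \<le> W" using hF Vr by (simp add: W_def)
    define X1 where "X1 = h (T t) x y / V x (\<R> (T t)) * gauss c ?r (T t)"
    define X2 where "X2 = P * (T t * h (T t) x y)"
    define X3 where "X3 = P * (t * J x y (2 * T t) (4 * F))"
    define X4 where "X4 = W * (t * w F)"
    define Z where "Z = X2 + X1"
    have X: "0 \<le> X1" "0 \<le> X2" "0 \<le> X3" "0 \<le> X4" unfolding X1_def X2_def X3_def X4_def
      using P hT hF T0 t w_pos[OF F0] W V_pos[OF RT, of x] J_nn(2)[of "2 * T t" x y] xy by auto
    hence Z: "0 \<le> Z" by (simp add: Z_def)
    let ?E = "\<lambda>s. ennreal (a1 * Z) * (ennreal ((T t / s) powr \<kappa>) * indicator {0<..T t} s)
        + (ennreal (a2 * Z) * indicator {T t<..s0} s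
        + (ennreal (k\<^sub>3 * P) * (ennreal (s * H x y s) * indicator {s0<..F} s)
        + (ennreal (k\<^sub>3 * a3 * W) * (ennreal ((s / F) powr L) * indicator {s0<..F} s)
        + ennreal (k\<^sub>3 * W) * indicator {max F s0..} s)))"
    have "q t x y \<le> (\<integral>\<^sup>+s. ?E s \<partial>law x t)"
      unfolding q_def
    proof (rule nn_integral_mono)
      fix s
      show "p s x y * indicator {0<..} s \<le> ?E s"
      proof (cases "0 < s")
        case s: True
        consider "s \<le> T t" | "T t < s" "s \<le> s0" | "s0 < s" "s \<le> F" | "s0 < s" "F < s" by linarith
        thus ?thesis
        proof cases
          case 1
          have "gauss k\<^sub>4 ?r (T t) \<le> gauss c ?r (T t)"
            using c by (auto intro!: divide_right_mono mult_right_mono)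
          hence "X2 + h (T t) x y / V x (\<R> (T t)) * gauss k\<^sub>4 ?r (T t) \<le> Z"
            unfolding Z_def X1_def using hT V_pos[OF RT, of x] by (intro add_left_mono mult_left_mono) auto
          hence "a1 * (T t / s) powr \<kappa> * (X2 + h (T t) x y / V x (\<R> (T t)) * gauss k\<^sub>4 ?r (T t))
             \<le> a1 * (T t / s) powr \<kappa> * Z" using a1 by (intro mult_left_mono) auto
          moreover have "p s x y \<le> ennreal (a1 * (T t / s) powr \<kappa> * (X2 + h (T t) x y / V x (\<R> (T t)) * gauss k\<^sub>4 ?r (T t)))"
            using u1[OF t xy r s 1] by (simp only: X2_def P_def)
          ultimately have "p s x y \<le> ennreal (a1 * Z * (T t / s) powr \<kappa>)" by (auto intro: order_trans ennreal_leI simp: mult_ac)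
          also have "\<dots> = ennreal (a1 * Z) * (ennreal ((T t / s) powr \<kappa>) * indicator {0<..T t} s)"
            using 1 s a1 Z by (simp add: ennreal_mult')
          also have "\<dots> \<le> ?E s" by simp
          finally show ?thesis using s by simp
        next
          case 2
          have "p s x y \<le> ennreal (a2 * Z)" using u2[OF t xy r(1) 2[unfolded s0_def]] by (simp only: Z_def X1_def X2_def P_def)
          also have "\<dots> = ennreal (a2 * Z) * indicator {T t<..s0} s" using 2 by simp
          also have "\<dots> \<le> ?E s" by (intro add_increasing add_increasing2 order_refl) auto
          finally show ?thesis using s by simp
        next
          case 3
          have "p s x y \<le> ennreal (k\<^sub>3 * h s x y * (C\<^sub>0 * s / (V x ?r * \<Psi> ?r) + gauss k\<^sub>4 ?r s / V x (\<R> s)))"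
            by (rule p_upper_off[OF s xy r(1)])
          also have "\<dots> \<le> ennreal (k\<^sub>3 * P * (s * h s x y) + k\<^sub>3 * a3 * W * (s / F) powr L)"
          proof (rule ennreal_leI)
            have "k\<^sub>3 * h s x y * (C\<^sub>0 * s / (V x ?r * \<Psi> ?r) + gauss k\<^sub>4 ?r s / V x (\<R> s))
               = k\<^sub>3 * P * (s * h s x y) + k\<^sub>3 * (h s x y * (gauss k\<^sub>4 ?r s / V x (\<R> s)))"
              by (simp add: P_def algebra_simps)
            also have "k\<^sub>3 * (h s x y * (gauss k\<^sub>4 ?r s / V x (\<R> s))) \<le> k\<^sub>3 * (a3 * (s / F) powr L * W)"
              unfolding W_def F_def using u3[OF xy r(1) s 3(2)[unfolded F_def]] k_pos by (intro mult_left_mono) auto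
            finally show "k\<^sub>3 * h s x y * (C\<^sub>0 * s / (V x ?r * \<Psi> ?r) + gauss k\<^sub>4 ?r s / V x (\<R> s))
               \<le> k\<^sub>3 * P * (s * h s x y) + k\<^sub>3 * a3 * W * (s / F) powr L" by (simp add: mult_ac)
          qed
          also have "\<dots> = ennreal (k\<^sub>3 * P) * (ennreal (s * H x y s) * indicator {s0<..F} s)
             + ennreal (k\<^sub>3 * a3 * W) * (ennreal ((s / F) powr L) * indicator {s0<..F} s)"
            using 3 s k_pos P a3 W h_bounds[OF s xy] by (simp add: H_def ennreal_mult'[symmetric])
          also have "\<dots> \<le> ennreal (k\<^sub>3 * P) * (ennreal (s * H x y s) * indicator {s0<..F} s)
             + (ennreal (k\<^sub>3 * a3 * W) * (ennreal ((s / F) powr L) * indicator {s0<..F} s) + ennreal (k\<^sub>3 * W) * indicator {max F s0..} s)"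
            by simp
          also have "\<dots> \<le> ?E s" by (intro add_increasing order_refl) auto
          finally show ?thesis using s by simp
        next
          case 4
          have R: "?r \<le> \<R> s" using scale.ginv_lower[of ?r s] 4 by (simp add: F_def)
          have "h s x y / V x (\<R> s) \<le> W" unfolding W_def
            using h_antimono[OF F0 _ xy, of s] 4 V_mono[OF R, of x] Vr hF by (intro frac_le) auto
          hence "k\<^sub>3 * (h s x y / V x (\<R> s)) \<le> k\<^sub>3 * W" using k_pos by (intro mult_left_mono) auto
          hence "p s x y \<le> ennreal (k\<^sub>3 * W)" using p_upper[OF s xy] by (auto intro: order_trans ennreal_leI)
          also have "\<dots> = ennreal (k\<^sub>3 * W) * indicator {max F s0..} s" using 4 by simp
          also have "\<dots> \<le> ?E s" by (intro add_increasing order_refl) auto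
          finally show ?thesis using s by simp
        qed
      qed simp
    qed
    also have "\<dots> = ennreal (a1 * Z) * (\<integral>\<^sup>+s. ennreal ((T t / s) powr \<kappa>) * indicator {0<..T t} s \<partial>law x t)
        + (ennreal (a2 * Z) * emeasure (law x t) {T t<..s0}
        + (ennreal (k\<^sub>3 * P) * (\<integral>\<^sup>+s. ennreal (s * H x y s) * indicator {s0<..F} s \<partial>law x t)
        + (ennreal (k\<^sub>3 * a3 * W) * (\<integral>\<^sup>+s. ennreal ((s / F) powr L) * indicator {s0<..F} s \<partial>law x t)
        + ennreal (k\<^sub>3 * W) * emeasure (law x t) {max F s0..})))"
      by (simp add: nn_integral_add nn_integral_cmult nn_integral_cmult_indicator)
    also have "\<dots> \<le> ennreal (a1 * Z) * ennreal m1 + (ennreal (a2 * Z) * 1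
        + (ennreal (k\<^sub>3 * P) * ennreal (2 * C\<^sub>K * (t * J x y (2 * T t) (4 * F)))
        + (ennreal (k\<^sub>3 * a3 * W) * ennreal (2 * ((C\<^sub>K * t) * b\<^sub>2 * 2 powr \<beta>\<^sub>2 * w F))
        + ennreal (k\<^sub>3 * W) * ennreal (C\<^sub>K * (t * w F)))))"
    proof (intro add_mono mult_left_mono)
      show "(\<integral>\<^sup>+s. ennreal ((T t / s) powr \<kappa>) * indicator {0<..T t} s \<partial>law x t) \<le> ennreal m1" by (rule m1(2)[OF t xy(1)])
      show "emeasure (law x t) {T t<..s0} \<le> 1" by (rule Pr.emeasure_le_1)
      have "(\<integral>\<^sup>+s. ennreal (s * H x y s) * indicator {s0<..F} s \<partial>law x t) \<le> ennreal (2 * C\<^sub>K * (t * J x y (K * T t) F))"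
        unfolding s0_def by (rule truncated_mean_upper[OF t xy])
      also have "\<dots> \<le> ennreal (2 * C\<^sub>K * (t * J x y (2 * T t) (4 * F)))"
        using law_tail(2) t T0 K0 F0 xy by (intro ennreal_leI mult_left_mono J_mono) auto
      finally show "(\<integral>\<^sup>+s. ennreal (s * H x y s) * indicator {s0<..F} s \<partial>law x t) \<le> ennreal (2 * C\<^sub>K * (t * J x y (2 * T t) (4 * F)))" .
      have tail: "emeasure (law x t) {u..} \<le> ennreal (C\<^sub>K * (t * w u))" if "s0 \<le> u" for u
        unfolding Pr.emeasure_eq_measure using that s0 by (intro ennreal_leI law_tail xy t) auto
      show "(\<integral>\<^sup>+s. ennreal ((s / F) powr L) * indicator {s0<..F} s \<partial>law x t) \<le> ennreal (2 * ((C\<^sub>K * t) * b\<^sub>2 * 2 powr \<beta>\<^sub>2 * w F))"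
        using tail law_tail(2) t by (intro truncated_moment L law_sets xy F0 s0) (auto simp: mult.assoc)
      have "w (max F s0) \<le> w F" using F0 by (intro w_antimono) auto
      hence "ennreal (C\<^sub>K * (t * w (max F s0))) \<le> ennreal (C\<^sub>K * (t * w F))"
        using law_tail(2) t by (intro ennreal_leI mult_left_mono) auto
      thus "emeasure (law x t) {max F s0..} \<le> ennreal (C\<^sub>K * (t * w F))" using tail[of "max F s0"] by (auto intro: order_trans)
    qed auto
    also have "\<dots> = ennreal (g1 * Z + g2 * X3 + g3 * X4)"
    proof -
      have "0 \<le> t * J x y (2 * T t) (4 * F)" using J_nn(2)[of "2 * T t" x y] T0 xy t by simp
      moreover have "0 \<le> t * w F" using t w_pos[OF F0] by simp
      ultimately have "ennreal (a1 * Z) * ennreal m1 + (ennreal (a2 * Z) * 1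
        + (ennreal (k\<^sub>3 * P) * ennreal (2 * C\<^sub>K * (t * J x y (2 * T t) (4 * F)))
        + (ennreal (k\<^sub>3 * a3 * W) * ennreal (2 * ((C\<^sub>K * t) * b\<^sub>2 * 2 powr \<beta>\<^sub>2 * w F))
        + ennreal (k\<^sub>3 * W) * ennreal (C\<^sub>K * (t * w F)))))
        = ennreal (a1 * Z * m1 + (a2 * Z + (k\<^sub>3 * P * (2 * C\<^sub>K * (t * J x y (2 * T t) (4 * F)))
        + (k\<^sub>3 * a3 * W * (2 * ((C\<^sub>K * t) * b\<^sub>2 * 2 powr \<beta>\<^sub>2 * w F)) + k\<^sub>3 * W * (C\<^sub>K * (t * w F))))))"
        using a1 a2 a3 m1(1) k_pos P W Z law_tail(2) pos t w_pos[OF F0]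
        by (simp add: ennreal_mult'[symmetric] ennreal_plus[symmetric] del: ennreal_plus)
      also have "a1 * Z * m1 + (a2 * Z + (k\<^sub>3 * P * (2 * C\<^sub>K * (t * J x y (2 * T t) (4 * F)))
        + (k\<^sub>3 * a3 * W * (2 * ((C\<^sub>K * t) * b\<^sub>2 * 2 powr \<beta>\<^sub>2 * w F)) + k\<^sub>3 * W * (C\<^sub>K * (t * w F))))) = g1 * Z + g2 * X3 + g3 * X4"
        by (simp add: g1_def g2_def g3_def X3_def X4_def algebra_simps)
      finally show ?thesis .
    qed
    also have "\<dots> \<le> ennreal ((g1 + g2 + g3) * profile c t x y)"
    proof (rule ennreal_leI)
      have pr: "profile c t x y = X3 + X2 + X1 + X4"
        by (simp add: profile_def P_def X2_def X1_def X3_def X4_def W_def F_def distrib_left)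
      have "g1 * Z + g2 * X3 + g3 * X4 \<le> g1 * (X3 + X2 + X1 + X4) + g2 * (X3 + X2 + X1 + X4) + g3 * (X3 + X2 + X1 + X4)"
        using X g by (intro add_mono mult_left_mono) (auto simp: Z_def)
      thus "g1 * Z + g2 * X3 + g3 * X4 \<le> (g1 + g2 + g3) * profile c t x y" unfolding pr by (simp only: distrib_right)
    qed
    finally show "q t x y \<le> ennreal ((g1 + g2 + g3) * profile c t x y)" .
  qed
qed

end

section \<open>The estimates for subordinate processes\<close>

lemma power_scaling_iff:
  "power_scaling f \<longleftrightarrow> (\<exists>a\<^sub>1 a\<^sub>2 c\<^sub>1 c\<^sub>2. 0 < a\<^sub>1 \<and> 0 < a\<^sub>2 \<and> 0 < c\<^sub>1 \<and> 0 < c\<^sub>2 \<and> (\<forall>r R. 0 < r \<and> r \<le> R \<longrightarrow>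
     c\<^sub>1 * (R / r) powr a\<^sub>1 \<le> f R / f r \<and> f R / f r \<le> c\<^sub>2 * (R / r) powr a\<^sub>2))"
  unfolding power_scaling_def by blast

lemma vol_mono:
  fixes m :: "'e::{heine_borel, second_countable_topology} measure"
  assumes "radon_full_support m" "r \<le> R" shows "vol m x r \<le> vol m x R"
proof -
  have sets: "sets m = sets borel" using assms by (simp add: radon_full_support_def)
  have "emeasure m (ball x R) \<le> emeasure m (cball x R)" using sets by (intro emeasure_mono) auto
  also have "\<dots> < \<infinity>" using assms compact_cball[of x R] by (auto simp: radon_full_support_def)
  finally have "emeasure m (ball x R) < \<infinity>" .
  thus ?thesis unfolding vol_def using assms(2) sets
    by (intro measure_mono_fmeasurable) (auto simp: fmeasurable_def)
qed

lemma volume_growth_infinite: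
  assumes "volume_growth m \<infinity> d\<^sub>1 d\<^sub>2"
  shows "\<exists>C. 1 \<le> C \<and> (\<forall>x r. 0 < r \<longrightarrow> 0 < vol m x r) \<and>
    (\<forall>x r R. 0 < r \<and> r \<le> R \<longrightarrow> vol m x R \<le> C * (R / r) powr d\<^sub>2 * vol m x r)"
proof -
  obtain C where C: "1 \<le> C" "\<And>x r R. 0 < r \<Longrightarrow> r \<le> R \<Longrightarrow> inverse C * (R / r) powr d\<^sub>1 \<le> vol m x R / vol m x r \<and>
        vol m x R / vol m x r \<le> C * (R / r) powr d\<^sub>2"
  proof -
    have "\<exists>C\<ge>1. \<forall>x r R. 0 < r \<and> r \<le> R \<and> ereal R < ereal 1 * \<infinity> \<longrightarrow>
        inverse C * (R / r) powr d\<^sub>1 \<le> vol m x R / vol m x r \<and>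
        vol m x R / vol m x r \<le> C * (R / r) powr d\<^sub>2"
      using assms unfolding volume_growth_def by (metis order_refl)
    thus ?thesis using that by auto
  qed
  have p: "0 < vol m x r" if "0 < r" for x r
  proof -
    have "inverse C \<le> vol m x r / vol m x r" using C(2)[of r r x] that by simp
    hence "vol m x r \<noteq> 0" using C(1) by (auto simp: not_le)
    thus ?thesis by (simp add: vol_def less_le)
  qed
  show ?thesis
  proof (intro exI[of _ C] conjI allI impI C(1) p)
    fix x r R assume "0 < r \<and> r \<le> (R :: real)"
    hence r: "0 < r" "r \<le> R" by auto
    show "vol m x R \<le> C * (R / r) powr d\<^sub>2 * vol m x r" using C(2)[OF r, of x] p[OF r(1), of x] by (simp add: pos_divide_le_eq)
  qed
qed

text \<open>
  Positive denominators turn the quotients in the profile into real ones.  The first and the third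
  bound do not mention the jump term and so hold on the diagonal as well; the fourth holds where the
  jump term is not cut off by the minimum.
\<close>

lemma hk_profile_bounds:
  assumes v: "0 < vol m x (ginv \<Phi> t)" and C0: "0 \<le> C\<^sub>0" and t: "0 < t"
  shows "hk_profile m \<Phi> \<Psi> C\<^sub>0 c t x y \<le> ennreal (1 / vol m x (ginv \<Phi> t))"
    and "0 < vol m x (dist x y) * \<Psi> (dist x y) \<Longrightarrow> hk_profile m \<Phi> \<Psi> C\<^sub>0 c t x y \<le>
      ennreal (C\<^sub>0 * t / (vol m x (dist x y) * \<Psi> (dist x y)) + exp (- c * (dist x y)\<^sup>2 / (ginv \<Phi> t)\<^sup>2) / vol m x (ginv \<Phi> t))"
    and "0 < c \<Longrightarrow> ennreal (exp (- c * (dist x y)\<^sup>2 / (ginv \<Phi> t)\<^sup>2) / vol m x (ginv \<Phi> t)) \<le> hk_profile m \<Phi> \<Psi> C\<^sub>0 c t x y"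
    and "0 < vol m x (dist x y) * \<Psi> (dist x y) \<Longrightarrow>
      C\<^sub>0 * t / (vol m x (dist x y) * \<Psi> (dist x y)) \<le> 1 / vol m x (ginv \<Phi> t) \<Longrightarrow>
      ennreal (C\<^sub>0 * t / (vol m x (dist x y) * \<Psi> (dist x y))) \<le> hk_profile m \<Phi> \<Psi> C\<^sub>0 c t x y"
proof -
  let ?r = "dist x y" and ?v = "vol m x (ginv \<Phi> t)"
  let ?E = "exp (- c * ?r\<^sup>2 / (ginv \<Phi> t)\<^sup>2)"
  have one: "1 / ennreal ?v = ennreal (1 / ?v)" using v divide_ennreal[of 1 ?v] by simp
  have two: "1 / ennreal ?v * ennreal ?E = ennreal (?E / ?v)"
    unfolding one using v by (simp add: ennreal_mult'[symmetric])
  show "hk_profile m \<Phi> \<Psi> C\<^sub>0 c t x y \<le> ennreal (1 / ?v)" by (simp add: hk_profile_def one)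
  show "ennreal (?E / ?v) \<le> hk_profile m \<Phi> \<Psi> C\<^sub>0 c t x y" if "0 < c"
  proof -
    have "?E \<le> 1" using that by simp
    hence "?E / ?v \<le> 1 / ?v" using v by (intro divide_right_mono) auto
    hence "ennreal (?E / ?v) \<le> ennreal (1 / ?v)" by (rule ennreal_leI)
    thus ?thesis unfolding hk_profile_def unfolding two unfolding one by (simp add: add_increasing)
  qed
  assume w: "0 < vol m x ?r * \<Psi> ?r"
  have three: "ennreal (C\<^sub>0 * t) / ennreal (vol m x ?r * \<Psi> ?r) = ennreal (C\<^sub>0 * t / (vol m x ?r * \<Psi> ?r))"
    using w C0 t by (intro divide_ennreal) auto
  have pos: "0 \<le> C\<^sub>0 * t / (vol m x ?r * \<Psi> ?r)" using w C0 t by (intro divide_nonneg_pos) auto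
  show "hk_profile m \<Phi> \<Psi> C\<^sub>0 c t x y \<le> ennreal (C\<^sub>0 * t / (vol m x ?r * \<Psi> ?r) + ?E / ?v)"
    unfolding hk_profile_def unfolding two unfolding three using pos v by (simp add: ennreal_plus[symmetric] del: ennreal_plus)
  assume le: "C\<^sub>0 * t / (vol m x ?r * \<Psi> ?r) \<le> 1 / ?v"
  show "ennreal (C\<^sub>0 * t / (vol m x ?r * \<Psi> ?r)) \<le> hk_profile m \<Phi> \<Psi> C\<^sub>0 c t x y"
    unfolding hk_profile_def unfolding two unfolding three one using le by (simp add: add_increasing2 ennreal_leI)
qed

lemma measure_distr_borel:
  assumes "X \<in> borel_measurable M" "A \<in> sets borel"
  shows "measure (distr M borel X) A = measure M {\<omega>\<in>space M. X \<omega> \<in> A}"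
  using assms by (simp add: measure_distr vimage_def Int_def conj_commute)

context poly_levy
begin

lemma sub_scale_pos: "0 < r \<Longrightarrow> sub_scale \<phi> \<Phi> r = 1 / \<phi> (1 / \<Phi> r)"
  by (simp add: sub_scale_def)

text \<open>
  Through the strict monotonicity of \<open>\<phi>\<close>, every comparison of \<open>t\<close> with \<open>\<psi> r\<close> becomes one of \<open>T t\<close> with
  \<open>\<Phi> r\<close>; in particular the generalised inverse of \<open>\<psi>\<close> at \<open>t\<close> is that of \<open>\<Phi>\<close> at \<open>T t\<close>.
\<close>

lemma less_sub_scale_iff:
  assumes t: "0 < t" and r: "0 < r" and F: "0 < \<Phi> r"
  shows "t < sub_scale \<phi> \<Phi> r \<longleftrightarrow> T t < \<Phi> r" and "t \<le> sub_scale \<phi> \<Phi> r \<longleftrightarrow> T t \<le> \<Phi> r"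
proof -
  have T0: "0 < T t" using T_pos[OF t] .
  have f: "0 < \<phi> (1 / \<Phi> r)" using F by (intro \<phi>_pos) simp
  have iff: "\<phi> x < \<phi> y \<longleftrightarrow> x < y" if "0 \<le> x" "0 \<le> y" for x y
    using \<phi>_less[of x y] \<phi>_mono[of y x] that by (cases "x < y") auto
  have iff1: "\<phi> (1 / \<Phi> r) < \<phi> (1 / T t) \<longleftrightarrow> 1 / \<Phi> r < 1 / T t"
    and iff2: "\<phi> (1 / T t) < \<phi> (1 / \<Phi> r) \<longleftrightarrow> 1 / T t < 1 / \<Phi> r"
    using F T0 by (intro iff; simp)+
  have "t < sub_scale \<phi> \<Phi> r \<longleftrightarrow> \<phi> (1 / \<Phi> r) < 1 / t"
    unfolding sub_scale_pos[OF r] using f t by (simp add: field_simps)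
  also have "\<dots> \<longleftrightarrow> \<phi> (1 / \<Phi> r) < \<phi> (1 / T t)" using \<phi>_T[OF t] by simp
  also have "\<dots> \<longleftrightarrow> 1 / \<Phi> r < 1 / T t"
    by (rule iff1)
  also have "\<dots> \<longleftrightarrow> T t < \<Phi> r" using F T0 by (simp add: field_simps)
  finally show "t < sub_scale \<phi> \<Phi> r \<longleftrightarrow> T t < \<Phi> r" .
  have "t \<le> sub_scale \<phi> \<Phi> r \<longleftrightarrow> \<not> (1 / t < \<phi> (1 / \<Phi> r))"
    unfolding sub_scale_pos[OF r] using f t by (auto simp: field_simps not_less)
  also have "\<dots> \<longleftrightarrow> \<not> (\<phi> (1 / T t) < \<phi> (1 / \<Phi> r))" using \<phi>_T[OF t] by simp
  also have "\<dots> \<longleftrightarrow> \<not> (1 / T t < 1 / \<Phi> r)"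
    by (simp only: iff2)
  also have "\<dots> \<longleftrightarrow> T t \<le> \<Phi> r" using F T0 by (auto simp: field_simps not_less)
  finally show "t \<le> sub_scale \<phi> \<Phi> r \<longleftrightarrow> T t \<le> \<Phi> r" .
qed

end

theorem theorem4p3:
  fixes m :: "'e::{heine_borel, second_countable_topology} measure"
    and R\<^sub>E :: ereal and d\<^sub>1 d\<^sub>2 :: real
    and D :: "'e set"
    and P :: "'e option \<Rightarrow> 'w measure"
    and Y :: "ennreal \<Rightarrow> 'w \<Rightarrow> 'e option"
    and S :: "real \<Rightarrow> 'w \<Rightarrow> real"
    and \<nu> :: "real measure"
    and p :: "real \<Rightarrow> 'e \<Rightarrow> 'e \<Rightarrow> ennreal"
    and \<Phi> \<Psi> :: "real \<Rightarrow> real"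
    and h :: "real \<Rightarrow> 'e \<Rightarrow> 'e \<Rightarrow> real"
    and C\<^sub>0 :: real
  defines "\<phi> \<equiv> laplace_exponent \<nu>"
    and "w \<equiv> levy_tail \<nu>"
    and "V \<equiv> vol m"
  defines "\<psi> \<equiv> sub_scale \<phi> \<Phi>"
    and "T \<equiv> \<lambda>t. 1 / ginv \<phi> (1 / t)"
    and "q \<equiv> subordinate_heat_kernel P S p"
  defines "B \<equiv> \<lambda>t x y. LBINT s:{2 * T t..4 * \<Phi> (dist x y)}. h s x y * w s"
  assumes "radon_full_support m"
    and "volume_growth m R\<^sub>E d\<^sub>1 d\<^sub>2"
    and "open D" and "D \<noteq> UNIV"
    and "hunt_process D P Y"
    and "heat_kernel m D P Y p"
    and "\<forall>x\<in>topspace (cemetery_space D). driftless_subordinator (P x) S \<nu>"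
    and "\<forall>x\<in>topspace (cemetery_space D). independent_of_subordinator D (P x) Y S"
    and "scale_functions \<Phi> \<Psi>"
    and "boundary_function D \<Phi> h"
    and "Poly_infinity w"
    and "HK_U m R\<^sub>E D \<Phi> \<Psi> h C\<^sub>0 p"
  shows
    "(\<exists>a\<^sub>1>0. \<exists>a\<^sub>2>0. \<forall>t>0. \<forall>x\<in>D. \<forall>y\<in>D. \<psi> (dist x y) \<le> t \<longrightarrow>
        ennreal (a\<^sub>1 * (h (T t) x y / V x (ginv \<psi> t))) \<le> q t x y \<and>
        (below_diam D \<Phi> (T t) \<longrightarrow>
          q t x y \<le> ennreal (a\<^sub>2 * (h (T t) x y / V x (ginv \<psi> t)))))
     \<and>
     (\<exists>a\<^sub>1>0. \<exists>a\<^sub>2>0. \<exists>a\<^sub>3>0. \<exists>a\<^sub>4>0. \<forall>t>0. \<forall>x\<in>D. \<forall>y\<in>D. \<psi> (dist x y) \<ge> t \<longrightarrow>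
        (let r = dist x y;
             rhs = (\<lambda>c. C\<^sub>0 / (V x r * \<Psi> r) * (t * B t x y + h (T t) x y / ginv \<phi> (1 / t))
                       + h (T t) x y / V x (ginv \<psi> t) * exp (- c * r\<^sup>2 / (ginv \<psi> t)\<^sup>2)
                       + h (\<Phi> r) x y * (t * w (\<Phi> r) / V x r))
         in ennreal (a\<^sub>1 * rhs a\<^sub>2) \<le> q t x y \<and> q t x y \<le> ennreal (a\<^sub>3 * rhs a\<^sub>4)))"
proof -
  have scale: "scale_functions \<Phi> \<Psi>" by fact
  obtain \<alpha>\<^sub>1 \<alpha>\<^sub>2 a\<^sub>1 a\<^sub>2 where \<Phi>: "scale_function \<Phi> \<alpha>\<^sub>1 \<alpha>\<^sub>2 a\<^sub>1 a\<^sub>2"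
  proof -
    have "power_scaling \<Phi>" using scale by (simp add: scale_functions_def)
    then obtain \<alpha>\<^sub>1 \<alpha>\<^sub>2 a\<^sub>1 a\<^sub>2 where "0 < \<alpha>\<^sub>1" "0 < \<alpha>\<^sub>2" "0 < a\<^sub>1" "0 < a\<^sub>2" "\<forall>r R. 0 < r \<and> r \<le> R \<longrightarrow>
       a\<^sub>1 * (R / r) powr \<alpha>\<^sub>1 \<le> \<Phi> R / \<Phi> r \<and> \<Phi> R / \<Phi> r \<le> a\<^sub>2 * (R / r) powr \<alpha>\<^sub>2"
      unfolding power_scaling_iff by blast
    hence "scale_function \<Phi> \<alpha>\<^sub>1 \<alpha>\<^sub>2 a\<^sub>1 a\<^sub>2"
      using scale by unfold_locales (auto simp: scale_functions_def)
    thus ?thesis by (rule that)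
  qed
  interpret scale: scale_function \<Phi> \<alpha>\<^sub>1 \<alpha>\<^sub>2 a\<^sub>1 a\<^sub>2 by (rule \<Phi>)
  have top: "Some x \<in> topspace (cemetery_space D)" if "x \<in> D" for x
    using that by (simp add: cemetery_space_def)
  have "None \<in> topspace (cemetery_space D)" by (simp add: cemetery_space_def)
  hence "levy_measure \<nu>" using assms(14) by (auto simp: driftless_subordinator_def)
  moreover obtain b\<^sub>1 b\<^sub>2 \<beta>\<^sub>1 \<beta>\<^sub>2 where "0 < b\<^sub>1" "0 < b\<^sub>2" "0 < \<beta>\<^sub>1" "\<beta>\<^sub>1 \<le> \<beta>\<^sub>2" "\<forall>r R. 0 < r \<and> r \<le> R \<longrightarrow>
        b\<^sub>1 * (R / r) powr \<beta>\<^sub>1 \<le> w r / w R \<and> w r / w R \<le> b\<^sub>2 * (R / r) powr \<beta>\<^sub>2"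
    using \<open>Poly_infinity w\<close> unfolding Poly_infinity_def by blast
  ultimately have pl: "poly_levy \<nu> b\<^sub>1 b\<^sub>2 \<beta>\<^sub>1 \<beta>\<^sub>2" by unfold_locales (auto simp: w_def)
  interpret pl: poly_levy \<nu> b\<^sub>1 b\<^sub>2 \<beta>\<^sub>1 \<beta>\<^sub>2 by (rule pl)
  have T_eq: "T = pl.T" by (simp add: T_def pl.T_def[abs_def] \<phi>_def)
  have RE: "R\<^sub>E = \<infinity>" and C0: "0 \<le> C\<^sub>0" using \<open>HK_U m R\<^sub>E D \<Phi> \<Psi> h C\<^sub>0 p\<close> by (auto simp: HK_U_def)
  have d2: "0 < d\<^sub>2" using assms(9) by (auto simp: volume_growth_def)
  obtain C\<^sub>V where CV0: "1 \<le> C\<^sub>V" "\<forall>x r. 0 < r \<longrightarrow> 0 < V x r"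
    "\<forall>x r R. 0 < r \<and> r \<le> R \<longrightarrow> V x R \<le> C\<^sub>V * (R / r) powr d\<^sub>2 * V x r"
    using volume_growth_infinite[OF assms(9)[unfolded RE], folded V_def] by (elim exE conjE) (rule that)
  have CV: "1 \<le> C\<^sub>V" "\<And>x r. 0 < r \<Longrightarrow> 0 < V x r"
    "\<And>x r R. 0 < r \<Longrightarrow> r \<le> R \<Longrightarrow> V x R \<le> C\<^sub>V * (R / r) powr d\<^sub>2 * V x r"
    using CV0 by simp_all
  have "\<exists>c>0. \<exists>\<gamma>\<ge>0. \<forall>s t. 0 < s \<and> s \<le> t \<and> below_diam D \<Phi> t \<longrightarrow>
        (\<forall>x\<in>D. \<forall>y\<in>D. s powr \<gamma> * h s x y \<le> c * t powr \<gamma> * h t x y)"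
    using \<open>boundary_function D \<Phi> h\<close> by (simp only: boundary_function_def)
  then obtain C\<^sub>h \<gamma> where h0: "0 < C\<^sub>h" "0 \<le> \<gamma>" "\<forall>s t. 0 < s \<and> s \<le> t \<and> below_diam D \<Phi> t \<longrightarrow>
        (\<forall>x\<in>D. \<forall>y\<in>D. s powr \<gamma> * h s x y \<le> C\<^sub>h * t powr \<gamma> * h t x y)"
    by (elim exE conjE) (rule that)
  have h: "0 < C\<^sub>h" "0 \<le> \<gamma>" "\<And>s u x y. 0 < s \<Longrightarrow> s \<le> u \<Longrightarrow> below_diam D \<Phi> u \<Longrightarrow> x \<in> D \<Longrightarrow> y \<in> D \<Longrightarrow>
      s powr \<gamma> * h s x y \<le> C\<^sub>h * u powr \<gamma> * h u x y"
    using h0 by simp_all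
  have h01: "0 \<le> h s x y \<and> h s x y \<le> 1" if "0 < s" "x \<in> D" "y \<in> D" for s x y
    using \<open>boundary_function D \<Phi> h\<close> that by (simp add: boundary_function_def)
  have hanti: "h u x y \<le> h s x y" if "0 < s" "s \<le> u" "x \<in> D" "y \<in> D" for s u x y
  proof -
    have "antimono_on {0<..} (\<lambda>s. h s x y)" using \<open>boundary_function D \<Phi> h\<close> that by (simp add: boundary_function_def)
    from monotone_onD[OF this, of s u] show ?thesis using that by simp
  qed
  have "\<exists>c\<^sub>1>0. \<exists>c\<^sub>2>0. \<exists>c\<^sub>3>0. \<exists>c\<^sub>4>0. \<forall>t>0. \<forall>x\<in>D. \<forall>y\<in>D.
        ennreal (c\<^sub>1 * h t x y) * hk_profile m \<Phi> \<Psi> C\<^sub>0 c\<^sub>2 t x y \<le> p t x y \<and>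
        p t x y \<le> ennreal (c\<^sub>3 * h t x y) * hk_profile m \<Phi> \<Psi> C\<^sub>0 c\<^sub>4 t x y"
    using \<open>HK_U m R\<^sub>E D \<Phi> \<Psi> h C\<^sub>0 p\<close> by (simp only: HK_U_def)
  then obtain k\<^sub>1 k\<^sub>2 k\<^sub>3 k\<^sub>4 where k: "0 < k\<^sub>1" "0 < k\<^sub>2" "0 < k\<^sub>3" "0 < k\<^sub>4"
    and hk0: "\<forall>t>0. \<forall>x\<in>D. \<forall>y\<in>D.
        ennreal (k\<^sub>1 * h t x y) * hk_profile m \<Phi> \<Psi> C\<^sub>0 k\<^sub>2 t x y \<le> p t x y \<and>
        p t x y \<le> ennreal (k\<^sub>3 * h t x y) * hk_profile m \<Phi> \<Psi> C\<^sub>0 k\<^sub>4 t x y"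
    by (elim exE conjE) (rule that)
  have hk: "ennreal (k\<^sub>1 * h t x y) * hk_profile m \<Phi> \<Psi> C\<^sub>0 k\<^sub>2 t x y \<le> p t x y \<and>
        p t x y \<le> ennreal (k\<^sub>3 * h t x y) * hk_profile m \<Phi> \<Psi> C\<^sub>0 k\<^sub>4 t x y"
    if "0 < t" "x \<in> D" "y \<in> D" for t x y
    using hk0 that by simp
  have \<Psi>: "\<Phi> r \<le> \<Psi> r" if "0 \<le> r" for r using scale that by (simp add: scale_functions_def)
  have V\<Psi>: "0 < V x r * \<Psi> r" if "0 < r" for x r
    using CV(2)[OF that, of x] \<Psi>[of r] scale.\<Phi>_pos[OF that] that by simp
  have Vg: "0 < vol m x (ginv \<Phi> s)" if "0 < s" for x s
    using CV(2)[OF scale.ginv_pos[OF that], of x] by (simp add: V_def)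
  have p1: "p s x y \<le> ennreal (k\<^sub>3 * h s x y / V x (ginv \<Phi> s))" if s: "0 < s" and xy: "x \<in> D" "y \<in> D" for s x y
  proof -
    have "p s x y \<le> ennreal (k\<^sub>3 * h s x y) * ennreal (1 / V x (ginv \<Phi> s))"
      unfolding V_def
      by (rule order_trans[OF conjunct2[OF hk[OF s xy]] mult_left_mono[OF hk_profile_bounds(1)[OF Vg[OF s] C0 s] zero_le]])
    thus ?thesis using k h01[OF s xy] by (simp add: ennreal_mult'[symmetric])
  qed
  have p2: "p s x y \<le> ennreal (k\<^sub>3 * h s x y * (C\<^sub>0 * s / (V x (dist x y) * \<Psi> (dist x y))
        + exp (- k\<^sub>4 * (dist x y)\<^sup>2 / (ginv \<Phi> s)\<^sup>2) / V x (ginv \<Phi> s)))"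
    if s: "0 < s" and xy: "x \<in> D" "y \<in> D" and r: "0 < dist x y" for s x y
  proof -
    have "p s x y \<le> ennreal (k\<^sub>3 * h s x y) * ennreal (C\<^sub>0 * s / (V x (dist x y) * \<Psi> (dist x y))
        + exp (- k\<^sub>4 * (dist x y)\<^sup>2 / (ginv \<Phi> s)\<^sup>2) / V x (ginv \<Phi> s))"
      unfolding V_def
      by (rule order_trans[OF conjunct2[OF hk[OF s xy]]
        mult_left_mono[OF hk_profile_bounds(2)[where \<Psi> = \<Psi> and x = x and y = y, OF Vg[OF s] C0 s V\<Psi>[OF r, unfolded V_def]] zero_le]])
    thus ?thesis using k h01[OF s xy] by (simp add: ennreal_mult'[symmetric])
  qed
  have p3: "ennreal (k\<^sub>1 * h s x y * (exp (- k\<^sub>2 * (dist x y)\<^sup>2 / (ginv \<Phi> s)\<^sup>2) / V x (ginv \<Phi> s))) \<le> p s x y"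
    if s: "0 < s" and xy: "x \<in> D" "y \<in> D" for s x y
  proof -
    have "ennreal (k\<^sub>1 * h s x y) * ennreal (exp (- k\<^sub>2 * (dist x y)\<^sup>2 / (ginv \<Phi> s)\<^sup>2) / V x (ginv \<Phi> s)) \<le> p s x y"
      unfolding V_def
      by (rule order_trans[OF mult_left_mono[OF hk_profile_bounds(3)[OF Vg[OF s] C0 s k(2)] zero_le] conjunct1[OF hk[OF s xy]]])
    thus ?thesis using k h01[OF s xy] by (simp add: ennreal_mult'[symmetric])
  qed
  have p4: "ennreal (k\<^sub>1 * h s x y * (C\<^sub>0 * s / (V x (dist x y) * \<Psi> (dist x y)))) \<le> p s x y"
    if s: "0 < s" and xy: "x \<in> D" "y \<in> D" and r: "0 < dist x y" and sr: "s \<le> \<Phi> (dist x y)" for s x y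
  proof -
    let ?r = "dist x y"
    have "C\<^sub>0 * s / (V x ?r * \<Psi> ?r) \<le> 1 / V x (ginv \<Phi> s)"
    proof -
      have "C\<^sub>0 \<le> 1" using \<open>HK_U m R\<^sub>E D \<Phi> \<Psi> h C\<^sub>0 p\<close> by (auto simp: HK_U_def)
      hence "C\<^sub>0 * s \<le> 1 * \<Psi> ?r" using s sr \<Psi>[of ?r] by (intro mult_mono) auto
      hence "C\<^sub>0 * s / (V x ?r * \<Psi> ?r) \<le> \<Psi> ?r / (V x ?r * \<Psi> ?r)"
        using V\<Psi>[OF r, of x] by (intro divide_right_mono) auto
      also have "\<dots> = 1 / V x ?r" using V\<Psi>[OF r, of x] by auto
      also have "\<dots> \<le> 1 / V x (ginv \<Phi> s)"
        using vol_mono[OF assms(8) scale.ginv_upper[of ?r s], of x] sr Vg[OF s, of x] CV(2)[OF r, of x]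
        by (intro divide_left_mono) (auto simp: V_def)
      finally show ?thesis .
    qed
    from hk_profile_bounds(4)[where \<Psi> = \<Psi> and x = x and y = y, OF Vg[OF s] C0 s V\<Psi>[OF r, unfolded V_def] this[unfolded V_def]]
    have "ennreal (k\<^sub>1 * h s x y) * ennreal (C\<^sub>0 * s / (V x ?r * \<Psi> ?r)) \<le> p s x y"
      unfolding V_def by (rule order_trans[OF mult_left_mono[OF _ zero_le] conjunct1[OF hk[OF s xy]]])
    thus ?thesis using k h01[OF s xy] by (simp add: ennreal_mult'[symmetric])
  qed
  have sub: "driftless_subordinator (P (Some x)) S \<nu>" if "x \<in> D" for x
    using assms(14) top[OF that] by blast
  define law where "law x t = distr (P (Some x)) borel (S t)" for x t
  have S: "S t \<in> borel_measurable (P (Some x))" if "x \<in> D" "0 < t" for x t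
    using sub[OF that(1)] that by (simp add: driftless_subordinator_def)
  have law: "measure (law x t) A = measure (P (Some x)) {\<omega>\<in>space (P (Some x)). S t \<omega> \<in> A}"
    if "x \<in> D" "0 < t" "A \<in> sets borel" for x t A
    unfolding law_def using S that by (intro measure_distr_borel) auto
  obtain e c\<^sub>e where e: "0 < e" "e \<le> 1" "0 < c\<^sub>e" "\<And>(M :: 'w measure) S t. driftless_subordinator M S \<nu> \<Longrightarrow> 0 < t \<Longrightarrow>
     c\<^sub>e \<le> measure M {\<omega>\<in>space M. e * pl.T t < S t \<omega> \<and> S t \<omega> \<le> pl.T t}"
    using pl.prob_between by blast
  obtain K0 C\<^sub>K where K0: "1 \<le> K0" "0 < C\<^sub>K" "\<And>(M :: 'w measure) S t r. driftless_subordinator M S \<nu> \<Longrightarrow> 0 < t \<Longrightarrow>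
     K0 * pl.T t \<le> r \<Longrightarrow> measure M {\<omega>\<in>space M. r \<le> S t \<omega>} \<le> C\<^sub>K * (t * levy_tail \<nu> r)"
    using pl.tail_upper_bound by blast
  \<comment> \<open>With \<open>K \<ge> 2\<close>, the times above \<open>K T\<close> lie in the range of integration of \<open>\<B>\<^sub>h\<close>.\<close>
  define K where "K = 2 * K0"
  obtain N c\<^sub>N where N: "4 \<le> N" "0 < c\<^sub>N" "\<And>(M :: 'w measure) S t a. driftless_subordinator M S \<nu> \<Longrightarrow> 0 < t \<Longrightarrow>
     pl.T t \<le> a \<Longrightarrow> c\<^sub>N * (t * levy_tail \<nu> a) \<le> measure M {\<omega>\<in>space M. a < S t \<omega> \<and> S t \<omega> \<le> N * a}"
    using pl.block_lower_bound by blast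
  have V_mono: "V x r \<le> V x R" if "r \<le> R" for x r R
    unfolding V_def by (rule vol_mono[OF assms(8) that])
  have law_prob: "prob_space (law x t)" if "x \<in> D" "0 < t" for x t
  proof -
    interpret prob_space "P (Some x)" using sub[OF that(1)] by (simp add: driftless_subordinator_def)
    show ?thesis unfolding law_def using S that by (intro prob_space_distr)
  qed
  have law_sets: "sets (law x t) = sets borel" if "x \<in> D" "0 < t" for x t by (simp add: law_def)
  have law_between: "c\<^sub>e \<le> measure (law x t) {e * pl.T t<..pl.T t}" if "x \<in> D" "0 < t" for x t
    using e(4)[OF sub[OF that(1)] that(2)] that by (simp add: law)
  have law_below: "measure (law x t) {..\<epsilon> * pl.T t} \<le> exp (1 - b\<^sub>1 * (1 / \<epsilon>) powr \<beta>\<^sub>1)"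
    if "x \<in> D" "0 < t" "0 < \<epsilon>" "\<epsilon> \<le> 1" for x t \<epsilon>
  proof -
    interpret poly_subordinator "P (Some x)" S \<nu> b\<^sub>1 b\<^sub>2 \<beta>\<^sub>1 \<beta>\<^sub>2
      by unfold_locales (rule sub[OF that(1)])
    show ?thesis using prob_below_T[of t \<epsilon>] that by (simp add: law)
  qed
  have K: "2 \<le> K" using K0(1) by (simp add: K_def)
  have law_tail: "measure (law x t) {r..} \<le> C\<^sub>K * (t * levy_tail \<nu> r)" if "x \<in> D" "0 < t" "K * pl.T t \<le> r" for x t r
  proof -
    have "K0 * pl.T t \<le> K * pl.T t" using K0(1) pl.T_pos[OF that(2)] by (intro mult_right_mono) (auto simp: K_def)
    thus ?thesis using K0(3)[OF sub[OF that(1)] that(2), of r] that by (simp add: law)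
  qed
  have law_block: "c\<^sub>N * (t * levy_tail \<nu> a) \<le> measure (law x t) {a<..N * a}" if "x \<in> D" "0 < t" "pl.T t \<le> a" for x t a
    using N(3)[OF sub[OF that(1)] that(2,3)] that by (simp add: law)
  interpret sk: subordinate_kernel \<Phi> \<alpha>\<^sub>1 \<alpha>\<^sub>2 a\<^sub>1 a\<^sub>2 \<nu> b\<^sub>1 b\<^sub>2 \<beta>\<^sub>1 \<beta>\<^sub>2 \<Psi> D V h p law
    C\<^sub>0 C\<^sub>V d\<^sub>2 C\<^sub>h \<gamma> k\<^sub>1 k\<^sub>2 k\<^sub>3 k\<^sub>4 e c\<^sub>e K C\<^sub>K N c\<^sub>N
    by (intro subordinate_kernel.intro subordinate_kernel_axioms.intro)
      (fact \<Phi> pl \<Psi> C0 V_mono CV d2 h01 hanti h k p1 p2 p3 p4 law_prob law_sets e(1-3) law_between law_below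
        K K0(2) law_tail N(1,2) law_block)+
  have q_eq: "q t x y = sk.q t x y" for t x y
    by (simp add: q_def subordinate_heat_kernel_def sk.q_def law_def)
  have \<psi>0: "\<psi> 0 = 0" by (simp add: \<psi>_def sub_scale_def)
  have \<Phi>0: "\<Phi> 0 \<le> T t" if t: "0 < t" for t
  proof -
    obtain r where "0 < r" "\<Phi> r \<le> T t" using scale.\<Phi>_small[OF pl.T_pos[OF t]] by (auto simp: T_eq)
    thus ?thesis using scale.less[of 0 r] by simp
  qed
  have \<psi>_less: "t < \<psi> r \<longleftrightarrow> T t < \<Phi> r" and \<psi>_le: "t \<le> \<psi> r \<longleftrightarrow> 0 < r \<and> T t \<le> \<Phi> r" if "0 < t" "0 \<le> r" for t r
    using pl.less_sub_scale_iff[of t r \<Phi>] that scale.\<Phi>_pos[of r] \<Phi>0[OF that(1)] \<psi>0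
    by (cases "r = 0"; auto simp: \<psi>_def \<phi>_def T_eq)+
  have ginv_\<psi>: "ginv \<psi> t = ginv \<Phi> (T t)" if "0 < t" for t
    unfolding ginv_def using \<psi>_less[OF that] by (intro arg_cong[where f = Inf]) auto
  have T_inv: "a / ginv \<phi> (1 / t) = T t * a" for a t by (simp add: T_def)
  have J: "B t x y = sk.J x y (2 * T t) (4 * \<Phi> (dist x y))" for t x y
    by (simp add: B_def sk.J_def w_def)
  have rhs: "C\<^sub>0 / (V x (dist x y) * \<Psi> (dist x y)) * (t * B t x y + h (T t) x y / ginv \<phi> (1 / t))
       + h (T t) x y / V x (ginv \<psi> t) * exp (- c * (dist x y)\<^sup>2 / (ginv \<psi> t)\<^sup>2)
       + h (\<Phi> (dist x y)) x y * (t * w (\<Phi> (dist x y)) / V x (dist x y)) = sk.profile c t x y"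
    if "0 < t" for c t x y
    by (simp only: sk.profile_def J T_inv ginv_\<psi>[OF that] T_eq w_def)
  show ?thesis
  proof (rule conjI)
    obtain a c where a: "0 < a" "0 < c" and low: "\<And>t x y. 0 < t \<Longrightarrow> x \<in> D \<Longrightarrow> y \<in> D \<Longrightarrow>
      ennreal (a * (h (pl.T t) x y / V x (ginv \<Phi> (pl.T t)) * exp (- c * (dist x y)\<^sup>2 / (ginv \<Phi> (pl.T t))\<^sup>2))) \<le> sk.q t x y"
      using sk.gaussian_lower by blast
    obtain a' where a': "0 < a'" and up: "\<And>t x y. 0 < t \<Longrightarrow> x \<in> D \<Longrightarrow> y \<in> D \<Longrightarrow> below_diam D \<Phi> (pl.T t) \<Longrightarrow>
      sk.q t x y \<le> ennreal (a' * (h (pl.T t) x y / V x (ginv \<Phi> (pl.T t))))"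
      using sk.near_diagonal_upper by blast
    have ac: "0 < a * exp (- c)" using a by simp
    show "\<exists>a\<^sub>1>0. \<exists>a\<^sub>2>0. \<forall>t>0. \<forall>x\<in>D. \<forall>y\<in>D. \<psi> (dist x y) \<le> t \<longrightarrow>
        ennreal (a\<^sub>1 * (h (T t) x y / V x (ginv \<psi> t))) \<le> q t x y \<and>
        (below_diam D \<Phi> (T t) \<longrightarrow>
          q t x y \<le> ennreal (a\<^sub>2 * (h (T t) x y / V x (ginv \<psi> t))))"
    proof (rule exI[of _ "a * exp (- c)"], rule conjI[OF ac], rule exI[of _ a'], rule conjI[OF a'], intro allI ballI impI conjI)
      fix t x y assume t: "0 < (t::real)" and xy: "x \<in> D" "y \<in> D" and \<psi>t: "\<psi> (dist x y) \<le> t"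
      have T0: "0 < T t" using pl.T_pos[OF t] by (simp add: T_eq)
      have R: "0 < ginv \<Phi> (T t)" by (rule scale.ginv_pos[OF T0])
      have "\<Phi> (dist x y) \<le> T t" using \<psi>_less[OF t, of "dist x y"] \<psi>t by simp
      hence "dist x y \<le> ginv \<Phi> (T t)" by (intro scale.ginv_lower) auto
      hence "(dist x y)\<^sup>2 \<le> (ginv \<Phi> (T t))\<^sup>2" by (intro power_mono) auto
      hence "c * ((dist x y)\<^sup>2 / (ginv \<Phi> (T t))\<^sup>2) \<le> c * 1" using R a by (intro mult_left_mono) auto
      hence "exp (- c) \<le> exp (- c * (dist x y)\<^sup>2 / (ginv \<Phi> (T t))\<^sup>2)" by simp
      moreover have "0 \<le> h (T t) x y / V x (ginv \<Phi> (T t))" using h01[OF T0 xy] CV(2)[OF R, of x] by simp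
      ultimately have "a * (h (T t) x y / V x (ginv \<Phi> (T t)) * exp (- c))
         \<le> a * (h (T t) x y / V x (ginv \<Phi> (T t)) * exp (- c * (dist x y)\<^sup>2 / (ginv \<Phi> (T t))\<^sup>2))"
        using a by (intro mult_left_mono) auto
      hence "ennreal (a * (h (T t) x y / V x (ginv \<Phi> (T t)) * exp (- c))) \<le> sk.q t x y"
        using low[OF t xy] unfolding T_eq by (rule order_trans[OF ennreal_leI])
      thus "ennreal (a * exp (- c) * (h (T t) x y / V x (ginv \<psi> t))) \<le> q t x y"
        unfolding q_eq ginv_\<psi>[OF t] by (simp only: mult_ac)
      assume "below_diam D \<Phi> (T t)"
      thus "q t x y \<le> ennreal (a' * (h (T t) x y / V x (ginv \<psi> t)))"
        using up[OF t xy] unfolding q_eq ginv_\<psi>[OF t] T_eq by simp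
    qed
  next
    obtain a c where a: "0 < a" "0 < c" and low: "\<And>t x y. 0 < t \<Longrightarrow> x \<in> D \<Longrightarrow> y \<in> D \<Longrightarrow>
      0 < dist x y \<and> pl.T t \<le> \<Phi> (dist x y) \<Longrightarrow> ennreal (a * sk.profile c t x y) \<le> sk.q t x y"
      using sk.off_diagonal_lower by blast
    obtain a' c' where a': "0 < a'" "0 < c'" and up: "\<And>t x y. 0 < t \<Longrightarrow> x \<in> D \<Longrightarrow> y \<in> D \<Longrightarrow>
      0 < dist x y \<and> pl.T t \<le> \<Phi> (dist x y) \<Longrightarrow> sk.q t x y \<le> ennreal (a' * sk.profile c' t x y)"
      using sk.off_diagonal_upper by blast
    show "\<exists>a\<^sub>1>0. \<exists>a\<^sub>2>0. \<exists>a\<^sub>3>0. \<exists>a\<^sub>4>0. \<forall>t>0. \<forall>x\<in>D. \<forall>y\<in>D. \<psi> (dist x y) \<ge> t \<longrightarrow>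
        (let r = dist x y;
             rhs = (\<lambda>c. C\<^sub>0 / (V x r * \<Psi> r) * (t * B t x y + h (T t) x y / ginv \<phi> (1 / t))
                       + h (T t) x y / V x (ginv \<psi> t) * exp (- c * r\<^sup>2 / (ginv \<psi> t)\<^sup>2)
                       + h (\<Phi> r) x y * (t * w (\<Phi> r) / V x r))
         in ennreal (a\<^sub>1 * rhs a\<^sub>2) \<le> q t x y \<and> q t x y \<le> ennreal (a\<^sub>3 * rhs a\<^sub>4))"
    proof (rule exI[of _ a], rule conjI[OF a(1)], rule exI[of _ c], rule conjI[OF a(2)],
        rule exI[of _ a'], rule conjI[OF a'(1)], rule exI[of _ c'], rule conjI[OF a'(2)], intro allI ballI impI)
      fix t x y assume t: "0 < (t::real)" and xy: "x \<in> D" "y \<in> D" and \<psi>t: "t \<le> \<psi> (dist x y)"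
      have r: "0 < dist x y \<and> pl.T t \<le> \<Phi> (dist x y)" using \<psi>_le[OF t, of "dist x y"] \<psi>t by (simp add: T_eq)
      show "let r = dist x y;
             rhs = (\<lambda>c. C\<^sub>0 / (V x r * \<Psi> r) * (t * B t x y + h (T t) x y / ginv \<phi> (1 / t))
                       + h (T t) x y / V x (ginv \<psi> t) * exp (- c * r\<^sup>2 / (ginv \<psi> t)\<^sup>2)
                       + h (\<Phi> r) x y * (t * w (\<Phi> r) / V x r))
         in ennreal (a * rhs c) \<le> q t x y \<and> q t x y \<le> ennreal (a' * rhs c')"
        unfolding Let_def rhs[OF t] q_eq by (intro conjI low up t xy r)
    qed
  qed
qed

end
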